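(* Let $x$ be an abstract vector variable, $Y=\{y_1,\dots,y_N\}$ a finite set of further abstract vector variables, and $k\ge0$. After localizing $\mathbb T_Y$ by $D^Y_k$, one has $$(H^Y_{k+1})_{D^Y_k}=\ker\Bigl(\partial^{Y,\mathrm R}_{x,q}:(H^Y_{k+1})_{D^Y_k}\to(H^Y_k)_{D^Y_k}\Bigr)\oplus R_x(H^Y_k)_{D^Y_k}.$$ The projection onto the right $q$-monogenic summand (the kernel) is $$\Pi^Y_{k+1}=I-R_x(\mathcal K^Y_k)^{-1}\partial^{Y,\mathrm R}_{x,q}.$$
   Context: **Radial algebra.** For a set $S$ of abstract vector variables, $R(S)$ is the associative unital $\mathbb R$-algebra generated by $S$ subject to $[\{u,v\},w]=0$ for all $u,v,w\in S$, where $\{a,b\}=ab+ba$, $[a,b]=ab-ba$. The wedge is the antisymmetrized product $u_1\wedge\cdots\wedge u_p=\frac1{p!}\sum_{\pi}\operatorname{sgn}(\pi)u_{\pi(1)}\cdots u_{\pi(p)}$ (empty wedge $=1$). **Coefficients.** $q,Q$ are algebraically independent indeterminates, $\mathbb B=\mathbb R[q,q^{-1},Q,(1-q)^{-1}]$, $R_{\mathbb B}(S)=\mathbb B\otimes_{\mathbb R}R(S)$. For integers $n,a$: $[n]_q=\frac{1-q^n}{1-q}$, $q^{m+a}:=Qq^a$, $[m+a]_q:=\frac{1-Qq^a}{1-q}$ ($m$ is only a formal symbol). **Scalars.** $r=x^2$, $s_i=\{x,y_i\}$, $c_{ij}=\{y_i,y_j\}=c_{ji}$ are central and $\mathcal A_x(Y)=\mathbb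 B[r,s_1,\dots,s_N,c_{ij}:1\le i\le j\le N]$ is a polynomial algebra. For $I=\{i_1<\cdots<i_p\}\subset\{1,\dots,N\}$, $y_I=y_{i_1}\wedge\cdots\wedge y_{i_p}$, $y_\varnothing=1$. It is known that $R_{\mathbb B}(\{x\}\cup Y)=\bigoplus_I y_I\mathcal A_x(Y)\oplus\bigoplus_I(x\wedge y_I)\mathcal A_x(Y)$, free over $\mathcal A_x(Y)$ on the elements $y_I,\ x\wedge y_I$. **Jackson operators.** For a scalar variable $u$ and parameter $P$: $\delta^{(u)}_Pf=\frac{f(u)-f(Pu)}{(1-P)u}$, $T^{(u)}_Pf(u)=f(Pu)$. For $A\in\mathcal A_x(Y)$, $$\partial^{\mathrm{sc},Y}_{x,q}A=(1+q)\,x\,\delta^{(r)}_{q^2}A+2\sum_{i=1}^N y_i\,T^{(r)}_{q^2}\delta^{(s_i)}_qA.$$ **Finite relative right $q$-vector derivative.** $\partial^{Y,\mathrm R}_{x,q}$ is the $\mathbb B$-linear operator on $R_{\mathbb B}(\{x\}\cup Y)$ with, for $p=|I|$ and $A,B\in\mathcal A_x(Y)$, $$\partial^{Y,\mathrm R}_{x,q}(y_IA)=y_I\,\partial^{\mathrm{sc},Y}_{x,q}(A),\qquad \partial^{Y,\mathrm R}_{x,q}((x\wedge y_I)B)=(-1)^p[m-p]_q\,y_IB+q^{m-p}(x\wedge y_I)\,\partial^{\mathrm{sc},Y}_{x,q}(B).$$ **Homogeneous blocks.** The $x$-degree is $\deg_xr=2$, $\deg_xs_i=1$, $\deg_xc_{ij}=0$,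 $\deg_xy_I=0$, $\deg_x(x\wedge y_I)=1$. $\mathbb T_Y=\mathbb B[c_{ij}:1\le i\le j\le N]$. $H^Y_n$ is the degree-$n$ component, a finite free $\mathbb T_Y$-module with basis $y_Ir^as^\beta$ ($2a+|\beta|=n$) and $(x\wedge y_I)r^as^\beta$ ($1+2a+|\beta|=n$). With $R_xF=Fx$ one has $R_xH^Y_n\subseteq H^Y_{n+1}$, $\partial^{Y,\mathrm R}_{x,q}H^Y_{n+1}\subseteq H^Y_n$, both $\mathbb T_Y$-linear. $\mathcal K^Y_k:=\partial^{Y,\mathrm R}_{x,q}R_x|_{H^Y_k}:H^Y_k\to H^Y_k$ and $D^Y_k:=\det\mathcal K^Y_k\in\mathbb T_Y$ (a nonzero element). The subscript $D^Y_k$ means localization at $\{1,D^Y_k,(D^Y_k)^2,\dots\}$; operators are extended $\mathbb T_Y$-linearly. An element of the kernel of $\partial^{Y,\mathrm R}_{x,q}$ is called right $q$-monogenic. *)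

theory Defs
  imports
    "HOL-Computational_Algebra.Polynomial"
    "HOL-Computational_Algebra.Fraction_Field"
    "HOL-Combinatorics.Permutations"
    "HOL-Algebra.AbelCoset"
    "HOL-Algebra.Module"
    "Jordan_Normal_Form.Determinant"
    "HOL-Library.Poly_Mapping"
begin

section \<open>The coefficient ring\<close>

text \<open>The ring \<open>\<real>[q, 1/q, Q, 1/(1-q)]\<close> is realised inside the field of fractions of the polynomial
  ring \<open>\<real>[q][Q]\<close>: the inner polynomial variable is \<open>q\<close>, the outer one is \<open>Q\<close>.\<close>

abbreviation fr_q :: "real poly poly fract" where
  "fr_q \<equiv> Fract [:[:0, 1:]:] 1"

abbreviation fr_Q :: "real poly poly fract" where
  "fr_Q \<equiv> Fract [:0, 1:] 1"

abbreviation fr_const :: "real \<Rightarrow> real poly poly fract" where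
  "fr_const c \<equiv> Fract [:[:c:]:] 1"

inductive_set qcoeff_set :: "real poly poly fract set" where
  const: "fr_const c \<in> qcoeff_set"
| q: "fr_q \<in> qcoeff_set"
| q_inv: "inverse fr_q \<in> qcoeff_set"
| Q: "fr_Q \<in> qcoeff_set"
| one_minus_q_inv: "inverse (1 - fr_q) \<in> qcoeff_set"
| add: "a \<in> qcoeff_set \<Longrightarrow> b \<in> qcoeff_set \<Longrightarrow> a + b \<in> qcoeff_set"
| mult: "a \<in> qcoeff_set \<Longrightarrow> b \<in> qcoeff_set \<Longrightarrow> a * b \<in> qcoeff_set"

lemma fr_const_add: "fr_const (a + b) = fr_const a + fr_const b"
  by simp

lemma fr_const_mult: "fr_const (a * b) = fr_const a * fr_const b"
  by simp

lemma fr_const_0: "fr_const 0 = 0" and fr_const_1: "fr_const 1 = 1"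
  by (simp_all add: Zero_fract_def One_fract_def one_pCons)

lemma qcoeff_set_0: "0 \<in> qcoeff_set" and qcoeff_set_1: "1 \<in> qcoeff_set"
  using qcoeff_set.const[of 0] qcoeff_set.const[of 1] by (simp_all only: fr_const_0 fr_const_1)

lemma qcoeff_set_uminus: "a \<in> qcoeff_set \<Longrightarrow> - a \<in> qcoeff_set"
proof -
  assume a: "a \<in> qcoeff_set"
  have "fr_const (-1) = - 1"
    by (simp add: One_fract_def one_pCons)
  then have "- a = fr_const (-1) * a" by simp
  then show ?thesis using qcoeff_set.mult[OF qcoeff_set.const a] by metis
qed

lemma qcoeff_set_minus: "a \<in> qcoeff_set \<Longrightarrow> b \<in> qcoeff_set \<Longrightarrow> a - b \<in> qcoeff_set"
  using qcoeff_set.add[OF _ qcoeff_set_uminus, of a b] by simp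

typedef qcoeff = qcoeff_set
  using qcoeff_set_0 by blast

setup_lifting type_definition_qcoeff

instantiation qcoeff :: comm_ring_1
begin

lift_definition zero_qcoeff :: qcoeff is 0 by (rule qcoeff_set_0)
lift_definition one_qcoeff :: qcoeff is 1 by (rule qcoeff_set_1)
lift_definition plus_qcoeff :: "qcoeff \<Rightarrow> qcoeff \<Rightarrow> qcoeff" is "(+)" by (rule qcoeff_set.add)
lift_definition times_qcoeff :: "qcoeff \<Rightarrow> qcoeff \<Rightarrow> qcoeff" is "(*)" by (rule qcoeff_set.mult)
lift_definition uminus_qcoeff :: "qcoeff \<Rightarrow> qcoeff" is uminus by (rule qcoeff_set_uminus)
lift_definition minus_qcoeff :: "qcoeff \<Rightarrow> qcoeff \<Rightarrow> qcoeff" is "(-)" by (rule qcoeff_set_minus)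

instance
  by standard (transfer; simp add: algebra_simps)+

end

instantiation qcoeff :: real_algebra_1
begin

lift_definition scaleR_qcoeff :: "real \<Rightarrow> qcoeff \<Rightarrow> qcoeff" is "\<lambda>c a. fr_const c * a"
  by (intro qcoeff_set.intros)

instance
proof
  fix a b :: real and x y :: qcoeff
  show "a *\<^sub>R (x + y) = a *\<^sub>R x + a *\<^sub>R y"
    by transfer (simp only: distrib_left)
  show "(a + b) *\<^sub>R x = a *\<^sub>R x + b *\<^sub>R x"
    by transfer (simp only: fr_const_add distrib_right)
  show "a *\<^sub>R b *\<^sub>R x = (a * b) *\<^sub>R x"
    by transfer (simp only: fr_const_mult mult.assoc)
  show "1 *\<^sub>R x = x"
    by transfer (simp only: fr_const_1 mult_1)
  show "a *\<^sub>R x * y = a *\<^sub>R (x * y)"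
    by transfer (simp only: mult.assoc)
  show "x * a *\<^sub>R y = a *\<^sub>R (x * y)"
    by transfer (simp only: mult.left_commute)
qed

end

lift_definition qq :: qcoeff is fr_q by (rule qcoeff_set.q)
lift_definition qq_inv :: qcoeff is "inverse fr_q" by (rule qcoeff_set.q_inv)
lift_definition QQ :: qcoeff is fr_Q by (rule qcoeff_set.Q)
lift_definition one_minus_qq_inv :: qcoeff is "inverse (1 - fr_q)"
  by (rule qcoeff_set.one_minus_q_inv)

definition qq_powi :: "int \<Rightarrow> qcoeff" where
  "qq_powi a = (if a \<ge> 0 then qq ^ nat a else qq_inv ^ nat (- a))"

text \<open>\<open>q_m_pow a\<close> is \<open>q\<^sup>m\<^sup>+\<^sup>a = Q q\<^sup>a\<close> and \<open>q_m_bracket a\<close> is \<open>[m + a]\<^sub>q\<close>, with \<open>m\<close> a formal symbol.\<close>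

definition q_m_pow :: "int \<Rightarrow> qcoeff" where
  "q_m_pow a = QQ * qq_powi a"

definition q_m_bracket :: "int \<Rightarrow> qcoeff" where
  "q_m_bracket a = (1 - QQ * qq_powi a) * one_minus_qq_inv"


section \<open>The radial algebra\<close>

text \<open>Finitely supported functions on words, with concatenation of words as the exponent monoid,
  form the free associative unital algebra.\<close>

instantiation list :: (type) monoid_add
begin

definition zero_list :: "'a list" where "zero_list = []"
definition plus_list :: "'a list \<Rightarrow> 'a list \<Rightarrow> 'a list" where "plus_list = (@)"

instance
  by standard (simp_all add: zero_list_def plus_list_def)

end

type_synonym ('v, 'k) free_alg = "'v list \<Rightarrow>\<^sub>0 'k"

definition free_var :: "'v \<Rightarrow> ('v, 'k::comm_ring_1) free_alg" where
  "free_var v = Poly_Mapping.single [v] 1"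

definition free_const :: "'k::comm_ring_1 \<Rightarrow> ('v, 'k) free_alg" where
  "free_const c = Poly_Mapping.single [] c"

definition anticomm :: "'a::ring \<Rightarrow> 'a \<Rightarrow> 'a" where
  "anticomm a b = a * b + b * a"

definition commut :: "'a::ring \<Rightarrow> 'a \<Rightarrow> 'a" where
  "commut a b = a * b - b * a"

inductive_set radial_ideal :: "('v, 'k::comm_ring_1) free_alg set" where
  rel: "commut (anticomm (free_var u) (free_var v)) (free_var w) \<in> radial_ideal"
| zero: "0 \<in> radial_ideal"
| add: "f \<in> radial_ideal \<Longrightarrow> g \<in> radial_ideal \<Longrightarrow> f + g \<in> radial_ideal"
| mult: "f \<in> radial_ideal \<Longrightarrow> a * f * b \<in> radial_ideal"

lemma radial_ideal_left: "f \<in> radial_ideal \<Longrightarrow> a * f \<in> radial_ideal"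
  using radial_ideal.mult[of f a 1] by simp

lemma radial_ideal_right: "f \<in> radial_ideal \<Longrightarrow> f * b \<in> radial_ideal"
  using radial_ideal.mult[of f 1 b] by simp

lemma radial_ideal_uminus: "f \<in> radial_ideal \<Longrightarrow> - f \<in> radial_ideal"
  using radial_ideal_left[of f "- 1"] by simp

definition radial_rel :: "('v, 'k::comm_ring_1) free_alg \<Rightarrow> ('v, 'k) free_alg \<Rightarrow> bool" where
  "radial_rel f g \<longleftrightarrow> f - g \<in> radial_ideal"

lemma equivp_radial_rel: "equivp (radial_rel :: ('v, 'k::comm_ring_1) free_alg \<Rightarrow> ('v, 'k) free_alg \<Rightarrow> bool)"
proof (rule equivpI)
  show "reflp (radial_rel :: ('v, 'k) free_alg \<Rightarrow> _)"
    by (auto intro!: reflpI simp: radial_rel_def radial_ideal.zero)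
  show "symp (radial_rel :: ('v, 'k) free_alg \<Rightarrow> _)"
  proof (rule sympI)
    fix f g :: "('v, 'k) free_alg"
    assume "radial_rel f g"
    then show "radial_rel g f"
      using radial_ideal_uminus[of "f - g"] by (simp add: radial_rel_def)
  qed
  show "transp (radial_rel :: ('v, 'k) free_alg \<Rightarrow> _)"
  proof (rule transpI)
    fix f g h :: "('v, 'k) free_alg"
    assume "radial_rel f g" "radial_rel g h"
    then show "radial_rel f h"
      using radial_ideal.add[of "f - g" "g - h"] by (simp add: radial_rel_def)
  qed
qed

text \<open>With \<open>S\<close> the universe of the type \<open>'v\<close>, the type \<open>('v, real) radial\<close> is \<open>R(S)\<close>; since
  extension of scalars commutes with presentations, \<open>('v, qcoeff) radial\<close> is \<open>R(S)\<close> tensored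
  over the reals with the coefficient ring.\<close>

quotient_type (overloaded) ('v, 'k) radial = "'v list \<Rightarrow>\<^sub>0 'k::comm_ring_1" / radial_rel
  by (rule equivp_radial_rel)

lemma lookup_mult_Nil:
  fixes f g :: "('v, 'k::comm_ring_1) free_alg"
  shows "Poly_Mapping.lookup (f * g) [] = Poly_Mapping.lookup f [] * Poly_Mapping.lookup g []"
proof -
  have "([] = l + p) \<longleftrightarrow> p = [] \<and> l = []" for l p :: "'v list"
    by (auto simp: plus_list_def)
  then have "(Poly_Mapping.lookup g p when [] = l + p) =
      ((Poly_Mapping.lookup g p when l = []) when p = [])"
    for l p :: "'v list"
    by (simp add: when_def)
  then have "Poly_Mapping.lookup (f * g) [] =
      (\<Sum>l. Poly_Mapping.lookup f l * (Poly_Mapping.lookup g [] when l = []))"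
    by (simp add: lookup_mult)
  also have "\<dots> = (\<Sum>l. Poly_Mapping.lookup f l * Poly_Mapping.lookup g [] when l = [])"
    by (rule arg_cong[where f = Sum_any]) (auto simp: when_def)
  finally show ?thesis by simp
qed

lemma radial_ideal_lookup_Nil: "f \<in> radial_ideal \<Longrightarrow> Poly_Mapping.lookup f [] = 0"
  by (induction rule: radial_ideal.induct)
     (simp_all add: commut_def lookup_mult_Nil mult.commute lookup_add lookup_minus)

instantiation radial :: (type, comm_ring_1) ring_1
begin

lift_definition zero_radial :: "('a, 'b) radial" is 0 .

lift_definition one_radial :: "('a, 'b) radial" is 1 .

lift_definition plus_radial :: "('a, 'b) radial \<Rightarrow> ('a, 'b) radial \<Rightarrow> ('a, 'b) radial" is "(+)"
proof -
  fix f f' g g' :: "('a, 'b) free_alg"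
  assume "radial_rel f f'" "radial_rel g g'"
  then show "radial_rel (f + g) (f' + g')"
    using radial_ideal.add[of "f - f'" "g - g'"] by (simp add: radial_rel_def algebra_simps)
qed

lift_definition uminus_radial :: "('a, 'b) radial \<Rightarrow> ('a, 'b) radial" is uminus
proof -
  fix f f' :: "('a, 'b) free_alg"
  assume "radial_rel f f'"
  then show "radial_rel (- f) (- f')"
    using radial_ideal_uminus[of "f - f'"] by (simp add: radial_rel_def)
qed

lift_definition minus_radial :: "('a, 'b) radial \<Rightarrow> ('a, 'b) radial \<Rightarrow> ('a, 'b) radial" is "(-)"
proof -
  fix f f' g g' :: "('a, 'b) free_alg"
  assume "radial_rel f f'" "radial_rel g g'"
  then show "radial_rel (f - g) (f' - g')"
    using radial_ideal.add[OF _ radial_ideal_uminus, of "f - f'" "g - g'"]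
    by (simp add: radial_rel_def algebra_simps)
qed

lift_definition times_radial :: "('a, 'b) radial \<Rightarrow> ('a, 'b) radial \<Rightarrow> ('a, 'b) radial" is "(*)"
proof -
  fix f f' g g' :: "('a, 'b) free_alg"
  assume "radial_rel f f'" "radial_rel g g'"
  then have "(f - f') * g + f' * (g - g') \<in> radial_ideal"
    by (auto simp: radial_rel_def intro: radial_ideal.add radial_ideal_left radial_ideal_right)
  then show "radial_rel (f * g) (f' * g')"
    by (simp add: radial_rel_def algebra_simps)
qed

instance
proof
  have one: "Poly_Mapping.lookup (1 :: ('a, 'b) free_alg) [] = 1"
    by (simp add: zero_list_def[symmetric] lookup_one)
  show "(0 :: ('a, 'b) radial) \<noteq> 1"
  proof transfer
    show "\<not> radial_rel 0 (1 :: ('a, 'b) free_alg)"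
    proof
      assume "radial_rel 0 (1 :: ('a, 'b) free_alg)"
      then have "- 1 \<in> (radial_ideal :: ('a, 'b) free_alg set)"
        by (simp add: radial_rel_def)
      from radial_ideal_lookup_Nil[OF this] one show False
        by simp
    qed
  qed
qed (transfer; simp add: algebra_simps radial_rel_def radial_ideal.zero)+

end

lift_definition rvar :: "'v \<Rightarrow> ('v, 'k::comm_ring_1) radial" is free_var .

lift_definition rconst :: "'k \<Rightarrow> ('v, 'k::comm_ring_1) radial" is free_const .

definition wedge :: "('v, 'k::{comm_ring_1, real_algebra_1}) radial list \<Rightarrow> ('v, 'k) radial" where
  "wedge us = rconst (of_real (1 / fact (length us))) *
     (\<Sum>\<pi> | \<pi> permutes {..<length us}.
        of_int (sign \<pi>) * prod_list (map (\<lambda>i. us ! \<pi> i) [0..<length us]))"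

type_synonym 'v RB = "('v, qcoeff) radial"


section \<open>The scalar polynomial algebra\<close>

text \<open>The indeterminates \<open>r\<close>, \<open>s\<^sub>i\<close> and \<open>c\<^sub>i\<^sub>j\<close>. Polynomials are finitely supported functions
  on exponent vectors. The type contains indeterminates for all indices; the sets \<open>A_alg N\<close> and
  \<open>T_alg N\<close> restrict them to \<open>1 \<le> i \<le> j \<le> N\<close>.\<close>

datatype svar = RV | SV nat | CV nat nat

type_synonym spoly = "(svar \<Rightarrow>\<^sub>0 nat) \<Rightarrow>\<^sub>0 qcoeff"

definition C_vars :: "nat \<Rightarrow> svar set" where
  "C_vars N = {CV i j | i j. 1 \<le> i \<and> i \<le> j \<and> j \<le> N}"

definition RS_vars :: "nat \<Rightarrow> svar set" where
  "RS_vars N = insert RV (SV ` {1..N})"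

definition T_alg :: "nat \<Rightarrow> spoly set" where
  "T_alg N = {t. \<forall>\<mu>\<in>Poly_Mapping.keys t. Poly_Mapping.keys \<mu> \<subseteq> C_vars N}"

definition A_alg :: "nat \<Rightarrow> spoly set" where
  "A_alg N = {A. \<forall>\<mu>\<in>Poly_Mapping.keys A. Poly_Mapping.keys \<mu> \<subseteq> RS_vars N \<union> C_vars N}"

definition sconst :: "qcoeff \<Rightarrow> spoly" where
  "sconst c = Poly_Mapping.single 0 c"

definition sindet :: "svar \<Rightarrow> spoly" where
  "sindet u = Poly_Mapping.single (Poly_Mapping.single u 1) 1"

text \<open>The substitution of \<open>P u\<close> for \<open>u\<close>, written out on monomials.\<close>

definition jackson_T :: "svar \<Rightarrow> qcoeff \<Rightarrow> spoly \<Rightarrow> spoly" where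
  "jackson_T u P f = Poly_Mapping.mapp (\<lambda>\<mu> c. P ^ Poly_Mapping.lookup \<mu> u * c) f"

text \<open>The quotient of \<open>f(u) - f(P u)\<close> by \<open>(1 - P) u\<close> is the unique solution of the equation below;
  it exists, and is unique, for the values \<open>q\<close> and \<open>q\<^sup>2\<close> of \<open>P\<close> which are used.\<close>

definition jackson_delta :: "svar \<Rightarrow> qcoeff \<Rightarrow> spoly \<Rightarrow> spoly" where
  "jackson_delta u P f = (THE g. sconst (1 - P) * sindet u * g = f - jackson_T u P f)"

definition xdeg :: "nat \<Rightarrow> (svar \<Rightarrow>\<^sub>0 nat) \<Rightarrow> nat" where
  "xdeg N \<mu> = 2 * Poly_Mapping.lookup \<mu> RV + (\<Sum>i=1..N. Poly_Mapping.lookup \<mu> (SV i))"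


section \<open>The relative vector derivative\<close>

text \<open>The set of variables is the whole type \<open>'v\<close>: \<open>x\<close> is one of them, and the definitions are meant
  for \<open>y 1, \<dots>, y N\<close> enumerating all others without repetition.\<close>

context
  fixes x :: 'v and y :: "nat \<Rightarrow> 'v" and N :: nat
begin

definition xv :: "'v RB" where
  "xv = rvar x"

definition yv :: "nat \<Rightarrow> 'v RB" where
  "yv i = rvar (y i)"

text \<open>Evaluation of a polynomial at \<open>r = x\<^sup>2\<close>, \<open>s\<^sub>i = {x, y\<^sub>i}\<close>, \<open>c\<^sub>i\<^sub>j = {y\<^sub>i, y\<^sub>j}\<close>; these are central, so
  that the order of the factors is immaterial.\<close>

definition eval_mono :: "(svar \<Rightarrow>\<^sub>0 nat) \<Rightarrow> 'v RB" where
  "eval_mono \<mu> = (xv\<^sup>2) ^ Poly_Mapping.lookup \<mu> RV *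
     prod_list (map (\<lambda>i. anticomm xv (yv i) ^ Poly_Mapping.lookup \<mu> (SV i)) [1..<Suc N]) *
     prod_list (map (\<lambda>(i, j). anticomm (yv i) (yv j) ^ Poly_Mapping.lookup \<mu> (CV i j))
       [(i, j). i \<leftarrow> [1..<Suc N], j \<leftarrow> [i..<Suc N]])"

definition ev :: "spoly \<Rightarrow> 'v RB" where
  "ev A = (\<Sum>\<mu>\<in>Poly_Mapping.keys A. rconst (Poly_Mapping.lookup A \<mu>) * eval_mono \<mu>)"

definition y_wedge :: "nat set \<Rightarrow> 'v RB" where
  "y_wedge I = wedge (map yv (sorted_list_of_set I))"

definition xy_wedge :: "nat set \<Rightarrow> 'v RB" where
  "xy_wedge I = wedge (xv # map yv (sorted_list_of_set I))"

definition scalar_deriv :: "spoly \<Rightarrow> 'v RB" where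
  "scalar_deriv A =
     rconst (1 + qq) * xv * ev (jackson_delta RV (qq\<^sup>2) A) +
     2 * (\<Sum>i=1..N. yv i * ev (jackson_T RV (qq\<^sup>2) (jackson_delta (SV i) qq A)))"

definition is_right_qderiv :: "('v RB \<Rightarrow> 'v RB) \<Rightarrow> bool" where
  "is_right_qderiv d \<longleftrightarrow>
     module_hom (\<lambda>b F. rconst b * F) (\<lambda>b F. rconst b * F) d \<and>
     (\<forall>I A. I \<subseteq> {1..N} \<longrightarrow> A \<in> A_alg N \<longrightarrow>
        d (y_wedge I * ev A) = y_wedge I * scalar_deriv A) \<and>
     (\<forall>I B. I \<subseteq> {1..N} \<longrightarrow> B \<in> A_alg N \<longrightarrow>
        d (xy_wedge I * ev B) =
          (- 1) ^ card I * rconst (q_m_bracket (- int (card I))) * y_wedge I * ev B +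
          rconst (q_m_pow (- int (card I))) * xy_wedge I * scalar_deriv B)"

text \<open>Existence and uniqueness rest on the freeness of the algebra over the scalar polynomials, with
  basis \<open>y\<^sub>I\<close> and \<open>x \<and> y\<^sub>I\<close>.\<close>

definition right_qderiv :: "'v RB \<Rightarrow> 'v RB" where
  "right_qderiv = (THE d. is_right_qderiv d)"

definition right_mult_x :: "'v RB \<Rightarrow> 'v RB" where
  "right_mult_x F = F * xv"


section \<open>Homogeneous blocks\<close>

text \<open>\<open>A_hom n e\<close>: the scalar polynomials of \<open>x\<close>-degree \<open>n - e\<close> (only \<open>0\<close>, if \<open>n < e\<close>).\<close>

definition A_hom :: "nat \<Rightarrow> nat \<Rightarrow> spoly set" where
  "A_hom n e = {A \<in> A_alg N. \<forall>\<mu>\<in>Poly_Mapping.keys A. e + xdeg N \<mu> = n}"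

definition H_block :: "nat \<Rightarrow> 'v RB set" where
  "H_block n = {\<Sum>I\<in>Pow {1..N}. y_wedge I * ev (A I) + xy_wedge I * ev (B I) | A B.
     (\<forall>I\<in>Pow {1..N}. A I \<in> A_hom n 0 \<and> B I \<in> A_hom n 1)}"

definition T_act :: "spoly \<Rightarrow> 'v RB \<Rightarrow> 'v RB" where
  "T_act t F = F * ev t"

text \<open>The basis of \<open>H_block n\<close> over the polynomials in the \<open>c\<^sub>i\<^sub>j\<close>: the index \<open>(e, I, \<mu>)\<close>, where
  \<open>\<mu>\<close> is a monomial in \<open>r\<close> and the \<open>s\<^sub>i\<close>, belongs to \<open>y\<^sub>I \<mu>\<close> if \<open>e\<close> is false and to
  \<open>(x \<and> y\<^sub>I) \<mu>\<close> if \<open>e\<close> is true.\<close>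

definition H_basis_index :: "nat \<Rightarrow> (bool \<times> nat set \<times> (svar \<Rightarrow>\<^sub>0 nat)) set" where
  "H_basis_index n = {(e, I, \<mu>). I \<subseteq> {1..N} \<and>
     Poly_Mapping.keys \<mu> \<subseteq> RS_vars N \<and> of_bool e + xdeg N \<mu> = n}"

definition H_basis :: "bool \<times> nat set \<times> (svar \<Rightarrow>\<^sub>0 nat) \<Rightarrow> 'v RB" where
  "H_basis = (\<lambda>(e, I, \<mu>). (if e then xy_wedge I else y_wedge I) * eval_mono \<mu>)"

definition H_coords :: "nat \<Rightarrow> 'v RB \<Rightarrow> bool \<times> nat set \<times> (svar \<Rightarrow>\<^sub>0 nat) \<Rightarrow> spoly" where
  "H_coords n F = (THE c. c \<in> H_basis_index n \<rightarrow>\<^sub>E T_alg N \<and>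
     F = (\<Sum>b\<in>H_basis_index n. T_act (c b) (H_basis b)))"

text \<open>The determinant of an endomorphism of \<open>H_block n\<close>; it does not depend on the enumeration of the
  basis.\<close>

definition H_det :: "nat \<Rightarrow> ('v RB \<Rightarrow> 'v RB) \<Rightarrow> spoly" where
  "H_det n f = (let bs = (SOME bs. distinct bs \<and> set bs = H_basis_index n) in
     det (mat (length bs) (length bs) (\<lambda>(i, j). H_coords n (f (H_basis (bs ! j))) (bs ! i))))"

definition K_op :: "'v RB \<Rightarrow> 'v RB" where
  "K_op F = right_qderiv (right_mult_x F)"

definition D_det :: "nat \<Rightarrow> spoly" where
  "D_det k = H_det k K_op"

end


section \<open>Localisation\<close>

text \<open>Localisation of a module \<open>M\<close>, a set of elements of a type on which scalars act by \<open>act\<close>, at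
  a multiplicative set \<open>S\<close> of scalars: fractions are classes of pairs \<open>(m, s)\<close>.\<close>

definition loc_rel ::
  "('a::comm_ring_1 \<Rightarrow> 'm::ab_group_add \<Rightarrow> 'm) \<Rightarrow> 'a set \<Rightarrow> 'm set \<Rightarrow> (('m \<times> 'a) \<times> ('m \<times> 'a)) set" where
  "loc_rel act S M = {((m, s), (m', s')). m \<in> M \<and> m' \<in> M \<and> s \<in> S \<and> s' \<in> S \<and>
     (\<exists>u\<in>S. act u (act s' m - act s m') = 0)}"

definition loc_frac ::
  "('a::comm_ring_1 \<Rightarrow> 'm::ab_group_add \<Rightarrow> 'm) \<Rightarrow> 'a set \<Rightarrow> 'm set \<Rightarrow> 'm \<Rightarrow> 'a \<Rightarrow> ('m \<times> 'a) set" where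
  "loc_frac act S M m s = loc_rel act S M `` {(m, s)}"

definition loc_ring :: "'a::comm_ring_1 set \<Rightarrow> 'a set \<Rightarrow> ('a \<times> 'a) set ring" where
  "loc_ring S T =
    \<lparr>carrier = (T \<times> S) // loc_rel (*) S T,
     monoid.mult = (\<lambda>X Y. \<Union>(a, s)\<in>X. \<Union>(b, t)\<in>Y. loc_frac (*) S T (a * b) (s * t)),
     one = loc_frac (*) S T 1 1,
     zero = loc_frac (*) S T 0 1,
     add = (\<lambda>X Y. \<Union>(a, s)\<in>X. \<Union>(b, t)\<in>Y. loc_frac (*) S T (t * a + s * b) (s * t))\<rparr>"

text \<open>The multiplicative part of the record of a module is not used.\<close>

definition loc_module ::
  "('a::comm_ring_1 \<Rightarrow> 'm::ab_group_add \<Rightarrow> 'm) \<Rightarrow> 'a set \<Rightarrow> 'm set \<Rightarrow> (('a \<times> 'a) set, ('m \<times> 'a) set) module"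
where
  "loc_module act S M =
    \<lparr>carrier = (M \<times> S) // loc_rel act S M,
     monoid.mult = undefined,
     one = undefined,
     zero = loc_frac act S M 0 1,
     add = (\<lambda>X Y. \<Union>(m, s)\<in>X. \<Union>(n, t)\<in>Y. loc_frac act S M (act t m + act s n) (s * t)),
     module.smult = (\<lambda>C X. \<Union>(a, t)\<in>C. \<Union>(m, s)\<in>X. loc_frac act S M (act a m) (t * s))\<rparr>"

text \<open>The extension of \<open>f\<close> to fractions, with values in the localisation of \<open>M'\<close>.\<close>

definition loc_map ::
  "('a::comm_ring_1 \<Rightarrow> 'm::ab_group_add \<Rightarrow> 'm) \<Rightarrow> 'a set \<Rightarrow> 'm set \<Rightarrow> ('m \<Rightarrow> 'm) \<Rightarrow>
    ('m \<times> 'a) set \<Rightarrow> ('m \<times> 'a) set" where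
  "loc_map act S M' f X = (\<Union>(m, s)\<in>X. loc_frac act S M' (f m) s)"

definition internal_direct_sum ::
  "('a, 'r) ring_scheme \<Rightarrow> ('a, 'b, 'm) module_scheme \<Rightarrow> 'b set \<Rightarrow> 'b set \<Rightarrow> bool" where
  "internal_direct_sum R M U W \<longleftrightarrow>
     submodule U R M \<and> submodule W R M \<and> U <+>\<^bsub>M\<^esub> W = carrier M \<and> U \<inter> W = {\<zero>\<^bsub>M\<^esub>}"

context
  fixes x :: 'v and y :: "nat \<Rightarrow> 'v" and N k :: nat
begin

definition D_powers :: "spoly set" where
  "D_powers = range (\<lambda>i. D_det x y N k ^ i)"

definition T_loc :: "(spoly \<times> spoly) set ring" where
  "T_loc = loc_ring D_powers (T_alg N)"

definition H_loc :: "nat \<Rightarrow> ((spoly \<times> spoly) set, ('v RB \<times> spoly) set) module" where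
  "H_loc n = loc_module (T_act x y N) D_powers (H_block x y N n)"

definition op_loc ::
  "nat \<Rightarrow> ('v RB \<Rightarrow> 'v RB) \<Rightarrow> ('v RB \<times> spoly) set \<Rightarrow> ('v RB \<times> spoly) set" where
  "op_loc n f = loc_map (T_act x y N) D_powers (H_block x y N n) f"

definition qderiv_loc :: "('v RB \<times> spoly) set \<Rightarrow> ('v RB \<times> spoly) set" where
  "qderiv_loc = op_loc k (right_qderiv x y N)"

definition Rx_loc :: "('v RB \<times> spoly) set \<Rightarrow> ('v RB \<times> spoly) set" where
  "Rx_loc = op_loc (k + 1) (right_mult_x x)"

definition K_loc :: "('v RB \<times> spoly) set \<Rightarrow> ('v RB \<times> spoly) set" where
  "K_loc = op_loc k (K_op x y N)"

definition monogenic_loc :: "('v RB \<times> spoly) set set" where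
  "monogenic_loc = a_kernel (H_loc (k + 1)) (H_loc k) qderiv_loc"

definition Pi_loc :: "('v RB \<times> spoly) set \<Rightarrow> ('v RB \<times> spoly) set" where
  "Pi_loc F = F \<ominus>\<^bsub>H_loc (k + 1)\<^esub> Rx_loc (inv_into (carrier (H_loc k)) K_loc (qderiv_loc F))"

end

end

theory Submission
  imports Defs
begin

text \<open>The derivative is well defined because the wedge products \<open>y\<^sub>I\<close> and \<open>x \<and> y\<^sub>I\<close> form a basis over
  the scalar polynomials. They span, because reordering a product of vectors only creates products
  with fewer vectors and a scalar factor. They are independent, because the algebra acts on the
  exterior algebra by a Clifford representation, in which a wedge product sends the vacuum to the
  corresponding exterior monomial plus terms of lower degree. A block consists of the elements with a
  fixed number of factors \<open>x\<close>, so that multiplication by \<open>x\<close> raises it by one and the derivative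
  lowers it by one.

  By means of the adjugate matrix, the determinant \<open>D\<close> of \<open>K\<close>, the derivative after multiplication
  by \<open>x\<close>, annihilates the kernel and the cokernel of \<open>K\<close>. So \<open>K\<close> is bijective after inverting
  \<open>D\<close>, and a factorisation of a bijection through a module splits that module.\<close>

section \<open>Localisation of modules\<close>

text \<open>The obstacle is that \<open>right_qderiv\<close> and \<open>H_coords\<close> are
  definite descriptions, which say something only once the wedge products are known to be a basis,
  whereas the radial algebra is a quotient of a free algebra by an ideal given through generators.
  That an element is nonzero has to be seen in a module on which this ideal acts by zero. Spanning
  and independence rest on one congruence, between a wedge and the ordered product of its letters,
  taken modulo two different subgroups; the locale \<open>reordering\<close> isolates it.

  Counting the letters \<open>x\<close> in words describes the blocks without a basis
  (\<open>H_eq_graded\<close>), and multiplication by \<open>x\<close> then needs no expansion of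
  \<open>y_I x\<close> into wedges.

  The determinant yields statements up to torsion: \<open>K G = D F\<close> is solvable for every
  \<open>F\<close>, and \<open>K F = 0\<close> forces \<open>D F = 0\<close>. Both become exact for
  fractions, whose equality allows a further factor from \<open>S\<close>. The splitting is the
  identity \<open>F = (F - R K^-1 d F) + R K^-1 d F\<close>, whose first summand is killed by
  \<open>d\<close> because \<open>d R = K\<close>.\<close>

locale localization =
  fixes act :: "'a::comm_ring_1 \<Rightarrow> 'm::ab_group_add \<Rightarrow> 'm" and T S :: "'a set"
  assumes act_add: "act (a + b) m = act a m + act b m"
    and act_add_right: "act a (m + n) = act a m + act a n"
    and act_mult: "act a (act b m) = act (a * b) m"
    and act_one: "act 1 m = m"
    and S_sub: "S \<subseteq> T"
    and S_one: "1 \<in> S"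
    and S_mult: "a \<in> S \<Longrightarrow> b \<in> S \<Longrightarrow> a * b \<in> S"
    and T_mult: "a \<in> T \<Longrightarrow> b \<in> T \<Longrightarrow> a * b \<in> T"
begin

sublocale act: additive "act a" for a
  by unfold_locales (rule act_add_right)

text \<open>Closure is asked only for scalars in \<open>T\<close>: a general polynomial, such as
  \<open>r\<close>, moves a block into another one, although the laws of the action hold for all
  polynomials.\<close>

definition submod :: "'m set \<Rightarrow> bool" where
  "submod M \<longleftrightarrow> 0 \<in> M \<and> (\<forall>m\<in>M. \<forall>n\<in>M. m + n \<in> M) \<and> (\<forall>m\<in>M. - m \<in> M) \<and> (\<forall>a\<in>T. \<forall>m\<in>M. act a m \<in> M)"

lemma submodD:
  assumes "submod M"
  shows "0 \<in> M" "m \<in> M \<Longrightarrow> n \<in> M \<Longrightarrow> m + n \<in> M" "m \<in> M \<Longrightarrow> - m \<in> M"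
    "a \<in> T \<Longrightarrow> m \<in> M \<Longrightarrow> act a m \<in> M" "a \<in> S \<Longrightarrow> m \<in> M \<Longrightarrow> act a m \<in> M"
  using assms S_sub by (auto simp: submod_def)

lemma equiv_loc_rel: "equiv (M \<times> S) (loc_rel act S M)"
proof (rule equivI)
  show "loc_rel act S M \<subseteq> (M \<times> S) \<times> (M \<times> S)"
    by (auto simp: loc_rel_def)
  show "refl_on (M \<times> S) (loc_rel act S M)"
    using S_one by (auto simp: refl_on_def loc_rel_def act.zero)
  show "sym (loc_rel act S M)"
  proof (rule symI, clarify)
    fix m s m' s'
    assume "((m, s), (m', s')) \<in> loc_rel act S M"
    then obtain u where u: "m \<in> M" "m' \<in> M" "s \<in> S" "s' \<in> S" "u \<in> S" "act u (act s' m - act s m') = 0"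
      by (auto simp: loc_rel_def)
    have "act u (act s m' - act s' m) = - act u (act s' m - act s m')"
      by (simp add: act.diff)
    with u show "((m', s'), (m, s)) \<in> loc_rel act S M"
      by (auto simp: loc_rel_def)
  qed
  show "trans (loc_rel act S M)"
  proof (rule transI, clarify)
    fix m s m' s' m'' s''
    assume "((m, s), (m', s')) \<in> loc_rel act S M" "((m', s'), (m'', s'')) \<in> loc_rel act S M"
    then obtain u v where u: "m \<in> M" "m' \<in> M" "m'' \<in> M" "s \<in> S" "s' \<in> S" "s'' \<in> S" "u \<in> S" "v \<in> S"
      "act u (act s' m - act s m') = 0" "act v (act s'' m' - act s' m'') = 0"
      by (auto simp: loc_rel_def)
    \<comment> \<open>The factor \<open>s'\<close> makes the two given relations fit together: after
      multiplication by \<open>v * s''\<close> and by \<open>u * s\<close> their terms in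
      \<open>m'\<close> cancel.\<close>
    have "act (u * v * s') (act s'' m - act s m'') =
        act (v * s'') (act u (act s' m - act s m')) + act (u * s) (act v (act s'' m' - act s' m''))"
      by (simp add: act.diff act_mult mult_ac)
    then have "act (u * v * s') (act s'' m - act s m'') = 0"
      using u by (simp add: act.zero)
    with u show "((m, s), (m'', s'')) \<in> loc_rel act S M"
      by (auto simp: loc_rel_def intro!: S_mult bexI[of _ "u * v * s'"])
  qed
qed

abbreviation "mfrac M m s \<equiv> loc_frac act S M m s"

abbreviation "LM M \<equiv> loc_module act S M"

lemma frac_eqI:
  assumes "m \<in> M" "m' \<in> M" "s \<in> S" "s' \<in> S" "u \<in> S" "act (u * s') m = act (u * s) m'"
  shows "mfrac M m s = mfrac M m' s'"
proof -
  have "((m, s), (m', s')) \<in> loc_rel act S M"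
    using assms by (auto simp: loc_rel_def act.diff act_mult intro!: bexI[of _ u])
  then show ?thesis
    unfolding loc_frac_def by (rule equiv_class_eq[OF equiv_loc_rel])
qed

lemma frac_eqD:
  assumes "m \<in> M" "m' \<in> M" "s \<in> S" "s' \<in> S" "mfrac M m s = mfrac M m' s'"
  shows "\<exists>u\<in>S. act (u * s') m = act (u * s) m'"
proof -
  have "((m, s), (m', s')) \<in> loc_rel act S M"
    using assms eq_equiv_class_iff[OF equiv_loc_rel] unfolding loc_frac_def by blast
  then show ?thesis
    by (auto simp: loc_rel_def act.diff act_mult)
qed

text \<open>Against the zero fraction with denominator 1 the cross-multiplied equation reduces to
  torsion. This is how a statement up to powers of \<open>D\<close> becomes exact for
  fractions.\<close>

lemma frac_eq_zero_iff:
  assumes "submod M" "m \<in> M" "s \<in> S"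
  shows "mfrac M m s = mfrac M 0 1 \<longleftrightarrow> (\<exists>u\<in>S. act u m = 0)"
  using frac_eqD[of m M 0 s 1] frac_eqI[of m M 0 s 1] submodD[OF assms(1)] assms S_one
  by (auto simp: act.zero)

text \<open>The operations on fractions are written as unions over all representatives. If the value
  is constant on the class, the union collapses to the value at any one of them, so that operations
  can be computed on given numerators and denominators.\<close>

lemma UN_frac:
  assumes "m \<in> M" "s \<in> S"
    and "\<And>m s m' s'. m \<in> M \<Longrightarrow> m' \<in> M \<Longrightarrow> s \<in> S \<Longrightarrow> s' \<in> S \<Longrightarrow> mfrac M m s = mfrac M m' s' \<Longrightarrow> g m s = g m' s'"
  shows "(\<Union>(m, s)\<in>mfrac M m s. g m s) = g m s"
proof -
  have "(\<lambda>(m, s). g m s) respects loc_rel act S M"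
  proof (rule congruentI, clarify)
    fix m s m' s'
    assume *: "((m, s), (m', s')) \<in> loc_rel act S M"
    then have "m \<in> M" "m' \<in> M" "s \<in> S" "s' \<in> S"
      by (auto simp: loc_rel_def)
    moreover have "mfrac M m s = mfrac M m' s'"
      unfolding loc_frac_def using * by (rule equiv_class_eq[OF equiv_loc_rel])
    ultimately show "g m s = g m' s'" by (rule assms(3))
  qed
  from UN_equiv_class[OF equiv_loc_rel this, of "(m, s)"] assms(1,2) show ?thesis
    by (simp add: loc_frac_def)
qed

lemma frac_in_carrier: "m \<in> M \<Longrightarrow> s \<in> S \<Longrightarrow> mfrac M m s \<in> carrier (LM M)"
  by (auto simp: loc_module_def loc_frac_def quotient_def)

lemma carrierE:
  assumes "X \<in> carrier (LM M)"
  obtains m s where "m \<in> M" "s \<in> S" "X = mfrac M m s"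
  using assms by (auto simp: loc_module_def loc_frac_def quotient_def)

lemma zero_loc: "\<zero>\<^bsub>LM M\<^esub> = mfrac M 0 1"
  by (simp add: loc_module_def)

lemma add_frac:
  assumes M: "submod M" and "m \<in> M" "n \<in> M" "s \<in> S" "t \<in> S"
  shows "mfrac M m s \<oplus>\<^bsub>LM M\<^esub> mfrac M n t = mfrac M (act t m + act s n) (s * t)"
proof -
  note M' = submodD[OF M]
  \<comment> \<open>The union over the second class is evaluated for every representative of the
    first, so that the outer comparison is one between fractions and not between unions.\<close>
  have inner: "(\<Union>(n, t)\<in>mfrac M n t. mfrac M (act t m + act s n) (s * t)) = mfrac M (act t m + act s n) (s * t)"
    if "m \<in> M" "s \<in> S" for m s
  proof (rule UN_frac[OF assms(3,5)])
    fix n t n' t'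
    assume *: "n \<in> M" "n' \<in> M" "t \<in> S" "t' \<in> S" and "mfrac M n t = mfrac M n' t'"
    then obtain u where u: "u \<in> S" "act (u * t') n = act (u * t) n'"
      using frac_eqD by blast
    show "mfrac M (act t m + act s n) (s * t) = mfrac M (act t' m + act s n') (s * t')"
    proof (rule frac_eqI[of _ _ _ _ _ u])
      have "act (s * s) (act (u * t') n) = act (s * s) (act (u * t) n')" using u by simp
      then show "act (u * (s * t')) (act t m + act s n) = act (u * (s * t)) (act t' m + act s n')"
        by (simp add: act_add_right act_mult mult_ac)
    qed (use * that u in \<open>auto intro: M' S_mult\<close>)
  qed
  have "mfrac M m s \<oplus>\<^bsub>LM M\<^esub> mfrac M n t =
      (\<Union>(m, s)\<in>mfrac M m s. \<Union>(n, t)\<in>mfrac M n t. mfrac M (act t m + act s n) (s * t))"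
    by (simp add: loc_module_def)
  also have "\<dots> = (\<Union>(n, t)\<in>mfrac M n t. mfrac M (act t m + act s n) (s * t))"
  proof (rule UN_frac[OF assms(2,4)])
    fix m s m' s'
    assume *: "m \<in> M" "m' \<in> M" "s \<in> S" "s' \<in> S" and "mfrac M m s = mfrac M m' s'"
    then obtain u where u: "u \<in> S" "act (u * s') m = act (u * s) m'"
      using frac_eqD by blast
    have "mfrac M (act t m + act s n) (s * t) = mfrac M (act t m' + act s' n) (s' * t)"
    proof (rule frac_eqI[of _ _ _ _ _ u])
      have "act (t * t) (act (u * s') m) = act (t * t) (act (u * s) m')" using u by simp
      then show "act (u * (s' * t)) (act t m + act s n) = act (u * (s * t)) (act t m' + act s' n)"
        by (simp add: act_add_right act_mult mult_ac)
    qed (use * assms u in \<open>auto intro: M' S_mult\<close>)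
    then show "(\<Union>(n, t)\<in>mfrac M n t. mfrac M (act t m + act s n) (s * t)) =
        (\<Union>(n, t)\<in>mfrac M n t. mfrac M (act t m' + act s' n) (s' * t))"
      using * by (simp add: inner)
  qed
  also have "\<dots> = mfrac M (act t m + act s n) (s * t)"
    using assms inner by blast
  finally show ?thesis .
qed

lemma abelian_group_loc:
  assumes M: "submod M"
  shows "abelian_group (LM M)"
proof (rule abelian_groupI)
  note M' = submodD[OF M]
  note [simp] = add_frac[OF M] zero_loc S_one S_mult M'
  note [intro] = frac_in_carrier
  show "\<zero>\<^bsub>LM M\<^esub> \<in> carrier (LM M)" by auto
  fix X assume "X \<in> carrier (LM M)"
  then obtain m s where X: "m \<in> M" "s \<in> S" "X = mfrac M m s" by (rule carrierE)
  show "\<zero>\<^bsub>LM M\<^esub> \<oplus>\<^bsub>LM M\<^esub> X = X"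
    using X by (simp add: act.zero act_one)
  show "\<exists>Y\<in>carrier (LM M). Y \<oplus>\<^bsub>LM M\<^esub> X = \<zero>\<^bsub>LM M\<^esub>"
  proof
    show "mfrac M (- m) s \<oplus>\<^bsub>LM M\<^esub> X = \<zero>\<^bsub>LM M\<^esub>"
      using X frac_eq_zero_iff[OF M, of 0 "s * s"] by (auto simp: act.minus act.zero)
  qed (use X in auto)
  fix Y assume "Y \<in> carrier (LM M)"
  then obtain n t where Y: "n \<in> M" "t \<in> S" "Y = mfrac M n t" by (rule carrierE)
  show "X \<oplus>\<^bsub>LM M\<^esub> Y \<in> carrier (LM M)" using X Y by auto
  show "X \<oplus>\<^bsub>LM M\<^esub> Y = Y \<oplus>\<^bsub>LM M\<^esub> X"
    using X Y by (simp add: add.commute mult.commute)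
  fix Z assume "Z \<in> carrier (LM M)"
  then obtain l v where Z: "l \<in> M" "v \<in> S" "Z = mfrac M l v" by (rule carrierE)
  show "X \<oplus>\<^bsub>LM M\<^esub> Y \<oplus>\<^bsub>LM M\<^esub> Z = X \<oplus>\<^bsub>LM M\<^esub> (Y \<oplus>\<^bsub>LM M\<^esub> Z)"
    using X Y Z by (simp add: act_add_right act_mult add.assoc mult_ac)
qed

lemma smult_frac:
  assumes M: "submod M" and C: "a \<in> T" "t \<in> S" and ms: "m \<in> M" "s \<in> S"
  shows "loc_frac (*) S T a t \<odot>\<^bsub>LM M\<^esub> mfrac M m s = mfrac M (act a m) (t * s)"
proof -
  \<comment> \<open>The scalars are themselves fractions: the same setting with \<open>T\<close>
    acting on itself by multiplication describes their classes.\<close>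
  interpret T: localization "(*)" T S
    by unfold_locales (use S_sub S_one S_mult T_mult in \<open>auto simp: algebra_simps\<close>)
  note M' = submodD[OF M]
  have inner: "(\<Union>(m, s)\<in>mfrac M m s. mfrac M (act a m) (t * s)) = mfrac M (act a m) (t * s)"
      if at: "a \<in> T" "t \<in> S" for a t
    proof (rule UN_frac[OF ms])
      fix m s m' s'
      assume *: "m \<in> M" "m' \<in> M" "s \<in> S" "s' \<in> S" and "mfrac M m s = mfrac M m' s'"
      then obtain u where u: "u \<in> S" "act (u * s') m = act (u * s) m'"
        using frac_eqD by blast
      show "mfrac M (act a m) (t * s) = mfrac M (act a m') (t * s')"
      proof (rule frac_eqI[of _ _ _ _ _ u])
        have "act (a * t) (act (u * s') m) = act (a * t) (act (u * s) m')" using u by simp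
        then show "act (u * (t * s')) (act a m) = act (u * (t * s)) (act a m')"
          by (simp add: act_mult mult_ac)
      qed (use * at u in \<open>auto intro: M' S_mult\<close>)
    qed
    have "T.mfrac T a t \<odot>\<^bsub>LM M\<^esub> mfrac M m s =
        (\<Union>(a, t)\<in>T.mfrac T a t. \<Union>(m, s)\<in>mfrac M m s. mfrac M (act a m) (t * s))"
      by (simp add: loc_module_def)
    also have "\<dots> = (\<Union>(m, s)\<in>mfrac M m s. mfrac M (act a m) (t * s))"
    proof (rule T.UN_frac[OF C])
      fix a t a' t'
      assume *: "a \<in> T" "a' \<in> T" "t \<in> S" "t' \<in> S" and "T.mfrac T a t = T.mfrac T a' t'"
      then obtain u where u: "u \<in> S" "u * t' * a = u * t * a'"
        using T.frac_eqD by blast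
      have "mfrac M (act a m) (t * s) = mfrac M (act a' m) (t' * s)"
      proof (rule frac_eqI[of _ _ _ _ _ u])
        have "u * (t' * s) * a = s * (u * t' * a)" by (simp add: mult_ac)
        also have "\<dots> = u * (t * s) * a'" unfolding u(2) by (simp add: mult_ac)
        finally show "act (u * (t' * s)) (act a m) = act (u * (t * s)) (act a' m)"
          by (simp add: act_mult)
      qed (use * ms u in \<open>auto intro: M' S_mult\<close>)
      then show "(\<Union>(m, s)\<in>mfrac M m s. mfrac M (act a m) (t * s)) =
          (\<Union>(m, s)\<in>mfrac M m s. mfrac M (act a' m) (t' * s))"
        using * by (simp add: inner)
    qed
    also have "\<dots> = mfrac M (act a m) (t * s)" using C by (simp add: inner)
  finally show ?thesis .
qed

lemma scalarE:
  assumes "C \<in> carrier (loc_ring S T)"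
  obtains a t where "a \<in> T" "t \<in> S" "C = loc_frac (*) S T a t"
  using assms by (auto simp: loc_ring_def loc_frac_def quotient_def)

lemma smult_carrier:
  assumes "submod M" "C \<in> carrier (loc_ring S T)" "X \<in> carrier (LM M)"
  shows "C \<odot>\<^bsub>LM M\<^esub> X \<in> carrier (LM M)"
  using assms by (elim scalarE carrierE) (auto simp: smult_frac intro!: frac_in_carrier submodD(4) S_mult)

section \<open>Linear maps and their extension to fractions\<close>

definition lin :: "'m set \<Rightarrow> 'm set \<Rightarrow> ('m \<Rightarrow> 'm) \<Rightarrow> bool" where
  "lin M M' f \<longleftrightarrow> f \<in> M \<rightarrow> M' \<and> (\<forall>m\<in>M. \<forall>n\<in>M. f (m + n) = f m + f n) \<and>
    (\<forall>a\<in>T. \<forall>m\<in>M. f (act a m) = act a (f m))"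

lemma linD:
  assumes "lin M M' f"
  shows "m \<in> M \<Longrightarrow> f m \<in> M'" "m \<in> M \<Longrightarrow> n \<in> M \<Longrightarrow> f (m + n) = f m + f n"
    "a \<in> T \<Longrightarrow> m \<in> M \<Longrightarrow> f (act a m) = act a (f m)"
    "a \<in> S \<Longrightarrow> m \<in> M \<Longrightarrow> f (act a m) = act a (f m)"
  using assms S_sub by (auto simp: lin_def)

abbreviation "lmap M' f \<equiv> loc_map act S M' f"

lemma lmap_frac:
  assumes M: "submod M" and f: "lin M M' f" and "m \<in> M" "s \<in> S"
  shows "lmap M' f (mfrac M m s) = mfrac M' (f m) s"
  unfolding loc_map_def
proof (rule UN_frac[OF assms(3,4)])
  note f' = linD[OF f]
  fix m s m' s'
  assume *: "m \<in> M" "m' \<in> M" "s \<in> S" "s' \<in> S" and "mfrac M m s = mfrac M m' s'"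
  then obtain u where u: "u \<in> S" "act (u * s') m = act (u * s) m'"
    using frac_eqD by blast
  show "mfrac M' (f m) s = mfrac M' (f m') s'"
  proof (rule frac_eqI[of _ _ _ _ _ u])
    show "act (u * s') (f m) = act (u * s) (f m')"
      using u * by (simp add: f'(4)[symmetric] S_mult)
  qed (use * u f' in auto)
qed

lemma lmap_carrier:
  assumes "submod M" "lin M M' f"
  shows "lmap M' f \<in> carrier (LM M) \<rightarrow> carrier (LM M')"
  using assms by (auto elim!: carrierE simp: lmap_frac linD intro!: frac_in_carrier)

lemma lmap_add:
  assumes M: "submod M" and M': "submod M'" and f: "lin M M' f"
    and X: "X \<in> carrier (LM M)" and Y: "Y \<in> carrier (LM M)"
  shows "lmap M' f (X \<oplus>\<^bsub>LM M\<^esub> Y) = lmap M' f X \<oplus>\<^bsub>LM M'\<^esub> lmap M' f Y"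
proof -
  obtain m s where X: "m \<in> M" "s \<in> S" "X = mfrac M m s" using X by (rule carrierE)
  obtain n t where Y: "n \<in> M" "t \<in> S" "Y = mfrac M n t" using Y by (rule carrierE)
  show ?thesis
    using X Y by (simp add: lmap_frac[OF M f] add_frac M M' linD[OF f] submodD[OF M] S_mult)
qed

lemma lmap_smult:
  assumes M: "submod M" and M': "submod M'" and f: "lin M M' f"
    and C: "C \<in> carrier (loc_ring S T)" and X: "X \<in> carrier (LM M)"
  shows "lmap M' f (C \<odot>\<^bsub>LM M\<^esub> X) = C \<odot>\<^bsub>LM M'\<^esub> lmap M' f X"
  using C X
  by (elim scalarE carrierE) (auto simp: smult_frac lmap_frac[OF M f] M M' linD[OF f] submodD[OF M] S_mult)

end

text \<open>The theorem without the radial algebra. The last two assumptions say that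
  \<open>D\<close> annihilates the cokernel and the kernel of the composite \<open>d R\<close>; for
  its determinant they follow from the adjugate matrix.\<close>

locale compression = localization act T S for act :: "'a::comm_ring_1 \<Rightarrow> 'm::ab_group_add \<Rightarrow> 'm" and T S :: "'a set" +
  fixes H1 H0 :: "'m set" and R d :: "'m \<Rightarrow> 'm" and D :: 'a
  assumes H1: "submod H1" and H0: "submod H0"
    and R: "lin H0 H1 R" and d: "lin H1 H0 d"
    and D: "D \<in> S"
    and D_surj: "m \<in> H0 \<Longrightarrow> \<exists>n\<in>H0. d (R n) = act D m"
    and D_inj: "m \<in> H0 \<Longrightarrow> d (R m) = 0 \<Longrightarrow> act D m = 0"
begin

abbreviation "K \<equiv> \<lambda>m. d (R m)"

lemma K: "lin H0 H0 K"
  using R d unfolding lin_def by (auto simp: Pi_iff)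

abbreviation "lR \<equiv> lmap H1 R"
abbreviation "ld \<equiv> lmap H0 d"
abbreviation "lK \<equiv> lmap H0 K"
abbreviation "L1 \<equiv> LM H1"
abbreviation "L0 \<equiv> LM H0"

sublocale L1: abelian_group L1 by (rule abelian_group_loc[OF H1])
sublocale L0: abelian_group L0 by (rule abelian_group_loc[OF H0])

lemma lR_in: "X \<in> carrier L0 \<Longrightarrow> lR X \<in> carrier L1"
  using lmap_carrier[OF H0 R] by blast

lemma ld_in: "X \<in> carrier L1 \<Longrightarrow> ld X \<in> carrier L0"
  using lmap_carrier[OF H1 d] by blast

lemma lK_in: "X \<in> carrier L0 \<Longrightarrow> lK X \<in> carrier L0"
  using lmap_carrier[OF H0 K] by blast

lemma ld_lR: "X \<in> carrier L0 \<Longrightarrow> ld (lR X) = lK X"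
  by (elim carrierE) (auto simp: lmap_frac[OF H0 R] lmap_frac[OF H1 d] lmap_frac[OF H0 K] linD[OF R])

lemma hom: "abelian_group_hom L0 L1 lR" "abelian_group_hom L1 L0 ld" "abelian_group_hom L0 L0 lK"
  by (rule abelian_group_homI; unfold_locales?;
      simp add: hom_def lmap_carrier[OF H0 R] lmap_carrier[OF H1 d] lmap_carrier[OF H0 K]
        lmap_add[OF H0 H1 R] lmap_add[OF H1 H0 d] lmap_add[OF H0 H0 K])+

sublocale lR: abelian_group_hom L0 L1 lR by (rule hom)
sublocale ld: abelian_group_hom L1 L0 ld by (rule hom)
sublocale lK: abelian_group_hom L0 L0 lK by (rule hom)

text \<open>If \<open>K m / s\<close> vanishes, then \<open>K (u m) = u (K m) = 0\<close> for some
  denominator \<open>u\<close>; hence \<open>D u m = 0\<close>, and \<open>D u\<close> is again a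
  denominator.\<close>

lemma lK_eq_zero:
  assumes "X \<in> carrier L0" "lK X = \<zero>\<^bsub>L0\<^esub>"
  shows "X = \<zero>\<^bsub>L0\<^esub>"
proof -
  obtain m s where X: "m \<in> H0" "s \<in> S" "X = mfrac H0 m s" using assms(1) by (rule carrierE)
  have "mfrac H0 (K m) s = mfrac H0 0 1"
    using assms(2) X by (simp add: lmap_frac[OF H0 K] zero_loc)
  then obtain u where u: "u \<in> S" "act u (K m) = 0"
    using X frac_eq_zero_iff[OF H0 linD(1)[OF K]] by blast
  then have "K (act u m) = 0" using linD(4)[OF K] X by simp
  then have "act D (act u m) = 0"
    using D_inj submodD(5)[OF H0] X u by blast
  then show ?thesis
    using X u D frac_eq_zero_iff[OF H0, of m s] by (auto simp: zero_loc act_mult intro: S_mult)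
qed

lemma lK_bij: "bij_betw lK (carrier L0) (carrier L0)"
  unfolding bij_betw_def
proof
  show "inj_on lK (carrier L0)"
  proof (rule inj_onI)
    fix X Y assume *: "X \<in> carrier L0" "Y \<in> carrier L0" "lK X = lK Y"
    then have "lK (X \<ominus>\<^bsub>L0\<^esub> Y) = \<zero>\<^bsub>L0\<^esub>"
      by (simp add: a_minus_def lK_in L0.r_neg)
    then have "X \<ominus>\<^bsub>L0\<^esub> Y = \<zero>\<^bsub>L0\<^esub>"
      by (rule lK_eq_zero[OF L0.minus_closed[OF *(1,2)]])
    moreover have "X = (X \<ominus>\<^bsub>L0\<^esub> Y) \<oplus>\<^bsub>L0\<^esub> Y"
      using * by (simp add: a_minus_def L0.a_assoc L0.l_neg)
    ultimately show "X = Y" using * by simp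
  qed
  show "lK ` carrier L0 = carrier L0"
  proof
    show "lK ` carrier L0 \<subseteq> carrier L0" using lK_in by blast
    show "carrier L0 \<subseteq> lK ` carrier L0"
    proof
      fix X assume "X \<in> carrier L0"
      then obtain m s where X: "m \<in> H0" "s \<in> S" "X = mfrac H0 m s" by (rule carrierE)
      \<comment> \<open>Since \<open>K n = D m\<close>, the fraction \<open>m / s\<close> is the
        image of \<open>n / (D s)\<close>.\<close>
      obtain n where n: "n \<in> H0" "K n = act D m" using D_surj X by blast
      have "lK (mfrac H0 n (D * s)) = mfrac H0 (act D m) (D * s)"
        using n X D by (simp add: lmap_frac[OF H0 K] S_mult)
      also have "\<dots> = X"
        unfolding X(3) using X D submodD[OF H0] S_one
        by (intro frac_eqI[of _ _ _ _ _ 1]) (auto simp: act_mult mult_ac S_mult)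
      finally show "X \<in> lK ` carrier L0"
        using n X D by (metis frac_in_carrier S_mult image_eqI)
    qed
  qed
qed

lemma submodule_kernel: "submodule (a_kernel L1 L0 ld) (loc_ring S T) L1"
proof -
  have "subgroup (a_kernel L1 L0 ld) (add_monoid L1)"
    unfolding a_kernel_def by (rule group_hom.subgroup_kernel[OF ld.a_group_hom])
  moreover have "C \<odot>\<^bsub>L0\<^esub> \<zero>\<^bsub>L0\<^esub> = \<zero>\<^bsub>L0\<^esub>" if "C \<in> carrier (loc_ring S T)" for C
    using that frac_eq_zero_iff[OF H0, of 0] submodD[OF H0] S_one
    by (elim scalarE) (auto simp: zero_loc smult_frac[OF H0] act.zero)
  ultimately show ?thesis
    by (intro submodule.intro submodule_axioms.intro)
       (auto simp: a_kernel_def' lmap_smult[OF H1 H0 d] smult_carrier[OF H1])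
qed

lemma submodule_range: "submodule (lR ` carrier L0) (loc_ring S T) L1"
proof -
  have "subgroup (lR ` carrier L0) (add_monoid L1)"
    using group_hom.img_is_subgroup[OF lR.a_group_hom] by simp
  then show ?thesis
    by (intro submodule.intro submodule_axioms.intro)
       (auto simp: lmap_smult[OF H0 H1 R, symmetric] smult_carrier[OF H0])
qed

text \<open>With \<open>W = lR G\<close>, the derivative of \<open>U + W\<close> is
  \<open>lK G\<close>. Inverting \<open>lK\<close> recovers \<open>G\<close>, and subtracting
  \<open>lR G\<close> leaves \<open>U\<close>.\<close>

lemma projection:
  assumes U: "U \<in> a_kernel L1 L0 ld" and W: "W \<in> lR ` carrier L0"
  shows "(U \<oplus>\<^bsub>L1\<^esub> W) \<ominus>\<^bsub>L1\<^esub> lR (inv_into (carrier L0) lK (ld (U \<oplus>\<^bsub>L1\<^esub> W))) = U"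
proof -
  from U have U: "U \<in> carrier L1" "ld U = \<zero>\<^bsub>L0\<^esub>" by (auto simp: a_kernel_def')
  from W obtain G where G: "G \<in> carrier L0" "W = lR G" by blast
  have "ld (U \<oplus>\<^bsub>L1\<^esub> W) = lK G"
    using U G by (simp add: lR_in ld_lR lK_in)
  then have "inv_into (carrier L0) lK (ld (U \<oplus>\<^bsub>L1\<^esub> W)) = G"
    using G lK_bij by (simp add: bij_betw_def)
  then show ?thesis
    using U G by (simp add: lR_in a_minus_def L1.a_assoc L1.r_neg)
qed

text \<open>The component of \<open>X\<close> in the range is \<open>lR G\<close>, where
  \<open>lK G = ld X\<close>; the remainder lies in the kernel because
  \<open>ld (lR G) = lK G\<close>. For a common element \<open>lR G\<close> of both summands the
  same identity gives \<open>lK G = 0\<close>, hence \<open>G = 0\<close>.\<close>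

lemma direct_sum:
  "internal_direct_sum (loc_ring S T) L1 (a_kernel L1 L0 ld) (lR ` carrier L0)"
  unfolding internal_direct_sum_def
proof (intro conjI submodule_kernel submodule_range)
  let ?U = "a_kernel L1 L0 ld" and ?W = "lR ` carrier L0"
  have U: "X \<in> ?U \<longleftrightarrow> X \<in> carrier L1 \<and> ld X = \<zero>\<^bsub>L0\<^esub>" for X by (auto simp: a_kernel_def')
  show "?U \<inter> ?W = {\<zero>\<^bsub>L1\<^esub>}"
  proof (intro equalityI subsetI)
    fix X assume X: "X \<in> ?U \<inter> ?W"
    then have "X \<in> ?W" by (rule IntD2)
    then obtain G where G: "G \<in> carrier L0" "X = lR G" by (rule imageE)
    have "ld X = \<zero>\<^bsub>L0\<^esub>" using IntD1[OF X] unfolding U by (rule conjunct2)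
    then have "lK G = \<zero>\<^bsub>L0\<^esub>" unfolding G(2) ld_lR[OF G(1)] .
    then have "G = \<zero>\<^bsub>L0\<^esub>" by (rule lK_eq_zero[OF G(1)])
    with G show "X \<in> {\<zero>\<^bsub>L1\<^esub>}" by simp
  next
    fix X assume "X \<in> {\<zero>\<^bsub>L1\<^esub>}"
    then show "X \<in> ?U \<inter> ?W"
      using lR.hom_zero by (auto simp: U intro!: image_eqI[of _ _ "\<zero>\<^bsub>L0\<^esub>"])
  qed
  show "?U <+>\<^bsub>L1\<^esub> ?W = carrier L1"
  proof (intro equalityI subsetI)
    fix X assume "X \<in> ?U <+>\<^bsub>L1\<^esub> ?W"
    then show "X \<in> carrier L1" by (auto simp: set_add_def' U lR_in)
  next
    fix X assume X: "X \<in> carrier L1"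
    define G where "G = inv_into (carrier L0) lK (ld X)"
    have G: "G \<in> carrier L0" "lK G = ld X"
      using lK_bij ld_in[OF X] unfolding G_def bij_betw_def by (metis inv_into_into, metis f_inv_into_f)
    have "X \<ominus>\<^bsub>L1\<^esub> lR G \<in> ?U"
      using X G by (simp add: U lR_in a_minus_def ld_lR L0.r_neg ld_in)
    moreover have "X = (X \<ominus>\<^bsub>L1\<^esub> lR G) \<oplus>\<^bsub>L1\<^esub> lR G"
      using X G by (simp add: lR_in a_minus_def L1.a_assoc L1.l_neg)
    ultimately show "X \<in> ?U <+>\<^bsub>L1\<^esub> ?W"
      using G by (auto simp: set_add_def')
  qed
qed

end

section \<open>Polynomial mappings\<close>

lemma poly_mapping_sum_single:
  fixes f :: "'a \<Rightarrow>\<^sub>0 'b::comm_monoid_add"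
  shows "f = (\<Sum>k\<in>Poly_Mapping.keys f. Poly_Mapping.single k (Poly_Mapping.lookup f k))"
  by (rule poly_mapping_eqI)
     (auto simp: lookup_sum lookup_single when_def in_keys_iff)

lemma poly_mapping_keys_induct [consumes 1, case_names zero add single]:
  fixes f :: "'a \<Rightarrow>\<^sub>0 'b::comm_monoid_add"
  assumes "Poly_Mapping.keys f \<subseteq> S"
    and "P 0" and "\<And>f g. P f \<Longrightarrow> P g \<Longrightarrow> P (f + g)"
    and "\<And>k c. k \<in> S \<Longrightarrow> P (Poly_Mapping.single k c)"
  shows "P f"
proof -
  have "P (\<Sum>k\<in>K. Poly_Mapping.single k (Poly_Mapping.lookup f k))" if "finite K" "K \<subseteq> S" for K
    using that by (induction K) (auto intro: assms)
  then show ?thesis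
    using assms(1) by (subst poly_mapping_sum_single) auto
qed

lemma poly_mapping_induct [case_names zero add single]:
  fixes f :: "'a \<Rightarrow>\<^sub>0 'b::comm_monoid_add"
  assumes "P 0" and "\<And>f g. P f \<Longrightarrow> P g \<Longrightarrow> P (f + g)" and "\<And>k c. P (Poly_Mapping.single k c)"
  shows "P f"
  by (rule poly_mapping_keys_induct[of f UNIV]) (auto intro: assms)

lemma keys_uminus: "Poly_Mapping.keys (- f :: 'a \<Rightarrow>\<^sub>0 'b::ab_group_add) = Poly_Mapping.keys f"
  by (auto simp: in_keys_iff)

text \<open>Exponents cancel, so multiplication by a monomial only shifts the coefficients.\<close>

lemma lookup_single_mult:
  fixes f :: "'a::cancel_comm_monoid_add \<Rightarrow>\<^sub>0 'b::semiring_0"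
  shows "Poly_Mapping.lookup (Poly_Mapping.single m c * f) (m + n) = c * Poly_Mapping.lookup f n"
  by (induction f rule: poly_mapping_induct)
     (simp_all add: lookup_add distrib_left mult_single lookup_single when_def)

lemma lookup_single_mult_eq_0:
  fixes f :: "'a::comm_monoid_add \<Rightarrow>\<^sub>0 'b::semiring_0"
  assumes "\<And>n. n \<in> Poly_Mapping.keys f \<Longrightarrow> k \<noteq> m + n"
  shows "Poly_Mapping.lookup (Poly_Mapping.single m c * f) k = 0"
proof -
  have "k \<notin> Poly_Mapping.keys (Poly_Mapping.single m c * f)"
    using keys_mult[of "Poly_Mapping.single m c" f] assms by (auto split: if_splits)
  then show ?thesis by (simp add: in_keys_iff)
qed

section \<open>Splitting exponents according to the variables\<close>

definition restrict_exp :: "'a set \<Rightarrow> ('a \<Rightarrow>\<^sub>0 nat) \<Rightarrow> ('a \<Rightarrow>\<^sub>0 nat)" where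
  "restrict_exp S m = Poly_Mapping.mapp (\<lambda>v n. if v \<in> S then n else 0) m"

lemma lookup_restrict_exp:
  "Poly_Mapping.lookup (restrict_exp S m) v = (if v \<in> S then Poly_Mapping.lookup m v else 0)"
  by (auto simp: restrict_exp_def lookup_mapp when_def in_keys_iff)

lemma keys_restrict_exp: "Poly_Mapping.keys (restrict_exp S m) = Poly_Mapping.keys m \<inter> S"
  by (auto simp: in_keys_iff lookup_restrict_exp split: if_splits)

lemma restrict_exp_add: "restrict_exp S (m + n) = restrict_exp S m + restrict_exp S n"
  by (rule poly_mapping_eqI) (simp add: lookup_add lookup_restrict_exp)

lemma restrict_exp_id: "Poly_Mapping.keys m \<subseteq> S \<Longrightarrow> restrict_exp S m = m"
  by (rule poly_mapping_eqI) (auto simp: lookup_restrict_exp in_keys_iff)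

lemma restrict_exp_disjoint: "Poly_Mapping.keys m \<inter> S = {} \<Longrightarrow> restrict_exp S m = 0"
  by (rule poly_mapping_eqI) (auto simp: lookup_restrict_exp in_keys_iff)

lemma restrict_exp_split:
  assumes "Poly_Mapping.keys m \<subseteq> S \<union> S'" "S \<inter> S' = {}"
  shows "m = restrict_exp S m + restrict_exp S' m"
proof (rule poly_mapping_eqI)
  fix v
  show "Poly_Mapping.lookup m v = Poly_Mapping.lookup (restrict_exp S m + restrict_exp S' m) v"
    using assms by (fastforce simp: lookup_add lookup_restrict_exp in_keys_iff subset_iff)
qed

lemma keys_add_nat:
  "Poly_Mapping.keys (m + n :: 'a \<Rightarrow>\<^sub>0 nat) = Poly_Mapping.keys m \<union> Poly_Mapping.keys n"
  by (auto simp: in_keys_iff lookup_add)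

section \<open>Scalar polynomials\<close>

text \<open>\<open>T_alg N\<close>, \<open>A_alg N\<close> and \<open>A_hom N n e\<close> all have
  this form for suitable sets of exponents, so that their closure properties have a common
  source.\<close>

definition supported :: "('a \<Rightarrow>\<^sub>0 nat) set \<Rightarrow> (('a \<Rightarrow>\<^sub>0 nat) \<Rightarrow>\<^sub>0 'b::comm_ring_1) set" where
  "supported S = {f. Poly_Mapping.keys f \<subseteq> S}"

lemma supported_closed:
  shows "0 \<in> supported S"
    and "f \<in> supported S \<Longrightarrow> g \<in> supported S \<Longrightarrow> f + g \<in> supported S"
    and "f \<in> supported S \<Longrightarrow> - f \<in> supported S"
  using keys_add[of f g] by (auto simp: supported_def keys_uminus)

lemma supported_mult:
  assumes "f \<in> supported S" "g \<in> supported S'" "\<And>m n. m \<in> S \<Longrightarrow> n \<in> S' \<Longrightarrow> m + n \<in> S''"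
  shows "f * g \<in> supported S''"
  using assms keys_mult[of f g] by (fastforce simp: supported_def)

lemma supported_single: "m \<in> S \<Longrightarrow> Poly_Mapping.single m c \<in> supported S"
  by (auto simp: supported_def)

lemma supported_sum: "(\<And>i. i \<in> I \<Longrightarrow> f i \<in> supported S) \<Longrightarrow> sum f I \<in> supported S"
  by (induction I rule: infinite_finite_induct) (auto intro: supported_closed)

lemma supported_induct [consumes 1, case_names zero add single]:
  assumes "f \<in> supported S"
    and "P 0" and "\<And>f g. P f \<Longrightarrow> P g \<Longrightarrow> P (f + g)"
    and "\<And>k c. k \<in> S \<Longrightarrow> P (Poly_Mapping.single k c)"
  shows "P f"
  using assms unfolding supported_def mem_Collect_eq by (rule poly_mapping_keys_induct)

lemma T_alg_supported: "T_alg N = supported {m. Poly_Mapping.keys m \<subseteq> C_vars N}"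
  by (auto simp: T_alg_def supported_def)

lemma A_alg_supported: "A_alg N = supported {m. Poly_Mapping.keys m \<subseteq> RS_vars N \<union> C_vars N}"
  by (auto simp: A_alg_def supported_def)

lemma A_hom_supported:
  "A_hom N n e = supported {m. Poly_Mapping.keys m \<subseteq> RS_vars N \<union> C_vars N \<and> e + xdeg N m = n}"
  by (auto simp: A_hom_def A_alg_def supported_def)

lemma RS_C_disjoint: "RS_vars N \<inter> C_vars N = {}"
  by (auto simp: RS_vars_def C_vars_def)

lemma xdeg_add: "xdeg N (m + n) = xdeg N m + xdeg N n"
  by (simp add: xdeg_def lookup_add sum.distrib)

lemma xdeg_C: "Poly_Mapping.keys m \<subseteq> C_vars N \<Longrightarrow> xdeg N m = 0"
  by (auto simp: xdeg_def C_vars_def in_keys_iff)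

lemma xdeg_single:
  "xdeg N (Poly_Mapping.single RV 1) = 2"
  "i \<in> {1..N} \<Longrightarrow> xdeg N (Poly_Mapping.single (SV i) 1) = 1"
  by (auto simp: xdeg_def lookup_single when_def)

lemmas xdeg_single' = xdeg_single[unfolded One_nat_def]

lemma T_alg_closed:
  "0 \<in> T_alg N" "1 \<in> T_alg N" "s \<in> T_alg N \<Longrightarrow> t \<in> T_alg N \<Longrightarrow> s + t \<in> T_alg N"
  "s \<in> T_alg N \<Longrightarrow> - s \<in> T_alg N" "s \<in> T_alg N \<Longrightarrow> t \<in> T_alg N \<Longrightarrow> s * t \<in> T_alg N"
  "sconst c \<in> T_alg N"
proof -
  show "1 \<in> T_alg N" unfolding T_alg_supported single_one[symmetric] by (rule supported_single) simp
  show "sconst c \<in> T_alg N" unfolding T_alg_supported sconst_def by (rule supported_single) simp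
  show "s \<in> T_alg N \<Longrightarrow> t \<in> T_alg N \<Longrightarrow> s * t \<in> T_alg N"
    unfolding T_alg_supported by (erule (1) supported_mult) (auto simp: keys_add_nat)
qed (auto simp: T_alg_supported intro: supported_closed)

lemma T_alg_sum: "(\<And>i. i \<in> I \<Longrightarrow> f i \<in> T_alg N) \<Longrightarrow> sum f I \<in> T_alg N"
  unfolding T_alg_supported by (rule supported_sum)

lemma T_alg_prod: "(\<And>i. i \<in> I \<Longrightarrow> f i \<in> T_alg N) \<Longrightarrow> prod f I \<in> T_alg N"
  by (induction I rule: infinite_finite_induct) (auto intro: T_alg_closed)

lemma T_alg_power: "f \<in> T_alg N \<Longrightarrow> f ^ n \<in> T_alg N"
  by (induction n) (auto intro: T_alg_closed)

lemma A_alg_closed: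
  "0 \<in> A_alg N" "f \<in> A_alg N \<Longrightarrow> g \<in> A_alg N \<Longrightarrow> f + g \<in> A_alg N"
  "f \<in> A_alg N \<Longrightarrow> - f \<in> A_alg N" "f \<in> A_alg N \<Longrightarrow> g \<in> A_alg N \<Longrightarrow> f * g \<in> A_alg N"
proof -
  show "f \<in> A_alg N \<Longrightarrow> g \<in> A_alg N \<Longrightarrow> f * g \<in> A_alg N"
    unfolding A_alg_supported by (erule (1) supported_mult) (auto simp: keys_add_nat)
qed (auto simp: A_alg_supported intro: supported_closed)

lemma A_hom_closed:
  "0 \<in> A_hom N n e" "f \<in> A_hom N n e \<Longrightarrow> g \<in> A_hom N n e \<Longrightarrow> f + g \<in> A_hom N n e"
  "f \<in> A_hom N n e \<Longrightarrow> - f \<in> A_hom N n e"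
  by (auto simp: A_hom_supported intro: supported_closed)

lemma A_hom_mult: "f \<in> A_hom N n e \<Longrightarrow> g \<in> A_hom N n' e' \<Longrightarrow> f * g \<in> A_hom N (n + n') (e + e')"
  unfolding A_hom_supported by (erule (1) supported_mult) (auto simp: keys_add_nat xdeg_add)

lemma A_hom_sub: "f \<in> A_hom N n e \<Longrightarrow> f \<in> A_alg N"
  by (simp add: A_hom_def)

lemma T_alg_sub: "f \<in> T_alg N \<Longrightarrow> f \<in> A_alg N"
  by (auto simp: A_alg_def T_alg_def)

lemma T_alg_hom: "f \<in> T_alg N \<Longrightarrow> f \<in> A_hom N 0 0"
  by (auto simp: A_alg_def A_hom_def T_alg_def xdeg_C)

section \<open>Jackson operators\<close>

lemma qcoeff_mult_eq_0: "a * b = 0 \<Longrightarrow> a = 0 \<or> b = (0::qcoeff)"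
  by transfer simp

lemma one_minus_qq: "1 - qq \<noteq> 0"
  by transfer (simp add: One_fract_def Zero_fract_def eq_fract one_pCons)

lemma one_minus_qq2: "1 - qq\<^sup>2 \<noteq> 0"
  by transfer (simp add: power2_eq_square One_fract_def Zero_fract_def eq_fract one_pCons)

lemma lookup_jackson_T:
  "Poly_Mapping.lookup (jackson_T u P f) m = P ^ Poly_Mapping.lookup m u * Poly_Mapping.lookup f m"
  by (auto simp: jackson_T_def lookup_mapp when_def in_keys_iff)

lemma jackson_T_add: "jackson_T u P (f + g) = jackson_T u P f + jackson_T u P g"
  by (rule poly_mapping_eqI) (simp add: lookup_jackson_T lookup_add distrib_left)

lemma jackson_T_single:
  "jackson_T u P (Poly_Mapping.single m c) = Poly_Mapping.single m (P ^ Poly_Mapping.lookup m u * c)"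
  by (rule poly_mapping_eqI) (simp add: lookup_jackson_T lookup_single when_def)

lemma jackson_T_zero: "jackson_T u P 0 = 0"
  by (rule poly_mapping_eqI) (simp add: lookup_jackson_T)

lemma jackson_T_mult: "jackson_T u P (f * g) = jackson_T u P f * jackson_T u P g"
proof (induction f rule: poly_mapping_induct)
  case (single m c)
  show ?case
    by (induction g rule: poly_mapping_induct)
       (simp_all add: jackson_T_zero jackson_T_add jackson_T_single distrib_left distrib_right mult_single lookup_add
         power_add mult_ac)
qed (simp_all add: jackson_T_zero jackson_T_add distrib_right)

lemma keys_jackson_T: "Poly_Mapping.keys (jackson_T u P f) \<subseteq> Poly_Mapping.keys f"
  by (auto simp: in_keys_iff lookup_jackson_T)

lemma jackson_T_T_alg: "t \<in> T_alg N \<Longrightarrow> u \<notin> C_vars N \<Longrightarrow> jackson_T u P t = t"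
proof (rule poly_mapping_eqI)
  fix m assume "t \<in> T_alg N" "u \<notin> C_vars N"
  then have "Poly_Mapping.lookup m u = 0 \<or> Poly_Mapping.lookup t m = 0"
    by (fastforce simp: T_alg_def in_keys_iff subset_iff)
  then show "Poly_Mapping.lookup (jackson_T u P t) m = Poly_Mapping.lookup t m"
    by (auto simp: lookup_jackson_T)
qed

text \<open>Multiplication by the monomial \<open>(1 - P) u\<close> shifts exponents and multiplies
  coefficients by \<open>1 - P\<close>. The coefficient ring lies in a field, so a nonzero
  \<open>1 - P\<close> can be cancelled.\<close>

lemma jackson_divide_inj:
  assumes "1 - P \<noteq> 0" "sconst (1 - P) * sindet u * g = sconst (1 - P) * sindet u * g'"
  shows "g = g'"
proof (rule poly_mapping_eqI)
  fix m
  have "sconst (1 - P) * sindet u = Poly_Mapping.single (Poly_Mapping.single u 1) (1 - P)"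
    by (simp add: sconst_def sindet_def mult_single)
  then have "(1 - P) * Poly_Mapping.lookup g m = (1 - P) * Poly_Mapping.lookup g' m"
    using assms(2) by (metis lookup_single_mult)
  then have "(1 - P) * (Poly_Mapping.lookup g m - Poly_Mapping.lookup g' m) = 0"
    by (simp add: right_diff_distrib)
  then show "Poly_Mapping.lookup g m = Poly_Mapping.lookup g' m"
    using assms(1) qcoeff_mult_eq_0 by fastforce
qed

text \<open>On \<open>u^(n+1)\<close> the quotient is \<open>(1 + P + ... + P^n) u^n\<close>: the
  geometric sum replaces the division by \<open>1 - P\<close>. That every exponent of the quotient
  comes from one of \<open>f\<close> is what later controls variables and degree.\<close>

lemma jackson_divide_ex:
  "\<exists>g. sconst (1 - P) * sindet u * g = f - jackson_T u P f \<and>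
     (\<forall>m\<in>Poly_Mapping.keys g. m + Poly_Mapping.single u 1 \<in> Poly_Mapping.keys f)"
proof -
  let ?e = "Poly_Mapping.single u (1::nat)"
  define g where "g = Abs_poly_mapping
    (\<lambda>m. (\<Sum>i\<le>Poly_Mapping.lookup m u. P ^ i) * Poly_Mapping.lookup f (m + ?e))"
  have "finite ((\<lambda>m. m + ?e) -` Poly_Mapping.keys f)"
    by (rule finite_vimageI) (auto intro: injI)
  then have "finite {m. (\<Sum>i\<le>Poly_Mapping.lookup m u. P ^ i) * Poly_Mapping.lookup f (m + ?e) \<noteq> 0}"
    by (rule rev_finite_subset) (auto simp: in_keys_iff)
  then have g: "Poly_Mapping.lookup g m =
      (\<Sum>i\<le>Poly_Mapping.lookup m u. P ^ i) * Poly_Mapping.lookup f (m + ?e)" for m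
    by (simp add: g_def)
  have "sconst (1 - P) * sindet u * g = f - jackson_T u P f"
  proof (rule poly_mapping_eqI)
    fix m
    have eq: "sconst (1 - P) * sindet u = Poly_Mapping.single ?e (1 - P)"
      by (simp add: sconst_def sindet_def mult_single)
    show "Poly_Mapping.lookup (sconst (1 - P) * sindet u * g) m = Poly_Mapping.lookup (f - jackson_T u P f) m"
    \<comment> \<open>A monomial without \<open>u\<close> cannot occur on the left, and on the right
      its coefficient carries the factor \<open>1 - P^0 = 0\<close>.\<close>
    proof (cases "Poly_Mapping.lookup m u = 0")
      case True
      then have "m \<noteq> ?e + n" for n by (auto simp: lookup_add)
      then have "Poly_Mapping.lookup (Poly_Mapping.single ?e (1 - P) * g) m = 0"
        by (intro lookup_single_mult_eq_0) auto
      then show ?thesis using True by (simp add: eq lookup_minus lookup_jackson_T)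
    next
      case False
      define n where "n = m - ?e"
      have m: "m = ?e + n"
        using False by (intro poly_mapping_eqI) (auto simp: n_def lookup_add lookup_minus lookup_single when_def)
      have "Poly_Mapping.lookup (sconst (1 - P) * sindet u * g) m = (1 - P) * Poly_Mapping.lookup g n"
        unfolding eq m by (rule lookup_single_mult)
      also have "\<dots> = (1 - P ^ Suc (Poly_Mapping.lookup n u)) * Poly_Mapping.lookup f m"
        by (simp only: g m sum_gp_basic[symmetric] mult.assoc add.commute)
      finally show ?thesis
        by (simp add: lookup_minus lookup_jackson_T m lookup_add left_diff_distrib)
    qed
  qed
  then show ?thesis
    by (intro exI[of _ g]) (auto simp: in_keys_iff g)
qed

lemma jackson_delta:
  assumes "1 - P \<noteq> 0"
  shows "sconst (1 - P) * sindet u * jackson_delta u P f = f - jackson_T u P f"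
    and "m \<in> Poly_Mapping.keys (jackson_delta u P f) \<Longrightarrow> m + Poly_Mapping.single u 1 \<in> Poly_Mapping.keys f"
proof -
  obtain g where g: "sconst (1 - P) * sindet u * g = f - jackson_T u P f"
    "\<forall>m\<in>Poly_Mapping.keys g. m + Poly_Mapping.single u 1 \<in> Poly_Mapping.keys f"
    using jackson_divide_ex by blast
  have "jackson_delta u P f = g"
    unfolding jackson_delta_def using g(1) jackson_divide_inj[OF assms] by (intro the_equality) metis+
  with g show "sconst (1 - P) * sindet u * jackson_delta u P f = f - jackson_T u P f"
    "m \<in> Poly_Mapping.keys (jackson_delta u P f) \<Longrightarrow> m + Poly_Mapping.single u 1 \<in> Poly_Mapping.keys f"
    by auto
qed

lemma jackson_delta_add:
  assumes "1 - P \<noteq> 0"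
  shows "jackson_delta u P (f + g) = jackson_delta u P f + jackson_delta u P g"
  by (rule jackson_divide_inj[OF assms, of u])
     (simp add: jackson_delta[OF assms] distrib_left jackson_T_add)

text \<open>Polynomials in the \<open>c_ij\<close> are constants for \<open>jackson_T\<close> in any
  other variable, so both sides solve the equation that determines the quotient of
  \<open>f * t\<close>.\<close>

lemma jackson_delta_mult_T:
  assumes "1 - P \<noteq> 0" "t \<in> T_alg N" "u \<notin> C_vars N"
  shows "jackson_delta u P (f * t) = jackson_delta u P f * t"
proof (rule jackson_divide_inj[OF assms(1), of u])
  have "sconst (1 - P) * sindet u * (jackson_delta u P f * t) = (f - jackson_T u P f) * t"
    unfolding jackson_delta(1)[OF assms(1), symmetric] by (simp add: mult.assoc)
  then show "sconst (1 - P) * sindet u * jackson_delta u P (f * t) =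
      sconst (1 - P) * sindet u * (jackson_delta u P f * t)"
    using assms by (simp add: jackson_delta(1) jackson_T_mult jackson_T_T_alg[of t N] left_diff_distrib)
qed

lemma jackson_delta_A_alg:
  assumes "1 - P \<noteq> 0" "f \<in> A_alg N"
  shows "jackson_delta u P f \<in> A_alg N"
  using jackson_delta(2)[OF assms(1), of _ u f] assms(2)
  by (fastforce simp: A_alg_def keys_add_nat)

text \<open>Division by \<open>u\<close> lowers the degree \<open>n - e\<close>. The loss is
  recorded by raising the offset \<open>e\<close>, which avoids subtracting natural numbers.\<close>

lemma jackson_delta_A_hom:
  assumes "1 - P \<noteq> 0" "f \<in> A_hom N n e"
  shows "jackson_delta u P f \<in> A_hom N n (e + xdeg N (Poly_Mapping.single u 1))"
  using jackson_delta(2)[OF assms(1), of _ u f] assms(2) jackson_delta_A_alg[OF assms(1), of f N u]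
  by (fastforce simp: A_hom_def xdeg_add)

lemma jackson_T_A_hom: "f \<in> A_hom N n e \<Longrightarrow> jackson_T u P f \<in> A_hom N n e"
  using keys_jackson_T[of u P f] by (auto simp: A_hom_supported supported_def)

section \<open>Reordering products of vectors\<close>

text \<open>Turns a transposition of positions into an exchange of two displayed letters, with the
  block between them explicit.\<close>

lemma permute_list_transpose:
  assumes "a < b" "b < length ws"
  obtains xs u zs v ys where "ws = xs @ u # zs @ v # ys"
    "permute_list (transpose a b) ws = xs @ v # zs @ u # ys"
proof -
  define ls where "ls = take (b - Suc a) (drop (Suc a) ws)"
  have ls: "length ls = b - Suc a" using assms by (simp add: ls_def)
  have split: "ws = take a ws @ ws ! a # ls @ ws ! b # drop (Suc b) ws"
  proof -
    have "ws = take a ws @ ws ! a # drop (Suc a) ws"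
      using assms by (intro id_take_nth_drop) simp
    moreover have "drop (Suc a) ws = ls @ drop (b - Suc a) (drop (Suc a) ws)"
      unfolding ls_def by (rule append_take_drop_id[symmetric])
    moreover have "drop (b - Suc a) (drop (Suc a) ws) = ws ! b # drop (Suc b) ws"
      using assms by (simp add: Cons_nth_drop_Suc)
    ultimately show ?thesis by metis
  qed
  have "permute_list (transpose a b) ws = take a ws @ ws ! b # ls @ ws ! a # drop (Suc b) ws"
  proof (rule nth_equalityI)
    show "length (permute_list (transpose a b) ws) =
        length (take a ws @ ws ! b # ls @ ws ! a # drop (Suc b) ws)"
      using assms ls by simp
    fix i assume "i < length (permute_list (transpose a b) ws)"
    then have i: "i < length ws" by simp
    have nth: "ws ! i = (take a ws @ ws ! a # ls @ ws ! b # drop (Suc b) ws) ! i"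
      using split by metis
    consider "i = a" | "i = b" | "i \<noteq> a" "i \<noteq> b" by blast
    then show "permute_list (transpose a b) ws ! i = (take a ws @ ws ! b # ls @ ws ! a # drop (Suc b) ws) ! i"
    proof cases
      case 3
      then have "permute_list (transpose a b) ws ! i = ws ! i"
        using i by (simp add: permute_list_def)
      also have "\<dots> = (take a ws @ ws ! b # ls @ ws ! a # drop (Suc b) ws) ! i"
        unfolding nth using 3 assms i ls by (auto simp: nth_append nth_Cons')
      finally show ?thesis .
    qed (use assms i ls in \<open>auto simp: permute_list_def nth_append nth_Cons'\<close>)
  qed
  with split show thesis by (rule that)
qed

text \<open>\<open>X\<close> is an additive subgroup containing every product of the letters of
  \<open>ws\<close> in which two adjacent factors are replaced by their anticommutator. Modulo
  \<open>X\<close> the letters therefore anticommute. For spanning \<open>X\<close> is a block; for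
  independence it consists of the elements that send the vacuum into low exterior degree.\<close>

locale reordering =
  fixes X :: "'r::ring_1 set" and f :: "'i \<Rightarrow> 'r" and ws :: "'i list"
  assumes X_zero: "0 \<in> X" and X_add: "F \<in> X \<Longrightarrow> G \<in> X \<Longrightarrow> F + G \<in> X"
    and X_uminus: "F \<in> X \<Longrightarrow> - F \<in> X"
    and contract: "mset (xs @ u # v # ys) = mset ws \<Longrightarrow>
      prod_list (map f xs) * anticomm (f u) (f v) * prod_list (map f ys) \<in> X"
begin

abbreviation "P xs \<equiv> prod_list (map f xs)"

lemma X_minus: "F \<in> X \<Longrightarrow> G \<in> X \<Longrightarrow> F - G \<in> X"
  using X_add[OF _ X_uminus, of F G] by simp

lemma X_sign: "F \<in> X \<Longrightarrow> s = 1 \<or> s = - 1 \<Longrightarrow> s * F \<in> X"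
  using X_uminus by auto

lemma X_sum: "(\<And>i. i \<in> I \<Longrightarrow> g i \<in> X) \<Longrightarrow> sum g I \<in> X"
  by (induction I rule: infinite_finite_induct) (auto intro: X_zero X_add)

lemma swap_adjacent:
  assumes "mset (xs @ u # v # ys) = mset ws"
  shows "P (xs @ u # v # ys) + P (xs @ v # u # ys) \<in> X"
  using contract[OF assms] by (simp add: anticomm_def algebra_simps)

lemma move:
  assumes "mset (xs @ u # zs @ ys) = mset ws"
  shows "P (xs @ u # zs @ ys) - (- 1) ^ length zs * P (xs @ zs @ u # ys) \<in> X"
  using assms
proof (induction zs arbitrary: xs)
  case Nil
  then show ?case using X_zero by simp
next
  case (Cons w zs)
  have "P (xs @ u # w # zs @ ys) + P (xs @ w # u # zs @ ys) \<in> X"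
    using Cons.prems by (intro swap_adjacent) simp
  moreover have "P ((xs @ [w]) @ u # zs @ ys) - (- 1) ^ length zs * P ((xs @ [w]) @ zs @ u # ys) \<in> X"
    using Cons.prems by (intro Cons.IH) (simp add: add_mset_commute)
  ultimately show ?case
    using X_minus by fastforce
qed

text \<open>In both products one letter is moved across \<open>zs\<close>, with the same sign, until
  \<open>u\<close> and \<open>v\<close> are adjacent; there a single exchange relates them.\<close>

lemma swap:
  assumes "mset (xs @ u # zs @ v # ys) = mset ws"
  shows "P (xs @ v # zs @ u # ys) + P (xs @ u # zs @ v # ys) \<in> X"
proof -
  define s :: 'r where "s = (- 1) ^ length zs"
  have s: "s = 1 \<or> s = - 1" by (cases "even (length zs)") (simp_all add: s_def)
  have 1: "P (xs @ u # zs @ v # ys) - s * P (xs @ zs @ u # v # ys) \<in> X"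
    unfolding s_def using assms by (intro move)
  have 2: "P (xs @ v # zs @ u # ys) - s * P (xs @ zs @ v # u # ys) \<in> X"
    unfolding s_def using assms by (intro move) (simp add: add_mset_commute)
  have "P ((xs @ zs) @ u # v # ys) + P ((xs @ zs) @ v # u # ys) \<in> X"
    using assms by (intro swap_adjacent) (simp add: add_mset_commute)
  then have "s * (P (xs @ zs @ u # v # ys) + P (xs @ zs @ v # u # ys)) \<in> X"
    using s by (intro X_sign) simp_all
  from X_add[OF X_add[OF 1 2] this] show ?thesis
    by (simp add: algebra_simps)
qed

lemma swap_nth:
  assumes "a < length xs" "b < length xs" "a \<noteq> b" "mset xs = mset ws"
  shows "P (permute_list (transpose a b) xs) + P xs \<in> X"
  using assms
proof (induction a b rule: linorder_wlog)
  case (le a b)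
  then have "a < b" "b < length xs" by auto
  then obtain us u zs v ys where "xs = us @ u # zs @ v # ys"
    "permute_list (transpose a b) xs = us @ v # zs @ u # ys"
    by (rule permute_list_transpose)
  with le show ?case using swap by simp
qed (simp add: transpose_commute)

text \<open>One transposition is applied to the list and the rest of the permutation to the result.
  The list therefore varies in the induction, while its length \<open>n\<close> and its multiset
  stay fixed.\<close>

lemma permute_aux:
  assumes "\<pi> permutes {..<n}" "finite {..<n}" "length xs = n" "mset xs = mset ws"
  shows "P (permute_list \<pi> xs) - of_int (sign \<pi>) * P xs \<in> X"
  using assms
proof (induction \<pi> arbitrary: xs rule: permutes_induct)
  case id
  then show ?case using X_zero by simp
next
  case (swap a b p)
  let ?t = "transpose a b"
  define xs' where "xs' = permute_list ?t xs"
  define s :: 'r where "s = of_int (sign p)"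
  have s: "s = 1 \<or> s = - 1" by (simp add: s_def sign_def)
  have t: "?t permutes {..<length xs}"
    using swap by (auto intro: permutes_swap_id)
  have xs': "length xs' = n" "mset xs' = mset ws"
    using swap t by (simp_all add: xs'_def)
  have 1: "P (permute_list p xs') - s * P xs' \<in> X"
    unfolding s_def using xs' by (intro swap.IH)
  have 2: "s * (P xs' + P xs) \<in> X"
    unfolding xs'_def using swap by (intro X_sign swap_nth s) auto
  define \<sigma> where "\<sigma> = ?t \<circ> p"
  have "permute_list \<sigma> xs = permute_list p xs'"
    using swap by (simp add: xs'_def \<sigma>_def permute_list_compose)
  moreover have "sign \<sigma> = - sign p"
  proof -
    have "permutation p" using swap.hyps by (metis permutes_imp_permutation finite_lessThan)
    then show ?thesis
      unfolding \<sigma>_def using swap.hyps by (simp add: sign_compose permutation_swap_id sign_swap_id)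
  qed
  ultimately show ?case
    using X_add[OF 1 2] unfolding \<sigma>_def[symmetric] by (simp add: s_def algebra_simps)
qed

lemma permute:
  assumes "\<pi> permutes {..<length xs}" "mset xs = mset ws"
  shows "P (permute_list \<pi> xs) - of_int (sign \<pi>) * P xs \<in> X"
  using assms by (intro permute_aux) auto

text \<open>Allows the spanning argument to choose the order of the letters: a repeated letter in
  front, or all letters sorted.\<close>

lemma mset_eq_in_X:
  assumes "mset xs = mset ws" "P xs \<in> X"
  shows "P ws \<in> X"
proof -
  obtain \<pi> where \<pi>: "\<pi> permutes {..<length xs}" "permute_list \<pi> xs = ws"
    using mset_eq_permutation[of ws xs] assms by metis
  have "P ws - of_int (sign \<pi>) * P xs \<in> X"
    using permute[OF \<pi>(1) assms(1)] \<pi>(2) by simp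
  moreover have "of_int (sign \<pi>) * P xs \<in> X"
    using assms(2) by (intro X_sign) (simp_all add: sign_def)
  ultimately show ?thesis
    using X_add by fastforce
qed

end

section \<open>The radial algebra\<close>

lemma rconst_add: "rconst (a + b) = rconst a + rconst b"
  by transfer (simp add: free_const_def single_add radial_rel_def radial_ideal.zero)

lemma rconst_mult: "rconst (a * b) = rconst a * rconst b"
  by transfer (simp add: free_const_def mult_single radial_rel_def radial_ideal.zero plus_list_def)

lemma rconst_0: "rconst 0 = 0"
  by transfer (simp add: free_const_def radial_rel_def radial_ideal.zero)

lemma rconst_1: "rconst 1 = 1"
  by transfer (simp add: free_const_def single_one[symmetric] zero_list_def radial_rel_def radial_ideal.zero del: single_one)

lemma rconst_uminus: "rconst (- a) = - rconst a"
  by transfer (simp add: free_const_def single_uminus radial_rel_def radial_ideal.zero)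

lemma rconst_of_nat: "rconst (of_nat n) = of_nat n"
  by (induction n) (simp_all add: rconst_0 rconst_1 rconst_add)

lemma rconst_of_int: "rconst (of_int n) = of_int n"
  by (cases n) (simp_all add: rconst_of_nat rconst_uminus rconst_add rconst_1 del: of_nat_Suc)

lemma free_const_commute: "free_const c * f = f * free_const c"
  by (induction f rule: poly_mapping_induct)
     (simp_all add: free_const_def distrib_left distrib_right mult_single plus_list_def mult.commute)

lemma rconst_commute: "rconst c * F = F * rconst c"
  by transfer (simp add: free_const_commute radial_rel_def radial_ideal.zero)

lemma abs_radial_add: "abs_radial (f + g) = abs_radial f + abs_radial g"
  by (simp add: plus_radial.abs_eq)

lemma abs_radial_mult: "abs_radial (f * g) = abs_radial f * abs_radial g"
  by (simp add: times_radial.abs_eq)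

lemma abs_radial_single: "abs_radial (Poly_Mapping.single w c) = rconst c * prod_list (map rvar w)"
proof (induction w)
  case Nil
  then show ?case by (simp add: rconst.abs_eq free_const_def)
next
  case (Cons v w)
  have "Poly_Mapping.single (v # w) c = free_var v * Poly_Mapping.single w c"
    by (simp add: free_var_def mult_single plus_list_def)
  then have "abs_radial (Poly_Mapping.single (v # w) c) = rvar v * (rconst c * prod_list (map rvar w))"
    by (simp only: abs_radial_mult Cons rvar.abs_eq[symmetric])
  also have "\<dots> = rconst c * rvar v * prod_list (map rvar w)"
    by (metis mult.assoc rconst_commute)
  finally show ?case by (simp add: mult.assoc)
qed

lemma radial_induct [case_names zero add word]:
  assumes "P 0" "\<And>F G. P F \<Longrightarrow> P G \<Longrightarrow> P (F + G)"
    and "\<And>c w. P (rconst c * prod_list (map rvar w))"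
  shows "P F"
proof (induction F rule: radial.abs_induct)
  case (1 f)
  show ?case
  proof (induction f rule: poly_mapping_induct)
    case zero
    show ?case using assms(1) by (simp only: zero_radial_def)
  next
    case (add f g)
    then show ?case unfolding abs_radial_add by (rule assms(2))
  next
    case (single w c)
    show ?case unfolding abs_radial_single by (rule assms(3))
  qed
qed

section \<open>Central elements of the radial algebra\<close>

definition central :: "'a::ring_1 \<Rightarrow> bool" where
  "central z \<longleftrightarrow> (\<forall>F. z * F = F * z)"

lemma centralD: "central z \<Longrightarrow> F * z = z * F"
  by (simp add: central_def)

lemma central_left_commute: "central z \<Longrightarrow> F * (z * G) = z * (F * G)"
  by (metis central_def mult.assoc)

lemma central_closed:
  "central 0" "central 1" "central a \<Longrightarrow> central b \<Longrightarrow> central (a + b)"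
  "central a \<Longrightarrow> central b \<Longrightarrow> central (a * b)"
proof -
  assume ab: "central a" "central b"
  show "central (a * b)"
    unfolding central_def
  proof
    fix F
    have "a * b * F = a * (F * b)" using ab(2) by (simp add: mult.assoc central_def)
    also have "\<dots> = F * (b * a)" using ab(1) by (simp add: mult.assoc central_def)
    also have "b * a = a * b" using ab(1) by (simp add: central_def)
    finally show "a * b * F = F * (a * b)" .
  qed
qed (auto simp: central_def distrib_left distrib_right)

lemma central_power: "central a \<Longrightarrow> central (a ^ n)"
  by (induction n) (auto intro: central_closed)

lemma central_prod_list: "(\<And>a. a \<in> set as \<Longrightarrow> central a) \<Longrightarrow> central (prod_list as)"
  by (induction as) (auto intro: central_closed)

lemma central_sum: "(\<And>i. i \<in> I \<Longrightarrow> central (g i)) \<Longrightarrow> central (sum g I)"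
  by (induction I rule: infinite_finite_induct) (auto intro: central_closed)

lemma central_rconst: "central (rconst c)"
  by (simp add: central_def rconst_commute)

text \<open>The defining relation gives commutation with the generators, which extends to words and
  then to their linear combinations.\<close>

lemma central_anticomm: "central (anticomm (rvar u) (rvar v))"
proof -
  let ?z = "anticomm (rvar u) (rvar v) :: ('a, 'b) radial"
  have rvar: "?z * rvar w = rvar w * ?z" for w
    using radial_ideal.rel[of u v w, where ?'k='b]
    by (simp add: anticomm_def commut_def radial_rel_def rvar.abs_eq plus_radial.abs_eq
        times_radial.abs_eq radial.abs_eq_iff)
  have z_word: "?z * prod_list (map rvar w) = prod_list (map rvar w) * ?z" for w
  proof (induction w)
    case (Cons v w)
    have "?z * (rvar v * prod_list (map rvar w)) = rvar v * (?z * prod_list (map rvar w))"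
      unfolding mult.assoc[symmetric] rvar ..
    then show ?case by (simp only: Cons list.map prod_list.Cons mult.assoc)
  qed simp
  have "?z * F = F * ?z" for F
  proof (induction F rule: radial_induct)
    case (word c w)
    have "?z * (rconst c * prod_list (map rvar w)) = rconst c * (?z * prod_list (map rvar w))"
      by (metis mult.assoc rconst_commute)
    then show ?case by (simp only: z_word mult.assoc)
  qed (simp_all add: distrib_left distrib_right)
  then show ?thesis by (simp add: central_def)
qed

text \<open>A square is half an anticommutator. This makes \<open>x^2\<close> central and disposes
  of words with a repeated letter.\<close>

lemma rconst_half: "rconst (of_real (1 / 2) :: 'k::{comm_ring_1,real_algebra_1}) * (F + F) = F"
proof -
  have "rconst (of_real (1 / 2) :: 'k) * (F + F) = rconst (of_real (1 / 2) * 2) * F"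
    by (simp add: rconst_mult mult.assoc rconst_of_nat[of 2, simplified] mult_2)
  also have "of_real (1 / 2) * (2 :: 'k) = of_real (1 / 2 * 2)"
    by (simp only: of_real_mult of_real_numeral)
  finally show ?thesis by (simp add: rconst_1)
qed

lemma rvar_square:
  "rvar v * rvar v = rconst (of_real (1 / 2)) * anticomm (rvar v) (rvar v :: ('v, 'k::{comm_ring_1,real_algebra_1}) radial)"
  by (simp add: anticomm_def rconst_half)

lemma central_rvar_square: "central ((rvar v :: ('v, 'k::{comm_ring_1,real_algebra_1}) radial)\<^sup>2)"
  by (simp add: power2_eq_square rvar_square central_closed central_rconst central_anticomm)

text \<open>Each of the \<open>n!\<close> signed rearrangements is congruent to the ordered product
  modulo \<open>X\<close>, hence so is their average. The factor \<open>1 / n!\<close> is the reason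
  for asking that \<open>X\<close> be stable under constants.\<close>

lemma wedge_minus_prod:
  fixes f :: "'i \<Rightarrow> ('v, 'k::{comm_ring_1,real_algebra_1}) radial"
  assumes "reordering X f ws" and X_const: "\<And>c F. F \<in> X \<Longrightarrow> rconst c * F \<in> X"
  shows "wedge (map f ws) - prod_list (map f ws) \<in> X"
proof -
  interpret reordering X f ws by fact
  let ?n = "length ws" and ?\<Pi> = "{\<pi>. \<pi> permutes {..<length ws}}"
  let ?c = "rconst (of_real (1 / fact ?n) :: 'k)"
  let ?g = "\<lambda>\<pi>. of_int (sign \<pi>) * prod_list (map (\<lambda>i. map f ws ! \<pi> i) [0..<?n])"
  have g: "?g \<pi> - P ws \<in> X" if \<pi>: "\<pi> \<in> ?\<Pi>" for \<pi>
  proof -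
    have "?g \<pi> = of_int (sign \<pi>) * P (permute_list \<pi> ws)"
      using \<pi> by (simp add: permute_list_map[symmetric] permute_list_def[of _ "map f ws"])
    moreover have "of_int (sign \<pi>) * (P (permute_list \<pi> ws) - of_int (sign \<pi>) * P ws) \<in> X"
      using \<pi> by (intro X_sign permute) (simp_all add: sign_def)
    moreover have "of_int (sign \<pi>) * (of_int (sign \<pi>) * P ws) = P ws"
      by (simp add: sign_def)
    ultimately show ?thesis
      by (simp only: right_diff_distrib)
  qed
  have card: "card ?\<Pi> = fact ?n" by (rule card_permutations) simp_all
  have "P ws = rconst (of_real (1 / fact ?n * fact ?n) :: 'k) * P ws"
    by (simp add: rconst_1)
  also have "\<dots> = ?c * (of_nat (fact ?n) * P ws)"
    unfolding of_real_mult rconst_mult by (simp add: mult.assoc rconst_of_nat[symmetric])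
  also have "of_nat (fact ?n) * P ws = (\<Sum>\<pi>\<in>?\<Pi>. P ws)"
    by (simp add: card)
  finally have P: "P ws = ?c * (\<Sum>\<pi>\<in>?\<Pi>. P ws)" .
  have "wedge (map f ws) - P ws = ?c * (\<Sum>\<pi>\<in>?\<Pi>. ?g \<pi>) - ?c * (\<Sum>\<pi>\<in>?\<Pi>. P ws)"
    unfolding wedge_def length_map P[symmetric] ..
  also have "\<dots> = ?c * (\<Sum>\<pi>\<in>?\<Pi>. ?g \<pi> - P ws)"
    by (simp only: sum_subtractf right_diff_distrib)
  also have "\<dots> \<in> X"
    using g by (intro X_const X_sum)
  finally show ?thesis .
qed

section \<open>Evaluation of scalar polynomials\<close>

lemma central_anticomm_vec:
  "central (anticomm (xv x) (xv x))" "central (anticomm (xv x) (yv y i))" "central (anticomm (yv y i) (yv y j))"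
  by (simp_all add: xv_def yv_def central_anticomm)

lemma prod_list_power_add:
  fixes f :: "'a \<Rightarrow> 'b::ring_1"
  assumes "\<And>i. central (f i)"
  shows "prod_list (map (\<lambda>i. f i ^ (m i + n i)) l) =
    prod_list (map (\<lambda>i. f i ^ m i) l) * prod_list (map (\<lambda>i. f i ^ n i) l)"
proof (induction l)
  case (Cons a l)
  let ?M = "prod_list (map (\<lambda>i. f i ^ m i) l)"
  have "central ?M"
    by (rule central_prod_list) (auto intro: central_power assms)
  then have "f a ^ n a * ?M = ?M * f a ^ n a" by (rule centralD)
  then have "f a ^ n a * (?M * G) = ?M * (f a ^ n a * G)" for G
    by (simp add: mult.assoc[symmetric])
  then show ?case
    unfolding list.map prod_list.Cons Cons by (simp add: power_add[of "f a" "m a" "n a"] mult.assoc)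
qed simp

lemma prod_list_one: "prod_list (map (\<lambda>i. 1) l) = 1"
  by (induction l) auto

lemma prod_list_power_indicator:
  fixes f :: "'a \<Rightarrow> 'b::ring_1"
  assumes "distinct l"
  shows "prod_list (map (\<lambda>i. f i ^ (if i = a then 1 else 0)) l) = (if a \<in> set l then f a else 1)"
  using assms
proof (induction l)
  case (Cons b l)
  then show ?case by auto
qed simp

text \<open>Index 0 stands for \<open>x\<close>, so that all vectors form one family and the two
  kinds of wedges become wedges over subsets of \<open>{0..N}\<close>.\<close>

definition rvec :: "'v \<Rightarrow> (nat \<Rightarrow> 'v) \<Rightarrow> nat \<Rightarrow> 'v RB" where
  "rvec x y i = (if i = 0 then xv x else yv y i)"

definition cpairs :: "nat \<Rightarrow> (nat \<times> nat) list" where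
  "cpairs N = [(i, j). i \<leftarrow> [1..<Suc N], j \<leftarrow> [i..<Suc N]]"

lemma set_cpairs: "set (cpairs N) = {(i, j). 1 \<le> i \<and> i \<le> j \<and> j \<le> N}"
  by (force simp: cpairs_def)

lemma distinct_cpairs: "distinct (cpairs N)"
proof -
  have "distinct (concat (map (\<lambda>i. map (Pair i) [i..<Suc N]) l))" if "distinct l" for l
    using that by (induction l) (auto simp: distinct_map inj_on_def)
  from this[of "[1..<Suc N]"] show ?thesis
    by (simp add: cpairs_def)
qed

lemma eval_mono_unfold:
  "eval_mono x y N m = (xv x)\<^sup>2 ^ Poly_Mapping.lookup m RV *
     prod_list (map (\<lambda>i. anticomm (xv x) (yv y i) ^ Poly_Mapping.lookup m (SV i)) [1..<Suc N]) *
     prod_list (map (\<lambda>p. anticomm (yv y (fst p)) (yv y (snd p)) ^ Poly_Mapping.lookup m (CV (fst p) (snd p))) (cpairs N))"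
  by (simp add: eval_mono_def cpairs_def case_prod_unfold)

lemma central_xv_square: "central ((xv x)\<^sup>2)"
  by (simp add: xv_def central_rvar_square)

lemma central_eval_mono_factors:
  "central ((xv x)\<^sup>2 ^ k)"
  "central (prod_list (map (\<lambda>i. anticomm (xv x) (yv y i) ^ m i) l))"
  "central (prod_list (map (\<lambda>p. anticomm (yv y (fst p)) (yv y (snd p)) ^ m' p) l'))"
proof -
  show "central ((xv x)\<^sup>2 ^ k)" by (rule central_power[OF central_xv_square])
qed (rule central_prod_list; auto intro: central_power central_anticomm_vec)+

lemma central_eval_mono: "central (eval_mono x y N m)"
  unfolding eval_mono_unfold by (intro central_closed(4) central_eval_mono_factors)

lemma eval_mono_add: "eval_mono x y N (m + n) = eval_mono x y N m * eval_mono x y N n"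
proof -
  have *: "a * a' * (b * b') * (c * c') = a * b * c * (a' * b' * c')"
    if b: "central b" and c: "central c" for a a' b b' c c' :: "'a RB"
    by (simp only: mult.assoc central_left_commute[OF c, of a'] central_left_commute[OF c, of b']
        central_left_commute[OF b, of a'])
  show ?thesis
    unfolding eval_mono_unfold lookup_add
    apply (subst prod_list_power_add, rule central_anticomm_vec)
    apply (subst prod_list_power_add, rule central_anticomm_vec)
    apply (subst power_add)
    by (rule *[OF central_eval_mono_factors(2,3)])
qed

lemma eval_mono_zero: "eval_mono x y N 0 = 1"
  by (simp add: eval_mono_unfold prod_list_one)

lemma ev_zero: "ev x y N 0 = 0"
  by (simp add: ev_def)

lemma ev_single: "ev x y N (Poly_Mapping.single m c) = rconst c * eval_mono x y N m"
  by (simp add: ev_def rconst_0)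

lemma ev_add: "ev x y N (A + B) = ev x y N A + ev x y N B"
  unfolding ev_def
  by (rule setsum_keys_plus_distrib) (simp_all add: rconst_0 rconst_add distrib_right)

lemma ev_uminus: "ev x y N (- A) = - ev x y N A"
  using ev_add[of x y N A "- A"] by (simp add: ev_zero eq_neg_iff_add_eq_0 add.commute)

lemma ev_diff: "ev x y N (A - B) = ev x y N A - ev x y N B"
  using ev_add[of x y N A "- B"] by (simp add: ev_uminus)

lemma ev_sum: "ev x y N (sum f I) = (\<Sum>i\<in>I. ev x y N (f i))"
  by (induction I rule: infinite_finite_induct) (simp_all add: ev_zero ev_add)

lemma ev_sconst: "ev x y N (sconst c) = rconst c"
  by (simp add: sconst_def ev_single eval_mono_zero)

lemma ev_one: "ev x y N 1 = 1"
  using ev_sconst[of x y N 1] by (simp add: sconst_def rconst_1)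

lemma central_ev: "central (ev x y N A)"
  unfolding ev_def by (intro central_sum central_closed central_rconst central_eval_mono)

lemma ev_mult: "ev x y N (A * B) = ev x y N A * ev x y N B"
proof (induction A rule: poly_mapping_induct)
  case (single m c)
  show ?case
  proof (induction B rule: poly_mapping_induct)
    case (single n d)
    have "rconst c * rconst d * (eval_mono x y N m * eval_mono x y N n) =
        rconst c * (eval_mono x y N m * (rconst d * eval_mono x y N n))"
      by (simp add: mult.assoc central_left_commute[OF central_rconst[of d], of "eval_mono x y N m"])
    then show ?case by (simp add: mult_single ev_single rconst_mult eval_mono_add mult.assoc)
  qed (simp_all add: ev_zero distrib_left ev_add)
qed (simp_all add: ev_zero distrib_right ev_add)

lemma eval_mono_single_RV: "eval_mono x y N (Poly_Mapping.single RV 1) = (xv x)\<^sup>2"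
  by (simp add: eval_mono_unfold lookup_single prod_list_one)

lemma eval_mono_single_SV:
  assumes "i \<in> {1..N}"
  shows "eval_mono x y N (Poly_Mapping.single (SV i) 1) = anticomm (xv x) (yv y i)"
proof -
  have "Poly_Mapping.lookup (Poly_Mapping.single (SV i) (1::nat)) (SV j) = (if j = i then 1 else 0)" for j
    by (auto simp: lookup_single when_def)
  then show ?thesis
    using assms by (simp add: eval_mono_unfold lookup_single prod_list_one prod_list_power_indicator del: power_Suc upt_Suc)
qed

lemma eval_mono_single_CV:
  assumes "1 \<le> i" "i \<le> j" "j \<le> N"
  shows "eval_mono x y N (Poly_Mapping.single (CV i j) 1) = anticomm (yv y i) (yv y j)"
proof -
  have "Poly_Mapping.lookup (Poly_Mapping.single (CV i j) (1::nat)) (CV (fst p) (snd p)) =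
      (if p = (i, j) then 1 else 0)" for p
    by (auto simp: lookup_single when_def)
  then show ?thesis
    using assms by (simp add: eval_mono_unfold lookup_single prod_list_one prod_list_power_indicator[OF distinct_cpairs] set_cpairs)
qed

lemmas eval_mono_single = eval_mono_single_RV[unfolded One_nat_def] eval_mono_single_SV[unfolded One_nat_def]
  eval_mono_single_CV[unfolded One_nat_def]

text \<open>The polynomial whose evaluation is the anticommutator of the vectors \<open>i\<close>
  and \<open>j\<close>. Since \<open>r = x^2\<close>, the entry for \<open>{x, x}\<close> is
  \<open>2 r\<close>; minimum and maximum occur because only \<open>CV i j\<close> with
  \<open>i \<le> j\<close> belongs to \<open>C_vars\<close>.\<close>

definition gram :: "nat \<Rightarrow> nat \<Rightarrow> spoly" where
  "gram i j = (if i = 0 \<and> j = 0 then sconst 2 * sindet RV else if i = 0 then sindet (SV j)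
     else if j = 0 then sindet (SV i) else sindet (CV (min i j) (max i j)))"

lemma gram_commute: "gram i j = gram j i"
  by (simp add: gram_def min.commute max.commute)

lemma anticomm_commute: "anticomm a b = anticomm b a"
  by (simp add: anticomm_def add.commute)

lemma ev_gram:
  fixes x :: 'v
  assumes "i \<le> N" "j \<le> N"
  shows "ev x y N (gram i j) = anticomm (rvec x y i) (rvec x y j)"
proof -
  have two: "rconst 2 = (2 :: 'v RB)" using rconst_of_nat[of 2] by simp
  have 0: "ev x y N (sconst 2 * sindet RV) = anticomm (xv x) (xv x)"
    by (simp add: two ev_mult ev_sconst sindet_def ev_single eval_mono_single rconst_1
        anticomm_def power2_eq_square mult_2)
  have 1: "ev x y N (sindet (SV i)) = anticomm (xv x) (yv y i)" if "i \<noteq> 0" "i \<le> N" for i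
    using that by (simp add: sindet_def ev_single eval_mono_single rconst_1)
  have 2: "ev x y N (sindet (CV i j)) = anticomm (yv y i) (yv y j)" if "i \<noteq> 0" "i \<le> j" "j \<le> N" for i j
    using that by (simp add: sindet_def ev_single eval_mono_single rconst_1)
  show ?thesis
    using assms by (auto simp: gram_def rvec_def 0 1 2 min_def max_def anticomm_commute)
qed

text \<open>Contracting two letters trades the letters \<open>x\<close> among them for an equal
  degree of the scalar, so that contraction stays inside a block.\<close>

lemma gram_hom:
  assumes "i \<le> N" "j \<le> N"
  shows "gram i j \<in> A_hom N (of_bool (i = 0) + of_bool (j = 0)) 0"
proof -
  have 1: "sindet u \<in> A_hom N (xdeg N (Poly_Mapping.single u 1)) 0" if "u \<in> RS_vars N \<union> C_vars N" for u
    using that unfolding A_hom_supported sindet_def by (intro supported_single) auto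
  have "sconst 2 \<in> A_hom N 0 0" by (intro T_alg_hom T_alg_closed)
  then have "sconst 2 * sindet RV \<in> A_hom N (0 + 2) (0 + 0)"
    using 1[of RV] by (intro A_hom_mult) (simp_all add: RS_vars_def xdeg_single')
  moreover have "sindet (SV i) \<in> A_hom N 1 0" if "i \<noteq> 0" "i \<le> N" for i
    using that 1[of "SV i"] by (simp add: RS_vars_def xdeg_single')
  moreover have "sindet (CV i j) \<in> A_hom N 0 0" if "i \<noteq> 0" "i \<le> j" "j \<le> N" for i j
    using that 1[of "CV i j"] by (auto simp: C_vars_def xdeg_C)
  ultimately show ?thesis
    using assms by (auto simp: gram_def min_def max_def numeral_2_eq_2)
qed

section \<open>Spanning by wedge products\<close>

lemma H_blockI:
  assumes "\<And>I. I \<subseteq> {1..N} \<Longrightarrow> A I \<in> A_hom N n 0" "\<And>I. I \<subseteq> {1..N} \<Longrightarrow> B I \<in> A_hom N n 1"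
  shows "(\<Sum>I\<in>Pow {1..N}. y_wedge y I * ev x y N (A I) + xy_wedge x y I * ev x y N (B I)) \<in> H_block x y N n"
  using assms unfolding H_block_def by blast

lemma H_blockE:
  assumes "F \<in> H_block x y N n"
  obtains A B where "\<And>I. I \<subseteq> {1..N} \<Longrightarrow> A I \<in> A_hom N n 0" "\<And>I. I \<subseteq> {1..N} \<Longrightarrow> B I \<in> A_hom N n 1"
    "F = (\<Sum>I\<in>Pow {1..N}. y_wedge y I * ev x y N (A I) + xy_wedge x y I * ev x y N (B I))"
  using assms unfolding H_block_def by blast

lemma H_block_zero: "0 \<in> H_block x y N n"
  using H_blockI[of N "\<lambda>_. 0" n "\<lambda>_. 0"] by (simp add: A_hom_closed ev_zero)

lemma H_block_add:
  assumes "F \<in> H_block x y N n" "G \<in> H_block x y N n"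
  shows "F + G \<in> H_block x y N n"
proof -
  obtain A B where F: "\<And>I. I \<subseteq> {1..N} \<Longrightarrow> A I \<in> A_hom N n 0" "\<And>I. I \<subseteq> {1..N} \<Longrightarrow> B I \<in> A_hom N n 1"
    "F = (\<Sum>I\<in>Pow {1..N}. y_wedge y I * ev x y N (A I) + xy_wedge x y I * ev x y N (B I))"
    using assms(1) by (rule H_blockE) blast
  obtain A' B' where G: "\<And>I. I \<subseteq> {1..N} \<Longrightarrow> A' I \<in> A_hom N n 0" "\<And>I. I \<subseteq> {1..N} \<Longrightarrow> B' I \<in> A_hom N n 1"
    "G = (\<Sum>I\<in>Pow {1..N}. y_wedge y I * ev x y N (A' I) + xy_wedge x y I * ev x y N (B' I))"
    using assms(2) by (rule H_blockE) blast
  have "F + G = (\<Sum>I\<in>Pow {1..N}. y_wedge y I * ev x y N (A I + A' I) + xy_wedge x y I * ev x y N (B I + B' I))"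
    unfolding F G sum.distrib[symmetric] by (simp add: ev_add algebra_simps)
  also have "\<dots> \<in> H_block x y N n"
    by (intro H_blockI A_hom_closed F G)
  finally show ?thesis .
qed

lemma H_block_mult_ev:
  assumes "F \<in> H_block x y N n" "C \<in> A_hom N n' 0"
  shows "F * ev x y N C \<in> H_block x y N (n + n')"
proof -
  obtain A B where F: "\<And>I. I \<subseteq> {1..N} \<Longrightarrow> A I \<in> A_hom N n 0" "\<And>I. I \<subseteq> {1..N} \<Longrightarrow> B I \<in> A_hom N n 1"
    "F = (\<Sum>I\<in>Pow {1..N}. y_wedge y I * ev x y N (A I) + xy_wedge x y I * ev x y N (B I))"
    using assms(1) by (rule H_blockE) blast
  have "F * ev x y N C = (\<Sum>I\<in>Pow {1..N}. y_wedge y I * ev x y N (A I * C) + xy_wedge x y I * ev x y N (B I * C))"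
    unfolding F sum_distrib_right by (simp add: ev_mult distrib_right mult.assoc)
  also have "\<dots> \<in> H_block x y N (n + n')"
    using A_hom_mult[OF F(1) assms(2)] A_hom_mult[OF F(2) assms(2)] by (intro H_blockI) auto
  finally show ?thesis .
qed

lemma H_block_rconst:
  assumes "F \<in> H_block x y N n"
  shows "rconst c * F \<in> H_block x y N n"
  using H_block_mult_ev[OF assms T_alg_hom[OF T_alg_closed(6)], of c] by (simp add: ev_sconst rconst_commute)

lemma H_block_uminus: "F \<in> H_block x y N n \<Longrightarrow> - F \<in> H_block x y N n"
  using H_block_rconst[of F x y N n "- 1"] by (simp add: rconst_uminus rconst_1)

lemma H_block_y:
  assumes "I \<subseteq> {1..N}" "A \<in> A_hom N n 0"
  shows "y_wedge y I * ev x y N A \<in> H_block x y N n"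
proof -
  have "(\<Sum>J\<in>Pow {1..N}. y_wedge y J * ev x y N (if J = I then A else 0) + xy_wedge x y J * ev x y N 0) \<in> H_block x y N n"
    using assms by (intro H_blockI) (auto intro: A_hom_closed)
  also have "(\<Sum>J\<in>Pow {1..N}. y_wedge y J * ev x y N (if J = I then A else 0) + xy_wedge x y J * ev x y N 0) =
      (\<Sum>J\<in>Pow {1..N}. if J = I then y_wedge y J * ev x y N A else 0)"
    by (intro sum.cong) (auto simp: ev_zero)
  finally show ?thesis using assms by (simp add: sum.delta)
qed

lemma H_block_xy:
  assumes "I \<subseteq> {1..N}" "A \<in> A_hom N n 1"
  shows "xy_wedge x y I * ev x y N A \<in> H_block x y N n"
proof -
  have "(\<Sum>J\<in>Pow {1..N}. y_wedge y J * ev x y N 0 + xy_wedge x y J * ev x y N (if J = I then A else 0)) \<in> H_block x y N n"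
    using assms by (intro H_blockI) (auto intro: A_hom_closed)
  also have "(\<Sum>J\<in>Pow {1..N}. y_wedge y J * ev x y N 0 + xy_wedge x y J * ev x y N (if J = I then A else 0)) =
      (\<Sum>J\<in>Pow {1..N}. if J = I then xy_wedge x y J * ev x y N A else 0)"
    by (intro sum.cong) (auto simp: ev_zero)
  finally show ?thesis using assms by (simp add: sum.delta)
qed

definition vec_wedge :: "'v \<Rightarrow> (nat \<Rightarrow> 'v) \<Rightarrow> nat set \<Rightarrow> 'v RB" where
  "vec_wedge x y J = wedge (map (rvec x y) (sorted_list_of_set J))"

lemma vec_wedge_y: "I \<subseteq> {1..N} \<Longrightarrow> vec_wedge x y I = y_wedge y I"
proof -
  assume I: "I \<subseteq> {1..N}"
  then have "finite I" by (rule finite_subset) simp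
  then have "map (rvec x y) (sorted_list_of_set I) = map (yv y) (sorted_list_of_set I)"
    using I by (auto simp: rvec_def)
  then show ?thesis by (simp only: vec_wedge_def y_wedge_def)
qed

text \<open>As the least index, 0 comes first in the sorted list, which puts \<open>x\<close> in
  front as in \<open>xy_wedge\<close>.\<close>

lemma vec_wedge_xy: "I \<subseteq> {1..N} \<Longrightarrow> vec_wedge x y (insert 0 I) = xy_wedge x y I"
proof -
  assume I: "I \<subseteq> {1..N}"
  then have fin: "finite I" by (rule finite_subset) simp
  have "sorted_list_of_set (insert 0 I) = 0 # sorted_list_of_set I"
  proof (rule sorted_list_of_set_unique[THEN iffD1])
    show "finite (insert 0 I)" using fin by simp
    show "sorted_wrt (<) (0 # sorted_list_of_set I) \<and> set (0 # sorted_list_of_set I) = insert 0 I \<and>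
        length (0 # sorted_list_of_set I) = card (insert 0 I)"
      using fin I by (auto simp: card_insert_if)
  qed
  moreover have "map (rvec x y) (sorted_list_of_set I) = map (yv y) (sorted_list_of_set I)"
    using I fin by (auto simp: rvec_def)
  ultimately have "map (rvec x y) (sorted_list_of_set (insert 0 I)) = xv x # map (yv y) (sorted_list_of_set I)"
    by (simp only: list.map) (simp add: rvec_def)
  then show ?thesis by (simp only: vec_wedge_def xy_wedge_def)
qed

lemma vec_wedge_H_block:
  assumes "J \<subseteq> {0..N}"
  shows "vec_wedge x y J \<in> H_block x y N (of_bool (0 \<in> J))"
proof (cases "0 \<in> J")
  case True
  define I where "I = J - {0}"
  have I: "I \<subseteq> {1..N}" "J = insert 0 I" using assms True by (auto simp: I_def Suc_le_eq)
  have "1 \<in> A_hom N 1 1"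
    using supported_single[of 0 "{m. Poly_Mapping.keys m \<subseteq> RS_vars N \<union> C_vars N \<and> 1 + xdeg N m = 1}" "1::qcoeff"]
    by (simp add: A_hom_supported xdeg_def)
  with I show ?thesis
    using H_block_xy[of I N 1 1 x y] by (simp add: vec_wedge_xy ev_one)
next
  case False
  then have I: "J \<subseteq> {1..N}" using assms by (auto simp: Suc_le_eq intro!: gr0I)
  with False show ?thesis
    using H_block_y[OF I T_alg_hom[OF T_alg_closed(2)]] by (simp add: vec_wedge_y ev_one)
qed

text \<open>Induction on the length. Modulo the block the letters anticommute, because a contraction
  leaves a shorter word times a scalar. A word with distinct letters can thus be sorted and compared
  with a wedge; one with a repeated letter reduces to a word beginning with a square.\<close>

lemma prod_vec_in_H_block:
  assumes "set ws \<subseteq> {0..N}"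
  shows "prod_list (map (rvec x y) ws) \<in> H_block x y N (count (mset ws) 0)"
  using assms
proof (induction "length ws" arbitrary: ws rule: less_induct)
  case less
  let ?X = "H_block x y N (count (mset ws) 0)"
  interpret reordering ?X "rvec x y" ws
  proof (rule reordering.intro)
    fix xs u v ys
    assume eq: "mset (xs @ u # v # ys) = mset ws"
    then have set: "set (xs @ u # v # ys) = set ws" and len: "length (xs @ u # v # ys) = length ws"
      by (metis set_mset_mset, metis size_mset)
    \<comment> \<open>The induction hypothesis applies to the word without \<open>u\<close> and
      \<open>v\<close>. The anticommutator is central, so it may stand at the end as an evaluated
      polynomial.\<close>
    have "prod_list (map (rvec x y) (xs @ ys)) * ev x y N (gram u v) \<in>
        H_block x y N (count (mset (xs @ ys)) 0 + (of_bool (u = 0) + of_bool (v = 0)))"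
      using less.prems set len by (intro H_block_mult_ev gram_hom less.hyps) auto
    also have "count (mset (xs @ ys)) 0 + (of_bool (u = 0) + of_bool (v = 0)) = count (mset ws) 0"
      unfolding eq[symmetric] by simp
    also have "prod_list (map (rvec x y) (xs @ ys)) * ev x y N (gram u v) =
        prod_list (map (rvec x y) xs) * ev x y N (gram u v) * prod_list (map (rvec x y) ys)"
      by (simp add: mult.assoc centralD[OF central_ev, of "prod_list (map (rvec x y) ys)"])
    also have "ev x y N (gram u v) = anticomm (rvec x y u) (rvec x y v)"
      using less.prems set by (intro ev_gram) auto
    finally show "prod_list (map (rvec x y) xs) * anticomm (rvec x y u) (rvec x y v) * prod_list (map (rvec x y) ys) \<in> ?X" .
  qed (auto intro: H_block_zero H_block_add H_block_uminus)
  show ?case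
  proof (cases "distinct ws")
    case False
    then obtain xs ys zs u where ws: "ws = xs @ [u] @ ys @ [u] @ zs"
      using not_distinct_decomp by blast
    show ?thesis
    proof (rule mset_eq_in_X)
      show "mset (u # u # xs @ ys @ zs) = mset ws" by (simp add: ws)
      then have "anticomm (rvec x y u) (rvec x y u) * P (xs @ ys @ zs) \<in> ?X"
        using contract[of "[]" u u "xs @ ys @ zs"] by simp
      then have "rconst (of_real (1 / 2)) * (anticomm (rvec x y u) (rvec x y u) * P (xs @ ys @ zs)) \<in> ?X"
        by (rule H_block_rconst)
      also have "rconst (of_real (1 / 2)) * (anticomm (rvec x y u) (rvec x y u) * P (xs @ ys @ zs)) = P (u # u # xs @ ys @ zs)"
        by (simp add: mult.assoc[symmetric] anticomm_def rconst_half)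
      finally show "P (u # u # xs @ ys @ zs) \<in> ?X" .
    qed
  next
    case True
    let ?s = "sorted_list_of_set (set ws)"
    have mset: "mset ?s = mset ws"
      using True mset_set_set[OF True] by (simp add: mset_sorted_list_of_multiset sorted_list_of_mset_set[symmetric])
    have ws_eq: "reordering ?X (rvec x y) ?s"
      using reordering_axioms unfolding reordering_def mset .
    \<comment> \<open>For distinct letters \<open>x\<close> occurs at most once, so the degree of
      the word is that of its wedge.\<close>
    have 0: "of_bool (0 \<in> set ws) = count (mset ws) 0"
      using True by (auto simp: distinct_count_atmost_1)
    have "wedge (map (rvec x y) ?s) \<in> ?X"
      using vec_wedge_H_block[OF less.prems, of x y] unfolding vec_wedge_def 0 .
    moreover have "wedge (map (rvec x y) ?s) - P ?s \<in> ?X"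
      by (rule wedge_minus_prod[OF ws_eq H_block_rconst])
    ultimately have "wedge (map (rvec x y) ?s) - (wedge (map (rvec x y) ?s) - P ?s) \<in> ?X"
      by (rule X_minus)
    then have "P ?s \<in> ?X" by simp
    then show ?thesis by (rule mset_eq_in_X[OF mset])
  qed
qed

section \<open>The Clifford representation\<close>

text \<open>The sign of moving the basis vector \<open>i\<close> to its sorted place among the
  indices of \<open>K\<close>: one factor -1 for each smaller index.\<close>

definition ord_sign :: "nat \<Rightarrow> nat set \<Rightarrow> spoly" where
  "ord_sign i K = (- 1) ^ card {j \<in> K. j < i}"

lemma ord_sign_square: "ord_sign i K * ord_sign i K = 1"
  by (simp add: ord_sign_def power_add[symmetric] mult_2[symmetric])

lemma ord_sign_insert:
  assumes "k \<notin> K"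
  shows "ord_sign i (insert k K) = (if k < i then - ord_sign i K else ord_sign i K)"
proof (cases "k < i")
  case True
  then have "{j \<in> insert k K. j < i} = insert k {j \<in> K. j < i}" by auto
  then show ?thesis using True assms by (simp add: ord_sign_def)
next
  case False
  then have "{j \<in> insert k K. j < i} = {j \<in> K. j < i}" by auto
  then show ?thesis using False by (simp add: ord_sign_def)
qed

lemma ord_sign_remove:
  assumes "k \<in> K"
  shows "ord_sign i (K - {k}) = (if k < i then - ord_sign i K else ord_sign i K)"
  using ord_sign_insert[of k "K - {k}" i] assms by (auto simp: insert_absorb)

text \<open>An element of the exterior algebra over the scalar polynomials, given by its
  coefficients: \<open>m K\<close> belongs to the exterior monomial with index set
  \<open>K\<close>.\<close>

type_synonym fock = "nat set \<Rightarrow> spoly"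

text \<open>Exterior multiplication by the basis vector \<open>i\<close>, read off at the monomial
  \<open>K\<close>. The companion \<open>annihilation\<close> is contraction with the dual basis
  vector.\<close>

definition creation :: "nat \<Rightarrow> fock \<Rightarrow> fock" where
  "creation i m K = (if i \<in> K then ord_sign i K * m (K - {i}) else 0)"

definition annihilation :: "nat \<Rightarrow> fock \<Rightarrow> fock" where
  "annihilation i m K = (if i \<in> K then 0 else ord_sign i K * m (insert i K))"

definition half_gram :: "nat \<Rightarrow> nat \<Rightarrow> spoly" where
  "half_gram i j = sconst (of_real (1 / 2)) * gram i j"

text \<open>A vector acts by exterior multiplication plus contraction; the symmetric form \<open>half_gram\<close> is
  chosen such that the anticommutator of two vectors is their \<open>gram\<close>.\<close>

definition clifford :: "nat \<Rightarrow> nat \<Rightarrow> fock \<Rightarrow> fock" where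
  "clifford N i m K = creation i m K + (\<Sum>j\<le>N. half_gram i j * annihilation j m K)"

text \<open>Removing the smaller of two indices flips the order sign of the larger one, but not
  conversely; so the two orders carry opposite signs. Contractions anticommute for the same
  reason.\<close>

lemma creation_anticommute: "creation i (creation k m) K + creation k (creation i m) K = 0"
  by (cases i k rule: linorder_cases)
     (auto simp: creation_def ord_sign_remove Diff_insert2[symmetric] insert_commute)

lemma annihilation_anticommute: "annihilation i (annihilation k m) K + annihilation k (annihilation i m) K = 0"
  by (cases i k rule: linorder_cases)
     (auto simp: annihilation_def ord_sign_insert insert_commute)

text \<open>For \<open>i = k\<close> exactly one of the terms survives, according to whether
  \<open>i\<close> lies in \<open>K\<close>, and its order sign occurs squared. For distinct indices
  the signs cancel as for two creations.\<close>

lemma creation_annihilation: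
  "creation i (annihilation k m) K + annihilation k (creation i m) K = (if i = k then m K else 0)"
proof (cases i k rule: linorder_cases)
  case equal
  then show ?thesis
    by (auto simp: creation_def annihilation_def ord_sign_insert ord_sign_remove mult.assoc[symmetric]
        ord_sign_square insert_absorb)
qed (auto simp: creation_def annihilation_def ord_sign_insert ord_sign_remove insert_Diff_if)

lemma sconst_add: "sconst (a + b) = sconst a + sconst b"
  by (simp add: sconst_def single_add)

lemma sconst_mult: "sconst (a * b) = sconst a * sconst b"
  by (simp add: sconst_def mult_single)

lemma sconst_one: "sconst 1 = 1"
  by (simp add: sconst_def)

lemma half_gram_double: "half_gram i j + half_gram j i = gram i j"
proof -
  have "half_gram i j + half_gram j i = sconst (of_real (1 / 2) + of_real (1 / 2)) * gram i j"
    by (simp only: half_gram_def gram_commute[of j i] sconst_add distrib_right)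
  also have "of_real (1 / 2) + of_real (1 / 2) = (of_real (1 / 2 + 1 / 2) :: qcoeff)"
    by (simp only: of_real_add)
  finally show ?thesis by (simp add: sconst_one)
qed

lemma creation_linear:
  "creation i (\<lambda>K. f K + (\<Sum>j\<in>J. c j * g j K)) K = creation i f K + (\<Sum>j\<in>J. c j * creation i (g j) K)"
  by (simp add: creation_def distrib_left sum_distrib_left mult.left_commute)

lemma annihilation_linear:
  "annihilation i (\<lambda>K. f K + (\<Sum>j\<in>J. c j * g j K)) K =
    annihilation i f K + (\<Sum>j\<in>J. c j * annihilation i (g j) K)"
  by (simp add: annihilation_def distrib_left sum_distrib_left mult.left_commute)

lemma clifford_comp:
  "clifford N i (clifford N k m) K =
    creation i (creation k m) K + (\<Sum>j\<le>N. half_gram k j * creation i (annihilation j m) K) +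
    (\<Sum>j\<le>N. half_gram i j * annihilation j (creation k m) K) +
    (\<Sum>j\<le>N. \<Sum>l\<le>N. half_gram i j * half_gram k l * annihilation j (annihilation l m) K)"
proof -
  have *: "clifford N k m = (\<lambda>K. creation k m K + (\<Sum>j\<le>N. half_gram k j * annihilation j m K))"
    by (simp add: fun_eq_iff clifford_def)
  show ?thesis
    unfolding clifford_def[of N i] unfolding * creation_linear annihilation_linear
    by (simp add: distrib_left sum.distrib sum_distrib_left mult.assoc)
qed

text \<open>Creations anticommute among themselves, and so do contractions. Only the mixed terms
  remain, and they contribute the two halves of \<open>gram i k\<close>.\<close>

lemma clifford_anticomm:
  assumes "i \<le> N" "k \<le> N"
  shows "clifford N i (clifford N k m) K + clifford N k (clifford N i m) K = gram i k * m K"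
proof -
  have 1: "(\<Sum>j\<le>N. half_gram k j * creation i (annihilation j m) K) +
      (\<Sum>j\<le>N. half_gram k j * annihilation j (creation i m) K) = half_gram k i * m K"
    if "i \<le> N" for i k
    using that by (simp add: sum.distrib[symmetric] distrib_left[symmetric] creation_annihilation if_distrib cong: if_cong)
  have 2: "(\<Sum>j\<le>N. \<Sum>l\<le>N. half_gram i j * half_gram k l * annihilation j (annihilation l m) K) +
      (\<Sum>j\<le>N. \<Sum>l\<le>N. half_gram k j * half_gram i l * annihilation j (annihilation l m) K) = 0"
  proof -
    \<comment> \<open>Exchanging the summation indices gives the first double sum with the two
      contractions in the opposite order.\<close>
    have "(\<Sum>j\<le>N. \<Sum>l\<le>N. half_gram k j * half_gram i l * annihilation j (annihilation l m) K) =
        (\<Sum>j\<le>N. \<Sum>l\<le>N. half_gram i j * half_gram k l * annihilation l (annihilation j m) K)"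
      by (subst sum.swap) (simp add: mult_ac)
    then show ?thesis
      by (simp add: sum.distrib[symmetric] distrib_left[symmetric] annihilation_anticommute)
  qed
  have "clifford N i (clifford N k m) K + clifford N k (clifford N i m) K =
      (creation i (creation k m) K + creation k (creation i m) K) +
      ((\<Sum>j\<le>N. half_gram k j * creation i (annihilation j m) K) +
        (\<Sum>j\<le>N. half_gram k j * annihilation j (creation i m) K)) +
      ((\<Sum>j\<le>N. half_gram i j * creation k (annihilation j m) K) +
        (\<Sum>j\<le>N. half_gram i j * annihilation j (creation k m) K)) +
      ((\<Sum>j\<le>N. \<Sum>l\<le>N. half_gram i j * half_gram k l * annihilation j (annihilation l m) K) +
      (\<Sum>j\<le>N. \<Sum>l\<le>N. half_gram k j * half_gram i l * annihilation j (annihilation l m) K))"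
    unfolding clifford_comp by (simp add: add_ac)
  also have "\<dots> = (half_gram k i + half_gram i k) * m K"
    unfolding 2 creation_anticommute 1[OF assms(1)] 1[OF assms(2)] by (simp add: distrib_right)
  finally show ?thesis by (simp add: half_gram_double gram_commute)
qed

lemma creation_annihilation_linear:
  "creation i (\<lambda>K. 0) K = 0" "annihilation i (\<lambda>K. 0) K = 0"
  "creation i (\<lambda>K. m K + n K) K = creation i m K + creation i n K"
  "annihilation i (\<lambda>K. m K + n K) K = annihilation i m K + annihilation i n K"
  "creation i (\<lambda>K. a * m K) K = a * creation i m K"
  "annihilation i (\<lambda>K. a * m K) K = a * annihilation i m K"
  by (simp_all add: creation_def annihilation_def distrib_left mult.left_commute)

lemma clifford_zero: "clifford N i (\<lambda>K. 0) = (\<lambda>K. 0)"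
  by (simp add: fun_eq_iff clifford_def creation_annihilation_linear)

lemma clifford_add: "clifford N i (\<lambda>K. m K + n K) = (\<lambda>K. clifford N i m K + clifford N i n K)"
  by (simp add: fun_eq_iff clifford_def creation_annihilation_linear distrib_left sum.distrib)

lemma clifford_scale: "clifford N i (\<lambda>K. a * m K) = (\<lambda>K. a * clifford N i m K)"
  by (simp add: fun_eq_iff clifford_def creation_annihilation_linear distrib_left sum_distrib_left
      mult.left_commute)

section \<open>Words acting on the vacuum\<close>

definition word_act :: "nat \<Rightarrow> nat list \<Rightarrow> fock \<Rightarrow> fock" where
  "word_act N ws m = foldr (clifford N) ws m"

lemma word_act_simps:
  "word_act N [] m = m" "word_act N (i # ws) m = clifford N i (word_act N ws m)"
  by (simp_all add: word_act_def)

lemma word_act_append: "word_act N (ws @ ws') m = word_act N ws (word_act N ws' m)"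
  by (simp add: word_act_def)

lemma word_act_zero: "word_act N ws (\<lambda>K. 0) = (\<lambda>K. 0)"
  by (induction ws) (simp_all add: word_act_simps clifford_zero)

lemma word_act_add: "word_act N ws (\<lambda>K. m K + n K) = (\<lambda>K. word_act N ws m K + word_act N ws n K)"
  by (induction ws) (simp_all add: word_act_simps clifford_add)

lemma word_act_scale: "word_act N ws (\<lambda>K. a * m K) = (\<lambda>K. a * word_act N ws m K)"
  by (induction ws) (simp_all add: word_act_simps clifford_scale)

definition vacuum :: fock where
  "vacuum K = (if K = {} then 1 else 0)"

text \<open>Each letter raises the exterior degree by at most one, and the vacuum has degree
  zero.\<close>

lemma word_act_vacuum_high:
  assumes "K \<subseteq> {..N}" "length ws < card K"
  shows "word_act N ws vacuum K = 0"
  using assms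
proof (induction ws arbitrary: K)
  case Nil
  then show ?case by (auto simp: word_act_simps vacuum_def)
next
  case (Cons i ws)
  have fin: "finite K" using Cons.prems(1) finite_subset by blast
  have "word_act N ws vacuum (K - {i}) = 0" if "i \<in> K"
    using Cons.prems that fin by (intro Cons.IH) auto
  then have "creation i (word_act N ws vacuum) K = 0"
    by (simp add: creation_def)
  moreover have "annihilation j (word_act N ws vacuum) K = 0" if "j \<le> N" for j
    using Cons that fin by (auto simp: annihilation_def)
  ultimately show ?case by (simp add: word_act_simps clifford_def)
qed

text \<open>Contractions would need a component of still higher degree, which vanishes; so only
  creations contribute. In an increasing word each letter is smaller than those already acting, and
  every order sign is 1.\<close>

lemma word_act_vacuum_top:
  assumes "sorted_wrt (<) ws" "K \<subseteq> {..N}" "length ws \<le> card K"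
  shows "word_act N ws vacuum K = (if K = set ws then 1 else 0)"
  using assms
proof (induction ws arbitrary: K)
  case Nil
  then show ?case by (auto simp: word_act_simps vacuum_def)
next
  case (Cons i ws)
  have fin: "finite K" using Cons.prems(2) finite_subset by blast
  have "annihilation j (word_act N ws vacuum) K = 0" if "j \<le> N" for j
    using Cons.prems that fin by (auto simp: annihilation_def word_act_vacuum_high)
  moreover have "creation i (word_act N ws vacuum) K = (if K = set (i # ws) then 1 else 0)"
  proof (cases "i \<in> K")
    case True
    have "word_act N ws vacuum (K - {i}) = (if K - {i} = set ws then 1 else 0)"
      using Cons.prems True fin by (intro Cons.IH) auto
    moreover have "K - {i} = set ws \<longleftrightarrow> K = set (i # ws)"
    proof -
      have "i \<notin> set ws" using Cons.prems(1) by auto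
      then show ?thesis using True by auto
    qed
    moreover have "ord_sign i K = 1" if "K = set (i # ws)"
    proof -
      have none: "{j \<in> K. j < i} = {}" using that Cons.prems(1) by auto
      show ?thesis unfolding ord_sign_def none by simp
    qed
    ultimately show ?thesis using True by (auto simp: creation_def)
  qed (auto simp: creation_def)
  ultimately show ?case by (simp add: word_act_simps clifford_def)
qed

section \<open>The radial algebra acting on the exterior algebra\<close>

locale radial_vars =
  fixes x :: 'v and y :: "nat \<Rightarrow> 'v" and N :: nat
  assumes bij: "bij_betw y {1..N} (UNIV - {x})"
begin

definition idx :: "'v \<Rightarrow> nat" where
  "idx v = (if v = x then 0 else inv_into {1..N} y v)"

lemma y_neq_x: "i \<in> {1..N} \<Longrightarrow> y i \<noteq> x"
  using bij by (auto simp: bij_betw_def)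

lemma idx_x: "idx x = 0"
  by (simp add: idx_def)

lemma idx_y: "i \<in> {1..N} \<Longrightarrow> idx (y i) = i"
  using y_neq_x bij by (simp add: idx_def bij_betw_def)

lemma idx_in: "v \<noteq> x \<Longrightarrow> idx v \<in> {1..N}"
  using bij inv_into_into[of v y "{1..N}"] by (simp add: idx_def bij_betw_def)

lemma idx_le: "idx v \<le> N"
  using idx_in[of v] by (cases "v = x") (auto simp: idx_x)

lemma rvec_idx: "rvec x y (idx v) = rvar v"
proof (cases "v = x")
  case False
  then have "y (idx v) = v"
    using bij by (auto simp: idx_def bij_betw_def intro!: f_inv_into_f)
  with False show ?thesis using idx_in[of v] by (simp add: rvec_def yv_def)
qed (simp add: idx_x rvec_def xv_def)

definition free_act :: "('v, qcoeff) free_alg \<Rightarrow> fock \<Rightarrow> fock" where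
  "free_act f m K = (\<Sum>w\<in>Poly_Mapping.keys f. sconst (Poly_Mapping.lookup f w) * word_act N (map idx w) m K)"

lemma free_act_zero: "free_act 0 m = (\<lambda>K. 0)"
  by (simp add: free_act_def fun_eq_iff)

lemma free_act_add: "free_act (f + g) m = (\<lambda>K. free_act f m K + free_act g m K)"
  unfolding free_act_def
  by (rule ext, rule setsum_keys_plus_distrib) (simp_all add: sconst_def single_add distrib_right)

lemma free_act_single: "free_act (Poly_Mapping.single w c) m = (\<lambda>K. sconst c * word_act N (map idx w) m K)"
  by (simp add: free_act_def fun_eq_iff sconst_def)

lemma free_act_uminus: "free_act (- f) m = (\<lambda>K. - free_act f m K)"
proof
  fix K
  have "free_act f m K + free_act (- f) m K = 0"
    using fun_cong[OF free_act_add[of f "- f" m], of K] by (simp add: free_act_zero)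
  then show "free_act (- f) m K = - free_act f m K"
    by (simp add: eq_neg_iff_add_eq_0 add.commute)
qed

lemma free_act_diff: "free_act (f - g) m = (\<lambda>K. free_act f m K - free_act g m K)"
  using free_act_add[of f "- g" m] by (simp add: free_act_uminus)

lemma free_act_mult: "free_act (f * g) m = free_act f (free_act g m)"
proof (induction f rule: poly_mapping_induct)
  case (single w c)
  show ?case
  proof (induction g rule: poly_mapping_induct)
    case (single v d)
    have "sconst (c * d) = sconst c * sconst d" by (simp add: sconst_def mult_single)
    then show ?case
      by (simp add: mult_single plus_list_def free_act_single word_act_append word_act_scale mult.assoc)
  qed (simp_all add: free_act_zero free_act_single word_act_zero distrib_left free_act_add word_act_add)
qed (simp_all add: free_act_zero free_act_add distrib_right)

lemma free_act_scale: "free_act f (\<lambda>K. a * m K) = (\<lambda>K. a * free_act f m K)"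
  by (simp add: fun_eq_iff free_act_def word_act_scale sum_distrib_left mult.left_commute)

lemma free_act_vanish: "free_act f (\<lambda>K. 0) = (\<lambda>K. 0)"
  by (simp add: fun_eq_iff free_act_def word_act_zero)

lemma free_act_var: "free_act (free_var v) m = clifford N (idx v) m"
  by (simp add: free_var_def free_act_single word_act_simps sconst_def)

lemma free_act_anticomm:
  "free_act (anticomm (free_var u) (free_var v)) m = (\<lambda>K. gram (idx u) (idx v) * m K)"
  by (simp add: anticomm_def free_act_add free_act_mult free_act_var clifford_anticomm idx_le)

text \<open>The anticommutator of two letters acts as multiplication by a polynomial, and all
  letters act linearly over the polynomials. Hence the generators of the ideal act by zero, and with
  them the ideal.\<close>

lemma free_act_radial_ideal: "f \<in> radial_ideal \<Longrightarrow> free_act f m = (\<lambda>K. 0)"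
proof (induction f arbitrary: m rule: radial_ideal.induct)
  case (rel u v w)
  show ?case
    unfolding commut_def free_act_diff free_act_mult[of "anticomm _ _"] free_act_mult[of _ "anticomm _ _"]
      free_act_anticomm by (simp add: free_act_scale)
qed (simp_all add: free_act_zero free_act_add free_act_mult free_act_vanish)

text \<open>Defined through a chosen representative; \<open>ract_abs\<close> shows that any other
  one gives the same operator, since the ideal acts by zero.\<close>

definition ract :: "'v RB \<Rightarrow> fock \<Rightarrow> fock" where
  "ract F = free_act (rep_radial F)"

lemma ract_abs: "ract (abs_radial f) m = free_act f m"
proof -
  have "abs_radial (rep_radial (abs_radial f)) = abs_radial f"
    by (rule Quotient_abs_rep[OF Quotient_radial])
  then have "rep_radial (abs_radial f) - f \<in> radial_ideal"
    by (simp add: radial.abs_eq_iff radial_rel_def)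
  from free_act_radial_ideal[OF this, of m] show ?thesis
    by (simp add: ract_def free_act_diff fun_eq_iff)
qed

lemma ract_add: "ract (F + G) m = (\<lambda>K. ract F m K + ract G m K)"
proof (induction F rule: radial.abs_induct)
  case (1 f)
  show ?case
    by (induction G rule: radial.abs_induct)
       (simp only: abs_radial_add[symmetric] ract_abs free_act_add)
qed

lemma ract_mult: "ract (F * G) m = ract F (ract G m)"
proof (induction F rule: radial.abs_induct)
  case (1 f)
  show ?case
    by (induction G rule: radial.abs_induct)
       (simp only: abs_radial_mult[symmetric] ract_abs free_act_mult)
qed

lemma ract_zero: "ract 0 m = (\<lambda>K. 0)"
  unfolding zero_radial_def by (simp add: ract_abs free_act_zero)

lemma ract_uminus: "ract (- F) m = (\<lambda>K. - ract F m K)"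
proof
  fix K
  have "ract F m K + ract (- F) m K = 0"
    using fun_cong[OF ract_add[of F "- F" m], of K] by (simp add: ract_zero)
  then show "ract (- F) m K = - ract F m K"
    by (simp add: eq_neg_iff_add_eq_0 add.commute)
qed

lemma ract_sum: "ract (sum F I) m = (\<lambda>K. \<Sum>i\<in>I. ract (F i) m K)"
  by (induction I rule: infinite_finite_induct) (simp_all add: ract_zero ract_add)

lemma ract_rconst: "ract (rconst c) m = (\<lambda>K. sconst c * m K)"
  by (simp add: rconst.abs_eq ract_abs free_const_def free_act_single word_act_simps)

lemma ract_rvar: "ract (rvar v) m = clifford N (idx v) m"
  by (simp add: rvar.abs_eq ract_abs free_act_var)

lemma ract_scale: "ract F (\<lambda>K. a * m K) = (\<lambda>K. a * ract F m K)"
  by (simp add: ract_def free_act_scale)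

lemma ract_rvec: "i \<le> N \<Longrightarrow> ract (rvec x y i) m = clifford N i m"
proof (cases "i = 0")
  case False
  moreover assume "i \<le> N"
  ultimately show ?thesis using idx_y[of i] by (simp add: rvec_def yv_def ract_rvar)
qed (simp add: rvec_def xv_def ract_rvar idx_x)

lemma ract_prod_rvec: "set ws \<subseteq> {0..N} \<Longrightarrow> ract (prod_list (map (rvec x y) ws)) m = word_act N ws m"
proof (induction ws)
  case Nil
  show ?case using ract_rconst[of 1 m] by (simp add: rconst_1 word_act_simps sconst_def)
qed (simp add: ract_mult ract_rvec word_act_simps)

text \<open>For an evaluated polynomial \<open>p\<close> turns out to be that polynomial itself
  (\<open>acts_by_ev\<close>). A relation between evaluations thus becomes one between polynomials,
  which covers the algebraic independence of \<open>r\<close>, \<open>s_i\<close>,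
  \<open>c_ij\<close>.\<close>

definition acts_by :: "'v RB \<Rightarrow> spoly \<Rightarrow> bool" where
  "acts_by F p \<longleftrightarrow> (\<forall>m. ract F m = (\<lambda>K. p * m K))"

lemma acts_by_rconst: "acts_by (rconst c) (sconst c)"
  by (simp add: acts_by_def ract_rconst)

lemma acts_by_one: "acts_by 1 1"
  using acts_by_rconst[of 1] by (simp add: rconst_1 sconst_def)

lemma acts_by_mult: "acts_by F p \<Longrightarrow> acts_by G p' \<Longrightarrow> acts_by (F * G) (p * p')"
  by (simp add: acts_by_def ract_mult mult.assoc)

lemma acts_by_add: "acts_by F p \<Longrightarrow> acts_by G p' \<Longrightarrow> acts_by (F + G) (p + p')"
  by (simp add: acts_by_def ract_add distrib_right)

lemma acts_by_anticomm: "i \<le> N \<Longrightarrow> j \<le> N \<Longrightarrow> acts_by (anticomm (rvec x y i) (rvec x y j)) (gram i j)"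
  by (simp add: acts_by_def anticomm_def ract_add ract_mult ract_rvec clifford_anticomm)

lemma acts_by_eval_mono:
  assumes "Poly_Mapping.keys k \<subseteq> RS_vars N \<union> C_vars N"
  shows "acts_by (eval_mono x y N k) (Poly_Mapping.single k 1)"
  using assms
proof (induction k rule: poly_mapping_keys_induct)
  case zero
  show ?case by (simp add: eval_mono_zero acts_by_one)
next
  case (add f g)
  from acts_by_mult[OF this] show ?case by (simp add: eval_mono_add mult_single)
next
  case (single u n)
  have 1: "acts_by (eval_mono x y N (Poly_Mapping.single u 1)) (Poly_Mapping.single (Poly_Mapping.single u 1) 1)"
  proof -
    consider "u = RV" | i where "u = SV i" "i \<in> {1..N}" | i j where "u = CV i j" "1 \<le> i" "i \<le> j" "j \<le> N"
      using single by (auto simp: RS_vars_def C_vars_def)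
    then show ?thesis
    proof cases
      case 1
      \<comment> \<open>The indeterminate \<open>r\<close> is not an entry of \<open>gram\<close>,
        but half of the entry \<open>2 r\<close>.\<close>
      have "acts_by (rconst (of_real (1 / 2)) * anticomm (rvec x y 0) (rvec x y 0)) (sconst (of_real (1 / 2)) * gram 0 0)"
        by (intro acts_by_mult acts_by_rconst acts_by_anticomm) simp_all
      also have "rconst (of_real (1 / 2)) * anticomm (rvec x y 0) (rvec x y 0) = (xv x)\<^sup>2"
        by (simp add: rvec_def power2_eq_square anticomm_def rconst_half)
      also have "sconst (of_real (1 / 2)) * gram 0 0 = sindet RV"
      proof -
        have "of_real (1 / 2) * 2 = (of_real (1 / 2 * 2) :: qcoeff)"
          by (simp only: of_real_mult of_real_numeral)
        then show ?thesis
          by (simp add: gram_def mult.assoc[symmetric] sconst_mult[symmetric] sconst_one)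
      qed
      finally show ?thesis by (simp add: 1 eval_mono_single sindet_def)
    next
      case (2 i)
      then show ?thesis
        using acts_by_anticomm[of 0 i] by (simp add: eval_mono_single rvec_def gram_def sindet_def)
    next
      case (3 i j)
      then show ?thesis
        using acts_by_anticomm[of i j] by (simp add: eval_mono_single rvec_def gram_def sindet_def)
    qed
  qed
  show ?case
  proof (induction n)
    case 0
    show ?case by (simp add: eval_mono_zero acts_by_one)
  next
    case (Suc n)
    have "Poly_Mapping.single u (Suc n) = Poly_Mapping.single u 1 + Poly_Mapping.single u n"
      by (simp add: single_add[symmetric])
    then show ?case
      using acts_by_mult[OF 1 Suc] by (simp add: eval_mono_add mult_single)
  qed
qed

lemma acts_by_ev: "A \<in> A_alg N \<Longrightarrow> acts_by (ev x y N A) A"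
  unfolding A_alg_supported
proof (induction A rule: supported_induct)
  case zero
  show ?case by (simp add: ev_zero acts_by_def ract_zero)
next
  case (single k c)
  then have "acts_by (rconst c * eval_mono x y N k) (sconst c * Poly_Mapping.single k 1)"
    by (intro acts_by_mult acts_by_rconst acts_by_eval_mono) simp
  then show ?case by (simp add: ev_single sconst_def mult_single)
qed (simp_all add: ev_add acts_by_add)

text \<open>Here \<open>X\<close> consists of the elements that annihilate the vacuum in all
  components of size at least \<open>card J\<close>. A contraction gives a scalar times a word two
  letters shorter, which lies in \<open>X\<close>, so the wedge may be replaced by the sorted
  word.\<close>

lemma ract_vec_wedge:
  assumes J: "J \<subseteq> {..N}" and K: "K \<subseteq> {..N}" "card J \<le> card K"
  shows "ract (vec_wedge x y J) vacuum K = (if K = J then 1 else 0)"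
proof -
  let ?s = "sorted_list_of_set J"
  let ?X = "{F. \<forall>K. K \<subseteq> {..N} \<longrightarrow> card J \<le> card K \<longrightarrow> ract F vacuum K = 0}"
  have fin: "finite J" using J finite_subset by blast
  have "reordering ?X (rvec x y) ?s"
  proof (rule reordering.intro)
    fix xs u v ys
    assume eq: "mset (xs @ u # v # ys) = mset ?s"
    then have set: "set (xs @ u # v # ys) = set ?s" and len: "length (xs @ u # v # ys) = length ?s"
      by (metis set_mset_mset, metis size_mset)
    have uv: "u \<le> N" "v \<le> N" "set xs \<subseteq> {0..N}" "set ys \<subseteq> {0..N}" "length (xs @ ys) < card J"
      using set len fin J by auto
    have "ract (prod_list (map (rvec x y) xs) * anticomm (rvec x y u) (rvec x y v) * prod_list (map (rvec x y) ys)) vacuum =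
        (\<lambda>K. gram u v * word_act N (xs @ ys) vacuum K)"
      using uv acts_by_anticomm[of u v]
      by (simp add: ract_mult ract_prod_rvec acts_by_def word_act_scale word_act_append)
    moreover have "word_act N (xs @ ys) vacuum K = 0" if "K \<subseteq> {..N}" "card J \<le> card K" for K
      using that uv by (intro word_act_vacuum_high) auto
    ultimately show "prod_list (map (rvec x y) xs) * anticomm (rvec x y u) (rvec x y v) * prod_list (map (rvec x y) ys) \<in> ?X"
      by simp
  qed (auto simp: ract_zero ract_add ract_uminus)
  then have "vec_wedge x y J - prod_list (map (rvec x y) ?s) \<in> ?X"
    unfolding vec_wedge_def by (rule wedge_minus_prod) (simp add: ract_mult ract_rconst)
  then have "ract (vec_wedge x y J + - prod_list (map (rvec x y) ?s)) vacuum K = 0"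
    using K by simp
  then have "ract (vec_wedge x y J) vacuum K = ract (prod_list (map (rvec x y) ?s)) vacuum K"
    by (simp only: ract_add ract_uminus) simp
  also have "\<dots> = word_act N ?s vacuum K"
    using fin J by (subst ract_prod_rvec) auto
  also have "\<dots> = (if K = J then 1 else 0)"
    using fin K by (subst word_act_vacuum_top) auto
  finally show ?thesis .
qed

text \<open>Triangularity: the relation is applied to the vacuum and read off at \<open>K\<close>,
  beginning with the largest sets. Larger \<open>J\<close> have \<open>C J = 0\<close> by induction;
  among the others only \<open>J = K\<close> contributes.\<close>

lemma vec_wedge_independent:
  assumes C: "\<And>J. J \<subseteq> {..N} \<Longrightarrow> C J \<in> A_alg N"
    and zero: "(\<Sum>J\<in>Pow {..N}. vec_wedge x y J * ev x y N (C J)) = 0" and K: "K \<subseteq> {..N}"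
  shows "C K = 0"
  using K
\<comment> \<open>Subsets of \<open>{..N}\<close> have at most \<open>N + 1\<close> elements, so the
  difference is never truncated and decreases as \<open>K\<close> grows.\<close>
proof (induction "N + 1 - card K" arbitrary: K rule: less_induct)
  case less
  have le: "card J \<le> N + 1" if "J \<subseteq> {..N}" for J
    using card_mono[OF _ that] by simp
  have coeff: "ract (vec_wedge x y J * ev x y N (C J)) vacuum K = (if J = K then C K else 0)"
    if J: "J \<subseteq> {..N}" for J
  proof (cases "card J \<le> card K")
    case True
    have "ract (vec_wedge x y J * ev x y N (C J)) vacuum K = C J * ract (vec_wedge x y J) vacuum K"
      using acts_by_ev[OF C[OF J]] by (simp add: ract_mult acts_by_def ract_scale)
    then show ?thesis using ract_vec_wedge[OF J less.prems True] by auto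
  next
    case False
    then have "C J = 0" using le[OF J] J by (intro less.hyps) auto
    with False show ?thesis by (auto simp: ev_zero ract_zero)
  qed
  have "0 = (\<Sum>J\<in>Pow {..N}. ract (vec_wedge x y J * ev x y N (C J)) vacuum K)"
    using zero fun_cong[OF ract_sum[of "\<lambda>J. vec_wedge x y J * ev x y N (C J)" "Pow {..N}" vacuum], of K]
    by (simp add: ract_zero)
  also have "\<dots> = (\<Sum>J\<in>Pow {..N}. if J = K then C K else 0)"
    by (intro sum.cong coeff) auto
  also have "\<dots> = C K" using less.prems by simp
  finally show ?case by simp
qed

lemma sum_Pow_insert_zero:
  fixes f :: "nat set \<Rightarrow> 'c::comm_monoid_add"
  shows "(\<Sum>J\<in>Pow {..n}. f J) = (\<Sum>I\<in>Pow {1..n}. f I + f (insert 0 I))"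
proof -
  have eq: "{..n} = insert 0 {1..n}" by auto
  have "inj_on (insert 0) (Pow {1..n})"
    by (rule inj_on_inverseI[of _ "\<lambda>J. J - {0}"]) auto
  then have "(\<Sum>J\<in>Pow {..n}. f J) = (\<Sum>I\<in>Pow {1..n}. f I) + (\<Sum>I\<in>Pow {1..n}. f (insert 0 I))"
    unfolding eq Pow_insert by (subst sum.union_disjoint) (auto simp: sum.reindex)
  then show ?thesis by (simp add: sum.distrib)
qed

lemma wedge_independent:
  assumes A: "\<And>I. I \<subseteq> {1..N} \<Longrightarrow> A I \<in> A_alg N" "\<And>I. I \<subseteq> {1..N} \<Longrightarrow> B I \<in> A_alg N"
    and zero: "(\<Sum>I\<in>Pow {1..N}. y_wedge y I * ev x y N (A I) + xy_wedge x y I * ev x y N (B I)) = 0"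
    and I: "I \<subseteq> {1..N}"
  shows "A I = 0" "B I = 0"
proof -
  define C where "C J = (if 0 \<in> J then B (J - {0}) else A J)" for J
  have C: "C J \<in> A_alg N" if J: "J \<subseteq> {..N}" for J
  proof (cases "0 \<in> J")
    case True
    have "J - {0} \<subseteq> {1..N}" using J by (auto simp: Suc_le_eq)
    with True show ?thesis by (simp add: C_def A(2))
  next
    case False
    then have "J \<subseteq> {1..N}" using J by (auto simp: Suc_le_eq intro!: gr0I)
    with False show ?thesis by (simp add: C_def A(1))
  qed
  have CI: "C I = A I" "C (insert 0 I) = B I" if "I \<subseteq> {1..N}" for I
  proof -
    have "0 \<notin> I" using that by auto
    then show "C I = A I" "C (insert 0 I) = B I" by (simp_all add: C_def)
  qed
  have "(\<Sum>J\<in>Pow {..N}. vec_wedge x y J * ev x y N (C J)) = 0"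
    unfolding sum_Pow_insert_zero zero[symmetric]
    by (intro sum.cong) (auto simp: CI vec_wedge_y vec_wedge_xy)
  note * = vec_wedge_independent[OF C this]
  show "A I = 0" "B I = 0"
    using *[of I] *[of "insert 0 I"] I CI[OF I] by (auto simp: subset_iff)
qed

end

section \<open>The relative derivative\<close>

lemma SV_RV_notin_C: "RV \<notin> C_vars N" "SV i \<notin> C_vars N"
  by (auto simp: C_vars_def)

lemma scalar_deriv_add: "scalar_deriv x y N (A + B) = scalar_deriv x y N A + scalar_deriv x y N B"
  by (simp add: scalar_deriv_def jackson_delta_add[OF one_minus_qq] jackson_delta_add[OF one_minus_qq2] jackson_T_add ev_add
      distrib_left sum.distrib)

lemma scalar_deriv_mult_T:
  assumes "t \<in> T_alg N"
  shows "scalar_deriv x y N (A * t) = scalar_deriv x y N A * ev x y N t"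
  by (simp add: scalar_deriv_def jackson_delta_mult_T[OF one_minus_qq assms] jackson_delta_mult_T[OF one_minus_qq2 assms]
      SV_RV_notin_C jackson_T_mult jackson_T_T_alg[OF assms] ev_mult distrib_right sum_distrib_right mult.assoc)

lemma scalar_deriv_zero: "scalar_deriv x y N 0 = 0"
  using scalar_deriv_add[of x y N 0 0] by simp

context radial_vars
begin

abbreviation "E \<equiv> ev x y N"
abbreviation "sd \<equiv> scalar_deriv x y N"
abbreviation "H \<equiv> H_block x y N"

definition combination :: "(nat set \<Rightarrow> spoly) \<Rightarrow> (nat set \<Rightarrow> spoly) \<Rightarrow> 'v RB" where
  "combination A B = (\<Sum>I\<in>Pow {1..N}. y_wedge y I * E (A I) + xy_wedge x y I * E (B I))"

definition coeffs :: "(nat set \<Rightarrow> spoly) \<Rightarrow> bool" where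
  "coeffs A \<longleftrightarrow> (\<forall>I. I \<subseteq> {1..N} \<longrightarrow> A I \<in> A_alg N)"

lemma coeffs_add: "coeffs A \<Longrightarrow> coeffs A' \<Longrightarrow> coeffs (\<lambda>I. A I + A' I)"
  by (simp add: coeffs_def A_alg_closed)

lemma coeffs_mult: "coeffs A \<Longrightarrow> a \<in> A_alg N \<Longrightarrow> coeffs (\<lambda>I. A I * a)"
  by (simp add: coeffs_def A_alg_closed)

lemma coeffs_uminus: "coeffs A \<Longrightarrow> coeffs (\<lambda>I. - A I)"
  by (simp add: coeffs_def A_alg_closed)

lemma combination_add:
  "combination (\<lambda>I. A I + A' I) (\<lambda>I. B I + B' I) = combination A B + combination A' B'"
  by (simp add: combination_def sum.distrib[symmetric] ev_add algebra_simps)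

lemma combination_mult_ev:
  "combination (\<lambda>I. A I * a) (\<lambda>I. B I * a) = combination A B * E a"
  by (simp add: combination_def sum_distrib_right ev_mult distrib_right mult.assoc)

lemma combination_uminus: "combination (\<lambda>I. - A I) (\<lambda>I. - B I) = - combination A B"
  by (simp add: combination_def sum_negf[symmetric] ev_uminus)

lemma word_in_H: "prod_list (map rvar w) \<in> H (count_list w x)"
proof -
  have eq: "map (rvec x y) (map idx w) = map rvar w"
    by (simp add: rvec_idx)
  have 0: "idx v = 0 \<longleftrightarrow> v = x" for v
    using idx_in[of v] by (cases "v = x") (auto simp: idx_x)
  have "count (mset (map idx w)) 0 = count_list w x"
    by (induction w) (auto simp: 0)
  moreover have "prod_list (map (rvec x y) (map idx w)) \<in> H (count (mset (map idx w)) 0)"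
    by (rule prod_vec_in_H_block) (auto simp: idx_le)
  ultimately show ?thesis
    unfolding eq by simp
qed

lemma combination_surj: "\<exists>A B. coeffs A \<and> coeffs B \<and> F = combination A B"
proof (induction F rule: radial_induct)
  case zero
  have "coeffs (\<lambda>I. 0)" by (simp add: coeffs_def A_alg_closed)
  moreover have "0 = combination (\<lambda>I. 0) (\<lambda>I. 0)" by (simp add: combination_def ev_zero)
  ultimately show ?case by blast
next
  case (add F G)
  then obtain A B A' B' where AB: "coeffs A" "coeffs B" "F = combination A B"
    and AB': "coeffs A'" "coeffs B'" "G = combination A' B'" by blast
  have "F + G = combination (\<lambda>I. A I + A' I) (\<lambda>I. B I + B' I)"
    unfolding AB(3) AB'(3) by (rule combination_add[symmetric])
  then show ?case
    using coeffs_add[OF AB(1) AB'(1)] coeffs_add[OF AB(2) AB'(2)] by blast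
next
  case (word c w)
  have "rconst c * prod_list (map rvar w) \<in> H (count_list w x)"
    by (intro H_block_rconst word_in_H)
  then obtain A B where "\<And>I. I \<subseteq> {1..N} \<Longrightarrow> A I \<in> A_hom N (count_list w x) 0"
    "\<And>I. I \<subseteq> {1..N} \<Longrightarrow> B I \<in> A_hom N (count_list w x) 1"
    "rconst c * prod_list (map rvar w) = combination A B"
    unfolding combination_def by (rule H_blockE) blast
  then show ?case
    by (intro exI[of _ A] exI[of _ B]) (auto simp: coeffs_def intro: A_hom_sub)
qed

lemma combination_inj:
  assumes "coeffs A" "coeffs B" "coeffs A'" "coeffs B'" "combination A B = combination A' B'" "I \<subseteq> {1..N}"
  shows "A I = A' I" "B I = B' I"
proof -
  have "combination (\<lambda>I. A I + - A' I) (\<lambda>I. B I + - B' I) = 0"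
    using assms by (simp only: combination_add combination_uminus) simp
  moreover have "coeffs (\<lambda>I. A I + - A' I)" "coeffs (\<lambda>I. B I + - B' I)"
    using assms by (intro coeffs_add coeffs_uminus; simp)+
  ultimately have "A I + - A' I = 0" "B I + - B' I = 0"
    using wedge_independent[of "\<lambda>I. A I + - A' I" "\<lambda>I. B I + - B' I" I] assms(6)
    unfolding combination_def coeffs_def by blast+
  then show "A I = A' I" "B I = B' I" by simp_all
qed

section \<open>Existence and uniqueness of the derivative\<close>

definition bracket :: "nat set \<Rightarrow> 'v RB" where
  "bracket I = (- 1) ^ card I * rconst (q_m_bracket (- int (card I)))"

definition qpow :: "nat set \<Rightarrow> 'v RB" where
  "qpow I = rconst (q_m_pow (- int (card I)))"

lemma bracket_rconst: "bracket I = rconst ((- 1) ^ card I * q_m_bracket (- int (card I)))"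
  by (simp add: bracket_def rconst_mult rconst_of_int[of "(- 1) ^ card I", simplified])

definition deriv_combination :: "(nat set \<Rightarrow> spoly) \<Rightarrow> (nat set \<Rightarrow> spoly) \<Rightarrow> 'v RB" where
  "deriv_combination A B = (\<Sum>I\<in>Pow {1..N}. y_wedge y I * sd (A I) +
     (bracket I * y_wedge y I * E (B I) + qpow I * xy_wedge x y I * sd (B I)))"

lemma deriv_combination_cong:
  assumes "\<And>I. I \<subseteq> {1..N} \<Longrightarrow> A I = A' I" "\<And>I. I \<subseteq> {1..N} \<Longrightarrow> B I = B' I"
  shows "deriv_combination A B = deriv_combination A' B'"
  unfolding deriv_combination_def using assms by (intro sum.cong) auto

lemma deriv_combination_add:
  "deriv_combination (\<lambda>I. A I + A' I) (\<lambda>I. B I + B' I) = deriv_combination A B + deriv_combination A' B'"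
  by (simp add: deriv_combination_def sum.distrib[symmetric] ev_add scalar_deriv_add algebra_simps)

lemma deriv_combination_mult_T:
  assumes "t \<in> T_alg N"
  shows "deriv_combination (\<lambda>I. A I * t) (\<lambda>I. B I * t) = deriv_combination A B * E t"
  by (simp add: deriv_combination_def sum_distrib_right ev_mult scalar_deriv_mult_T[OF assms] distrib_right mult.assoc)

text \<open>The prescribed formula is applied to some expansion in wedges. Independence makes the
  coefficients on subsets of \<open>{1..N}\<close> unique, and \<open>deriv_combination\<close>
  depends on no others.\<close>

definition deriv :: "'v RB \<Rightarrow> 'v RB" where
  "deriv F = (case SOME (A, B). coeffs A \<and> coeffs B \<and> F = combination A B of
     (A, B) \<Rightarrow> deriv_combination A B)"

lemma deriv_combination:
  assumes "coeffs A" "coeffs B"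
  shows "deriv (combination A B) = deriv_combination A B"
proof -
  define p where "p = (SOME (A', B'). coeffs A' \<and> coeffs B' \<and> combination A B = combination A' B')"
  have "case p of (A', B') \<Rightarrow> coeffs A' \<and> coeffs B' \<and> combination A B = combination A' B'"
    unfolding p_def by (rule someI[of _ "(A, B)"]) (simp add: assms)
  then have "deriv_combination (fst p) (snd p) = deriv_combination A B"
    using combination_inj[of A B "fst p" "snd p"] assms
    by (intro deriv_combination_cong) (auto simp: case_prod_unfold)
  then show ?thesis
    unfolding deriv_def p_def[symmetric] by (simp add: case_prod_unfold)
qed

lemma deriv_add: "deriv (F + G) = deriv F + deriv G"
proof -
  obtain A B A' B' where "coeffs A" "coeffs B" "coeffs A'" "coeffs B'" "F = combination A B" "G = combination A' B'"
    using combination_surj by metis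
  then show ?thesis
    using deriv_combination[of "\<lambda>I. A I + A' I" "\<lambda>I. B I + B' I"]
    by (simp add: combination_add deriv_combination deriv_combination_add coeffs_add)
qed

lemma deriv_mult_T:
  assumes "t \<in> T_alg N"
  shows "deriv (F * E t) = deriv F * E t"
proof -
  obtain A B where "coeffs A" "coeffs B" "F = combination A B"
    using combination_surj by metis
  then show ?thesis
    using deriv_combination[of "\<lambda>I. A I * t" "\<lambda>I. B I * t"] assms
    by (simp add: combination_mult_ev deriv_combination deriv_combination_mult_T coeffs_mult T_alg_sub)
qed

lemma module_rconst: "Modules.module (\<lambda>b F. rconst b * F :: 'v RB)"
  by unfold_locales (simp_all add: distrib_left distrib_right rconst_add rconst_mult rconst_1 mult.assoc)

lemma coeffs_delta: "A \<in> A_alg N \<Longrightarrow> coeffs (\<lambda>J. if J = I then A else 0)" "coeffs (\<lambda>J. 0)"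
  by (simp_all add: coeffs_def A_alg_closed)

lemma deriv_y:
  assumes "I \<subseteq> {1..N}" "A \<in> A_alg N"
  shows "deriv (y_wedge y I * E A) = y_wedge y I * sd A"
proof -
  have "combination (\<lambda>J. if J = I then A else 0) (\<lambda>J. 0) =
      (\<Sum>J\<in>Pow {1..N}. if J = I then y_wedge y I * E A else 0)"
    unfolding combination_def by (intro sum.cong) (auto simp: ev_zero)
  moreover have "deriv_combination (\<lambda>J. if J = I then A else 0) (\<lambda>J. 0) =
      (\<Sum>J\<in>Pow {1..N}. if J = I then y_wedge y I * sd A else 0)"
    unfolding deriv_combination_def by (intro sum.cong) (auto simp: ev_zero scalar_deriv_zero)
  ultimately show ?thesis
    using deriv_combination[OF coeffs_delta(1)[OF assms(2), of I] coeffs_delta(2)] assms(1) by simp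
qed

lemma deriv_xy:
  assumes "I \<subseteq> {1..N}" "B \<in> A_alg N"
  shows "deriv (xy_wedge x y I * E B) = bracket I * y_wedge y I * E B + qpow I * xy_wedge x y I * sd B"
proof -
  have "combination (\<lambda>J. 0) (\<lambda>J. if J = I then B else 0) =
      (\<Sum>J\<in>Pow {1..N}. if J = I then xy_wedge x y I * E B else 0)"
    unfolding combination_def by (intro sum.cong) (auto simp: ev_zero)
  moreover have "deriv_combination (\<lambda>J. 0) (\<lambda>J. if J = I then B else 0) =
      (\<Sum>J\<in>Pow {1..N}. if J = I then bracket I * y_wedge y I * E B + qpow I * xy_wedge x y I * sd B else 0)"
    unfolding deriv_combination_def by (intro sum.cong) (auto simp: ev_zero scalar_deriv_zero)
  ultimately show ?thesis
    using deriv_combination[OF coeffs_delta(2) coeffs_delta(1)[OF assms(2), of I]] assms(1) by simp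
qed

lemma is_right_qderiv_deriv: "is_right_qderiv x y N deriv"
proof -
  have "deriv (rconst b * F) = rconst b * deriv F" for b F
    using deriv_mult_T[OF T_alg_closed(6), of F b] by (simp add: ev_sconst rconst_commute)
  then have "module_hom (\<lambda>b F. rconst b * F) (\<lambda>b F. rconst b * F) deriv"
    by (intro module_hom.intro module_hom_axioms.intro module_rconst) (simp_all add: deriv_add)
  then show ?thesis
    unfolding is_right_qderiv_def using deriv_y deriv_xy by (auto simp: bracket_def qpow_def)
qed

lemma is_right_qderiv_unique:
  assumes "is_right_qderiv x y N d"
  shows "d = deriv"
proof
  fix F
  obtain A B where AB: "coeffs A" "coeffs B" "F = combination A B"
    using combination_surj by metis
  interpret d: module_hom "\<lambda>b F. rconst b * F" "\<lambda>b F. rconst b * F" d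
    using assms by (simp add: is_right_qderiv_def)
  interpret deriv: module_hom "\<lambda>b F. rconst b * F" "\<lambda>b F. rconst b * F" deriv
    using is_right_qderiv_deriv by (simp add: is_right_qderiv_def)
  have "d (y_wedge y I * E (A I)) = deriv (y_wedge y I * E (A I))"
    "d (xy_wedge x y I * E (B I)) = deriv (xy_wedge x y I * E (B I))" if "I \<in> Pow {1..N}" for I
    using assms is_right_qderiv_deriv AB(1,2) that unfolding is_right_qderiv_def coeffs_def by auto
  then show "d F = deriv F"
    unfolding AB(3) combination_def by (simp add: d.sum deriv.sum d.add deriv.add)
qed

text \<open>Resolves the definite description; from here on the derivative is the explicit map
  \<open>deriv\<close>.\<close>

lemma right_qderiv_eq: "right_qderiv x y N = deriv"
  unfolding right_qderiv_def using is_right_qderiv_deriv is_right_qderiv_unique by (rule the_equality)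

section \<open>The grading by degree in x\<close>

text \<open>Integer degrees allow for the degrees \<open>n - e\<close> and \<open>n - e - 1\<close>
  of coefficients and their derivatives. In negative degree only 0 is left.\<close>

definition graded :: "int \<Rightarrow> 'v RB set" where
  "graded n = {F. \<exists>f. F = abs_radial f \<and> (\<forall>w\<in>Poly_Mapping.keys f. int (count_list w x) = n)}"

lemma gradedI: "(\<And>w. w \<in> Poly_Mapping.keys f \<Longrightarrow> int (count_list w x) = n) \<Longrightarrow> abs_radial f \<in> graded n"
  by (auto simp: graded_def)

lemma graded_zero: "0 \<in> graded n"
  unfolding zero_radial_def by (rule gradedI) simp

lemma graded_add: "F \<in> graded n \<Longrightarrow> G \<in> graded n \<Longrightarrow> F + G \<in> graded n"
proof -
  assume "F \<in> graded n" "G \<in> graded n"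
  then obtain f g where fg: "F = abs_radial f" "G = abs_radial g"
    "\<forall>w\<in>Poly_Mapping.keys f \<union> Poly_Mapping.keys g. int (count_list w x) = n"
    by (auto simp: graded_def)
  have "abs_radial (f + g) \<in> graded n"
    using fg(3) keys_add[of f g] by (intro gradedI) blast
  then show ?thesis by (simp add: fg abs_radial_add)
qed

lemma graded_mult:
  assumes "F \<in> graded n" "G \<in> graded m" "k = n + m"
  shows "F * G \<in> graded k"
proof -
  obtain f g where fg: "F = abs_radial f" "G = abs_radial g"
    "\<forall>w\<in>Poly_Mapping.keys f. int (count_list w x) = n" "\<forall>w\<in>Poly_Mapping.keys g. int (count_list w x) = m"
    using assms by (auto simp: graded_def)
  have "abs_radial (f * g) \<in> graded k"
    using keys_mult[of f g] fg(3,4) assms(3) by (intro gradedI) (fastforce simp: plus_list_def)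
  then show ?thesis by (simp add: fg abs_radial_mult)
qed

lemma graded_sum: "(\<And>i. i \<in> I \<Longrightarrow> F i \<in> graded n) \<Longrightarrow> sum F I \<in> graded n"
  by (induction I rule: infinite_finite_induct) (auto intro: graded_zero graded_add)

lemma graded_rconst: "rconst c \<in> graded 0"
  unfolding rconst.abs_eq by (rule gradedI) (auto simp: free_const_def split: if_splits)

lemma graded_one: "1 \<in> graded 0"
  using graded_rconst[of 1] by (simp add: rconst_1)

lemma graded_xv: "xv x \<in> graded 1"
  unfolding xv_def rvar.abs_eq by (rule gradedI) (auto simp: free_var_def split: if_splits)

lemma graded_yv: "i \<in> {1..N} \<Longrightarrow> yv y i \<in> graded 0"
  unfolding yv_def rvar.abs_eq using y_neq_x[of i]
  by (intro gradedI) (auto simp: free_var_def split: if_splits)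

lemma graded_anticomm: "F \<in> graded n \<Longrightarrow> G \<in> graded m \<Longrightarrow> k = n + m \<Longrightarrow> anticomm F G \<in> graded k"
  unfolding anticomm_def by (intro graded_add graded_mult[of F n G m] graded_mult[of G m F n]) auto

lemma graded_power: "F \<in> graded n \<Longrightarrow> F ^ k \<in> graded (int k * n)"
  by (induction k) (auto intro!: graded_mult graded_one simp: algebra_simps)

lemma graded_prod_list:
  "(\<And>i. i \<in> set l \<Longrightarrow> F i \<in> graded (d i)) \<Longrightarrow> prod_list (map F l) \<in> graded (sum_list (map d l))"
  by (induction l) (auto intro!: graded_mult graded_one)

lemma graded_eval_mono: "eval_mono x y N m \<in> graded (int (xdeg N m))"
proof -
  have "(xv x)\<^sup>2 ^ Poly_Mapping.lookup m RV \<in> graded (int (Poly_Mapping.lookup m RV) * 2)"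
    using graded_power[OF graded_xv, of 2] by (intro graded_power) simp
  moreover have "prod_list (map (\<lambda>i. anticomm (xv x) (yv y i) ^ Poly_Mapping.lookup m (SV i)) [1..<Suc N]) \<in>
      graded (sum_list (map (\<lambda>i. int (Poly_Mapping.lookup m (SV i)) * 1) [1..<Suc N]))"
    by (intro graded_prod_list graded_power graded_anticomm[OF graded_xv graded_yv]) auto
  moreover have "prod_list (map (\<lambda>p. anticomm (yv y (fst p)) (yv y (snd p)) ^ Poly_Mapping.lookup m (CV (fst p) (snd p))) (cpairs N)) \<in>
      graded (sum_list (map (\<lambda>p. int (Poly_Mapping.lookup m (CV (fst p) (snd p))) * 0) (cpairs N)))"
    by (intro graded_prod_list graded_power graded_anticomm[OF graded_yv graded_yv]) (auto simp: set_cpairs)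
  ultimately show ?thesis
    unfolding eval_mono_unfold
    by (rule graded_mult[OF graded_mult[OF _ _ refl]])
       (simp add: xdeg_def sum_list_distinct_conv_sum_set atLeastLessThanSuc_atLeastAtMost del: upt_Suc)
qed

lemma graded_ev: "A \<in> A_hom N n e \<Longrightarrow> E A \<in> graded (int n - int e)"
  unfolding A_hom_supported
proof (induction A rule: supported_induct)
  case (single k c)
  then have "int n - int e = 0 + int (xdeg N k)" by auto
  then show ?case
    unfolding ev_single by (intro graded_mult[OF graded_rconst graded_eval_mono])
qed (simp_all add: ev_zero graded_zero ev_add graded_add)

text \<open>The quotient in \<open>r\<close> costs two degrees, one of which the factor
  \<open>x\<close> restores. The quotient in \<open>s_i\<close> costs one, and \<open>y_i\<close>
  has degree 0.\<close>

lemma graded_scalar_deriv: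
  assumes "A \<in> A_hom N n e"
  shows "sd A \<in> graded (int n - int e - 1)"
proof -
  have "rconst (1 + qq) * xv x \<in> graded 1"
    by (rule graded_mult[OF graded_rconst graded_xv]) simp
  moreover have "E (jackson_delta RV (qq\<^sup>2) A) \<in> graded (int n - int (e + 2))"
    using graded_ev[OF jackson_delta_A_hom[OF one_minus_qq2 assms], of RV] by (simp add: xdeg_single')
  ultimately have 1: "rconst (1 + qq) * xv x * E (jackson_delta RV (qq\<^sup>2) A) \<in> graded (int n - int e - 1)"
    by (rule graded_mult) simp
  have "yv y i * E (jackson_T RV (qq\<^sup>2) (jackson_delta (SV i) qq A)) \<in> graded (int n - int e - 1)"
    if i: "i \<in> {1..N}" for i
  proof -
    have "E (jackson_T RV (qq\<^sup>2) (jackson_delta (SV i) qq A)) \<in> graded (int n - int (e + 1))"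
      using graded_ev[OF jackson_T_A_hom[OF jackson_delta_A_hom[OF one_minus_qq assms]], of RV "qq\<^sup>2" "SV i"]
        xdeg_single(2)[OF i] by (simp add: add.commute)
    then show ?thesis by (rule graded_mult[OF graded_yv[OF i]]) simp
  qed
  then have "(\<Sum>i=1..N. yv y i * E (jackson_T RV (qq\<^sup>2) (jackson_delta (SV i) qq A))) \<in> graded (int n - int e - 1)"
    by (rule graded_sum)
  then have "2 * (\<Sum>i=1..N. yv y i * E (jackson_T RV (qq\<^sup>2) (jackson_delta (SV i) qq A))) \<in> graded (int n - int e - 1)"
    unfolding mult_2 by (intro graded_add)
  with 1 show ?thesis
    unfolding scalar_deriv_def by (rule graded_add)
qed

lemma graded_wedge:
  assumes "\<And>i. i \<in> set ws \<Longrightarrow> F i \<in> graded (d i)"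
  shows "wedge (map F ws) \<in> graded (sum_list (map d ws))"
proof -
  have "of_int (sign \<pi>) * prod_list (map (\<lambda>i. map F ws ! \<pi> i) [0..<length (map F ws)]) \<in> graded (sum_list (map d ws))"
    if \<pi>: "\<pi> permutes {..<length ws}" for \<pi>
  proof -
    have eq: "map (\<lambda>i. map F ws ! \<pi> i) [0..<length (map F ws)] = map F (permute_list \<pi> ws)"
      using \<pi> by (simp add: permute_list_map[symmetric] permute_list_def[of _ "map F ws"])
    have "prod_list (map F (permute_list \<pi> ws)) \<in> graded (sum_list (map d (permute_list \<pi> ws)))"
      using assms \<pi> by (intro graded_prod_list) simp
    also have "sum_list (map d (permute_list \<pi> ws)) = sum_list (map d ws)"
      using \<pi> by (simp only: sum_mset_sum_list[symmetric] mset_map mset_permute_list)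
    finally show ?thesis
      unfolding eq by (intro graded_mult[OF graded_rconst[of "of_int (sign \<pi>)", unfolded rconst_of_int]]) simp_all
  qed
  then show ?thesis
    unfolding wedge_def by (intro graded_mult[OF graded_rconst graded_sum]) auto
qed

lemma graded_y_wedge: "I \<subseteq> {1..N} \<Longrightarrow> y_wedge y I \<in> graded 0"
proof -
  assume I: "I \<subseteq> {1..N}"
  then have fin: "finite I" using finite_subset by blast
  have "y_wedge y I \<in> graded (sum_list (map (\<lambda>i. 0) (sorted_list_of_set I)))"
    unfolding y_wedge_def using I fin by (intro graded_wedge graded_yv) auto
  then show ?thesis by simp
qed

lemma graded_xy_wedge: "I \<subseteq> {1..N} \<Longrightarrow> xy_wedge x y I \<in> graded 1"
proof -
  assume I: "I \<subseteq> {1..N}"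
  then have fin: "finite I" using finite_subset by blast
  have nz: "0 \<notin> set (sorted_list_of_set I)" using I fin by auto
  have "map (rvec x y) (sorted_list_of_set I) = map (yv y) (sorted_list_of_set I)"
    using I fin by (auto simp: rvec_def)
  then have "xy_wedge x y I = wedge (map (rvec x y) (0 # sorted_list_of_set I))"
    by (simp only: xy_wedge_def list.map) (simp add: rvec_def)
  also have "\<dots> \<in> graded (sum_list (map (\<lambda>i. if i = 0 then 1 else 0) (0 # sorted_list_of_set I)))"
    using I fin by (intro graded_wedge) (auto simp: rvec_def intro!: graded_xv graded_yv)
  also have "sum_list (map (\<lambda>i. if i = 0 then 1 else 0) (0 # sorted_list_of_set I)) = (1 :: int)"
  proof -
    have "map (\<lambda>i. if i = 0 then 1 else 0 :: int) (sorted_list_of_set I) = map (\<lambda>i. 0) (sorted_list_of_set I)"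
      by (rule map_cong) (use nz in metis)+
    then show ?thesis by (simp only: list.map) simp
  qed
  finally show ?thesis .
qed

text \<open>Wedges and scalars are sums of words of known degree, which gives one inclusion; the
  other is spanning, in the form that a word lies in the block of its degree. The description by
  words makes products homogeneous at once.\<close>

lemma H_eq_graded: "H n = graded (int n)"
proof
  show "H n \<subseteq> graded (int n)"
  proof
    fix F assume "F \<in> H n"
    then obtain A B where AB: "\<And>I. I \<subseteq> {1..N} \<Longrightarrow> A I \<in> A_hom N n 0" "\<And>I. I \<subseteq> {1..N} \<Longrightarrow> B I \<in> A_hom N n 1"
      "F = (\<Sum>I\<in>Pow {1..N}. y_wedge y I * E (A I) + xy_wedge x y I * E (B I))"
      by (rule H_blockE) blast
    show "F \<in> graded (int n)"
      unfolding AB(3)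
    proof (intro graded_sum graded_add)
      fix I assume "I \<in> Pow {1..N}"
      then have I: "I \<subseteq> {1..N}" by simp
      show "y_wedge y I * E (A I) \<in> graded (int n)"
        by (rule graded_mult[OF graded_y_wedge[OF I] graded_ev[OF AB(1)[OF I]]]) simp
      show "xy_wedge x y I * E (B I) \<in> graded (int n)"
        by (rule graded_mult[OF graded_xy_wedge[OF I] graded_ev[OF AB(2)[OF I]]]) simp
    qed
  qed
  show "graded (int n) \<subseteq> H n"
  proof
    fix F assume "F \<in> graded (int n)"
    then obtain f where F: "F = abs_radial f" and f: "Poly_Mapping.keys f \<subseteq> {w. count_list w x = n}"
      by (auto simp: graded_def)
    show "F \<in> H n"
      unfolding F using f
    proof (induction f rule: poly_mapping_keys_induct)
      case zero
      show ?case unfolding zero_radial_def[symmetric] by (rule H_block_zero)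
    next
      case (add f g)
      then show ?case unfolding abs_radial_add by (rule H_block_add)
    next
      case (single w c)
      then show ?case
        unfolding abs_radial_single using word_in_H[of w] by (intro H_block_rconst) simp
    qed
  qed
qed

lemma H_mult_x: "F \<in> H n \<Longrightarrow> F * xv x \<in> H (n + 1)"
  unfolding H_eq_graded by (erule graded_mult[OF _ graded_xv]) simp

lemma deriv_H:
  assumes "F \<in> H (n + 1)"
  shows "deriv F \<in> H n"
proof -
  obtain A B where AB: "\<And>I. I \<subseteq> {1..N} \<Longrightarrow> A I \<in> A_hom N (n + 1) 0" "\<And>I. I \<subseteq> {1..N} \<Longrightarrow> B I \<in> A_hom N (n + 1) 1"
    "F = combination A B"
    using assms unfolding combination_def by (rule H_blockE) blast
  have "deriv F = deriv_combination A B"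
    unfolding AB(3) using AB(1,2) by (intro deriv_combination) (auto simp: coeffs_def intro: A_hom_sub)
  also have "\<dots> \<in> graded (int n)"
    unfolding deriv_combination_def
  proof (intro graded_sum graded_add)
    fix I assume "I \<in> Pow {1..N}"
    then have I: "I \<subseteq> {1..N}" by simp
    show "y_wedge y I * sd (A I) \<in> graded (int n)"
      by (rule graded_mult[OF graded_y_wedge[OF I] graded_scalar_deriv[OF AB(1)[OF I]]]) simp
    show "bracket I * y_wedge y I * E (B I) \<in> graded (int n)"
      unfolding bracket_rconst
      by (rule graded_mult[OF graded_mult[OF graded_rconst graded_y_wedge[OF I] refl] graded_ev[OF AB(2)[OF I]]]) simp
    show "qpow I * xy_wedge x y I * sd (B I) \<in> graded (int n)"
      unfolding qpow_def
      by (rule graded_mult[OF graded_mult[OF graded_rconst graded_xy_wedge[OF I] refl] graded_scalar_deriv[OF AB(2)[OF I]]]) simp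
  qed
  finally show ?thesis by (simp add: H_eq_graded)
qed

end

section \<open>Coordinates of homogeneous blocks\<close>

definition rs_monomials :: "nat \<Rightarrow> nat \<Rightarrow> nat \<Rightarrow> (svar \<Rightarrow>\<^sub>0 nat) set" where
  "rs_monomials N n e = {m. Poly_Mapping.keys m \<subseteq> RS_vars N \<and> e + xdeg N m = n}"

lemma lookup_le_xdeg:
  assumes "u \<in> RS_vars N"
  shows "Poly_Mapping.lookup m u \<le> xdeg N m"
  using assms member_le_sum[of _ "{1..N}" "\<lambda>i. Poly_Mapping.lookup m (SV i)"]
  by (fastforce simp: RS_vars_def xdeg_def intro: le_trans)

text \<open>As \<open>r\<close> and all \<open>s_i\<close> have positive degree, every exponent is
  bounded by the total degree.\<close>

lemma finite_rs_monomials: "finite (rs_monomials N n e)"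
proof (rule finite_imageD)
  let ?F = "{f. \<forall>u. (u \<in> RS_vars N \<longrightarrow> f u \<in> {..n}) \<and> (u \<notin> RS_vars N \<longrightarrow> f u = (0::nat))}"
  have "finite ?F"
    by (rule finite_set_of_finite_funs) (simp_all add: RS_vars_def)
  moreover have "Poly_Mapping.lookup ` rs_monomials N n e \<subseteq> ?F"
  proof clarify
    fix m u assume m: "m \<in> rs_monomials N n e"
    then have "xdeg N m \<le> n" "u \<notin> RS_vars N \<Longrightarrow> u \<notin> Poly_Mapping.keys m"
      by (auto simp: rs_monomials_def)
    then show "(u \<in> RS_vars N \<longrightarrow> Poly_Mapping.lookup m u \<in> {..n}) \<and>
        (u \<notin> RS_vars N \<longrightarrow> Poly_Mapping.lookup m u = 0)"
      using lookup_le_xdeg[of u N m] by (auto simp: in_keys_iff)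
  qed
  ultimately show "finite (Poly_Mapping.lookup ` rs_monomials N n e)"
    by (rule rev_finite_subset)
  show "inj_on Poly_Mapping.lookup (rs_monomials N n e)"
    by (auto intro: inj_onI poly_mapping_eqI)
qed

text \<open>The monomials are collected according to their part in \<open>r\<close> and the
  \<open>s_i\<close>. This part carries the whole degree because the \<open>c_ij\<close> have degree
  0.\<close>

lemma rs_expansion_ex:
  assumes "A \<in> A_hom N n e"
  shows "\<exists>t. (\<forall>m. t m \<in> T_alg N) \<and> A = (\<Sum>m\<in>rs_monomials N n e. Poly_Mapping.single m 1 * t m)"
proof -
  let ?rs = "restrict_exp (RS_vars N)" and ?c = "restrict_exp (C_vars N)"
  define t where "t m = (\<Sum>k\<in>{k \<in> Poly_Mapping.keys A. ?rs k = m}.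
    Poly_Mapping.single (?c k) (Poly_Mapping.lookup A k))" for m
  have "t m \<in> T_alg N" for m
    unfolding t_def T_alg_supported by (intro supported_sum supported_single) (simp add: keys_restrict_exp)
  moreover have "(\<Sum>m\<in>rs_monomials N n e. Poly_Mapping.single m 1 * t m) = A"
  proof -
    have keys: "Poly_Mapping.keys k \<subseteq> RS_vars N \<union> C_vars N" "e + xdeg N k = n" if "k \<in> Poly_Mapping.keys A" for k
      using assms that by (auto simp: A_hom_def A_alg_def)
    have split: "?rs k + ?c k = k" if "k \<in> Poly_Mapping.keys A" for k
      using restrict_exp_split[OF keys(1)[OF that] RS_C_disjoint] by simp
    have "xdeg N (?rs k) = xdeg N k" if "k \<in> Poly_Mapping.keys A" for k
      using xdeg_add[of N "?rs k" "?c k"] split[OF that] xdeg_C[of "?c k" N] by (simp add: keys_restrict_exp)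
    then have rs: "?rs ` Poly_Mapping.keys A \<subseteq> rs_monomials N n e"
      using keys by (auto simp: rs_monomials_def keys_restrict_exp)
    have "(\<Sum>m\<in>rs_monomials N n e. Poly_Mapping.single m 1 * t m) =
        (\<Sum>m\<in>rs_monomials N n e. \<Sum>k\<in>{k \<in> Poly_Mapping.keys A. ?rs k = m}. Poly_Mapping.single k (Poly_Mapping.lookup A k))"
      unfolding t_def sum_distrib_left
      by (intro sum.cong refl) (auto simp: mult_single split)
    also have "\<dots> = (\<Sum>k\<in>Poly_Mapping.keys A. Poly_Mapping.single k (Poly_Mapping.lookup A k))"
      by (rule sum.group[OF finite_keys finite_rs_monomials rs])
    finally show ?thesis by (simp only: poly_mapping_sum_single[symmetric])
  qed
  ultimately show ?thesis by (intro exI[of _ t]) simp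
qed

text \<open>If \<open>n\<close> involves only the \<open>c_ij\<close>, restricting
  \<open>m + n\<close> to the variables \<open>r\<close> and \<open>s_i\<close> recovers
  \<open>m\<close>; so only one summand contributes to the coefficient at
  \<open>m + n\<close>.\<close>

lemma rs_expansion_inj:
  assumes t: "\<And>m. m \<in> M \<Longrightarrow> t m \<in> T_alg N" and M: "finite M" "\<And>m. m \<in> M \<Longrightarrow> Poly_Mapping.keys m \<subseteq> RS_vars N"
    and zero: "(\<Sum>m\<in>M. Poly_Mapping.single m 1 * t m) = 0" and m: "m \<in> M"
  shows "t m = 0"
proof (rule poly_mapping_eqI)
  fix n
  show "Poly_Mapping.lookup (t m) n = Poly_Mapping.lookup 0 n"
  proof (cases "Poly_Mapping.keys n \<subseteq> C_vars N")
    case True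
    have "Poly_Mapping.lookup (Poly_Mapping.single m' 1 * t m') (m + n) =
        (if m' = m then Poly_Mapping.lookup (t m) n else 0)" if m': "m' \<in> M" for m'
    proof (cases "m' = m")
      case False
      have "Poly_Mapping.lookup (Poly_Mapping.single m' 1 * t m') (m + n) = 0"
      proof (rule lookup_single_mult_eq_0)
        fix n' assume "n' \<in> Poly_Mapping.keys (t m')"
        then have n': "Poly_Mapping.keys n' \<subseteq> C_vars N" using t[OF m'] by (auto simp: T_alg_def)
        have C: "restrict_exp (RS_vars N) k = 0" if "Poly_Mapping.keys k \<subseteq> C_vars N" for k
          using that RS_C_disjoint[of N] by (intro restrict_exp_disjoint) blast
        show "m + n \<noteq> m' + n'"
        proof
          assume "m + n = m' + n'"
          then have "restrict_exp (RS_vars N) (m + n) = restrict_exp (RS_vars N) (m' + n')" by simp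
          then have "m = m'"
            using M(2)[OF m] M(2)[OF m'] by (simp add: restrict_exp_add restrict_exp_id C True n')
          with False show False by simp
        qed
      qed
      with False show ?thesis by simp
    qed (simp add: lookup_single_mult)
    then have "Poly_Mapping.lookup (\<Sum>m\<in>M. Poly_Mapping.single m 1 * t m) (m + n) =
        (\<Sum>m'\<in>M. if m' = m then Poly_Mapping.lookup (t m) n else 0)"
      by (simp add: lookup_sum)
    then show ?thesis using zero m M(1) by simp
  next
    case False
    then have "n \<notin> Poly_Mapping.keys (t m)" using t[OF m] by (auto simp: T_alg_def)
    then show ?thesis by (simp add: in_keys_iff)
  qed
qed

context radial_vars
begin

abbreviation "B_index \<equiv> H_basis_index N"
abbreviation "basis \<equiv> H_basis x y N"

lemma finite_B_index: "finite (B_index n)"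
proof -
  have "B_index n \<subseteq> UNIV \<times> Pow {1..N} \<times> (rs_monomials N n 0 \<union> rs_monomials N n 1)"
    by (auto simp: H_basis_index_def rs_monomials_def)
  then show ?thesis by (rule finite_subset) (simp add: finite_rs_monomials)
qed

lemma sum_B_index:
  "sum f (B_index n) = (\<Sum>I\<in>Pow {1..N}. (\<Sum>m\<in>rs_monomials N n 0. f (False, I, m)) + (\<Sum>m\<in>rs_monomials N n 1. f (True, I, m)))"
proof -
  have eq: "B_index n = Pair False ` (Pow {1..N} \<times> rs_monomials N n 0) \<union> Pair True ` (Pow {1..N} \<times> rs_monomials N n 1)"
  proof (rule Set.set_eqI)
    fix b :: "bool \<times> nat set \<times> (svar \<Rightarrow>\<^sub>0 nat)"
    obtain e I m where "b = (e, I, m)" by (cases b)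
    then show "b \<in> B_index n \<longleftrightarrow> b \<in> Pair False ` (Pow {1..N} \<times> rs_monomials N n 0) \<union> Pair True ` (Pow {1..N} \<times> rs_monomials N n 1)"
      by (cases e) (auto simp: H_basis_index_def rs_monomials_def image_iff)
  qed
  have "sum f (B_index n) = sum f (Pair False ` (Pow {1..N} \<times> rs_monomials N n 0)) + sum f (Pair True ` (Pow {1..N} \<times> rs_monomials N n 1))"
    unfolding eq by (rule sum.union_disjoint) (auto simp: finite_rs_monomials)
  then show ?thesis
    by (simp add: sum.reindex inj_on_def sum.cartesian_product[symmetric] sum.distrib case_prod_unfold o_def sum.cartesian_product')
qed

lemma E_monomial: "E (Poly_Mapping.single m 1 * t) = eval_mono x y N m * E t"
  by (simp add: ev_mult ev_single rconst_1)

lemma sum_basis: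
  "(\<Sum>b\<in>B_index n. basis b * E (c b)) = combination
    (\<lambda>I. \<Sum>m\<in>rs_monomials N n 0. Poly_Mapping.single m 1 * c (False, I, m))
    (\<lambda>I. \<Sum>m\<in>rs_monomials N n 1. Poly_Mapping.single m 1 * c (True, I, m))"
  unfolding sum_B_index combination_def
  by (intro sum.cong refl) (simp add: H_basis_def ev_sum E_monomial sum_distrib_left mult.assoc)

lemma basis_span:
  assumes "F \<in> H n"
  shows "\<exists>c. (\<forall>b. c b \<in> T_alg N) \<and> F = (\<Sum>b\<in>B_index n. basis b * E (c b))"
proof -
  obtain A B where AB: "\<And>I. I \<subseteq> {1..N} \<Longrightarrow> A I \<in> A_hom N n 0" "\<And>I. I \<subseteq> {1..N} \<Longrightarrow> B I \<in> A_hom N n 1"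
    "F = combination A B"
    using assms unfolding combination_def by (rule H_blockE) blast
  have "\<forall>I. \<exists>t. I \<subseteq> {1..N} \<longrightarrow> (\<forall>m. t m \<in> T_alg N) \<and> A I = (\<Sum>m\<in>rs_monomials N n 0. Poly_Mapping.single m 1 * t m)"
    using rs_expansion_ex[OF AB(1)] by blast
  then obtain tA where tA: "\<And>I. I \<subseteq> {1..N} \<Longrightarrow> (\<forall>m. tA I m \<in> T_alg N) \<and> A I = (\<Sum>m\<in>rs_monomials N n 0. Poly_Mapping.single m 1 * tA I m)"
    by metis
  have "\<forall>I. \<exists>t. I \<subseteq> {1..N} \<longrightarrow> (\<forall>m. t m \<in> T_alg N) \<and> B I = (\<Sum>m\<in>rs_monomials N n 1. Poly_Mapping.single m 1 * t m)"
    using rs_expansion_ex[OF AB(2)] by blast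
  then obtain tB where tB: "\<And>I. I \<subseteq> {1..N} \<Longrightarrow> (\<forall>m. tB I m \<in> T_alg N) \<and> B I = (\<Sum>m\<in>rs_monomials N n 1. Poly_Mapping.single m 1 * tB I m)"
    by metis
  \<comment> \<open>The default 0 keeps the value in \<open>T_alg N\<close> for index sets outside
    \<open>{1..N}\<close>, where nothing is known about the chosen expansions.\<close>
  define c where "c = (\<lambda>(e, I, m). if I \<subseteq> {1..N} then if e then tB I m else tA I m else 0)"
  have "c b \<in> T_alg N" for b
    using tA tB by (cases b) (simp add: c_def T_alg_closed)
  moreover have "F = (\<Sum>b\<in>B_index n. basis b * E (c b))"
    unfolding AB(3) sum_basis combination_def
    by (intro sum.cong refl) (use tA tB in \<open>simp add: c_def\<close>)
  ultimately show ?thesis by blast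
qed

text \<open>Independence in two stages: the wedges over the scalar polynomials, then the monomials
  in \<open>r\<close> and the \<open>s_i\<close> over the polynomials in the
  \<open>c_ij\<close>.\<close>

lemma basis_independent:
  assumes c: "\<And>b. b \<in> B_index n \<Longrightarrow> c b \<in> T_alg N"
    and zero: "(\<Sum>b\<in>B_index n. basis b * E (c b)) = 0" and b: "b \<in> B_index n"
  shows "c b = 0"
proof -
  let ?A = "\<lambda>I. \<Sum>m\<in>rs_monomials N n 0. Poly_Mapping.single m 1 * c (False, I, m)"
  let ?B = "\<lambda>I. \<Sum>m\<in>rs_monomials N n 1. Poly_Mapping.single m 1 * c (True, I, m)"
  have cT: "c (False, I, m) \<in> T_alg N" if "I \<subseteq> {1..N}" "m \<in> rs_monomials N n 0" for I m
    using that by (intro c) (simp add: H_basis_index_def rs_monomials_def)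
  have cT': "c (True, I, m) \<in> T_alg N" if "I \<subseteq> {1..N}" "m \<in> rs_monomials N n 1" for I m
    using that by (intro c) (simp add: H_basis_index_def rs_monomials_def)
  have mono: "Poly_Mapping.single m 1 \<in> A_alg N" if "m \<in> rs_monomials N n e" for m e
    unfolding A_alg_supported using that by (intro supported_single) (auto simp: rs_monomials_def)
  have sum_A: "sum f M \<in> A_alg N" if "\<And>m. m \<in> M \<Longrightarrow> f m \<in> A_alg N" for f :: "(svar \<Rightarrow>\<^sub>0 nat) \<Rightarrow> spoly" and M
    using that unfolding A_alg_supported by (rule supported_sum)
  have "coeffs ?A"
    unfolding coeffs_def using cT by (intro allI impI sum_A A_alg_closed(4)) (blast intro: mono T_alg_sub)+
  moreover have "coeffs ?B"
    unfolding coeffs_def using cT' by (intro allI impI sum_A A_alg_closed(4)) (blast intro: mono T_alg_sub)+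
  moreover have "combination ?A ?B = combination (\<lambda>I. 0) (\<lambda>I. 0)"
    using zero unfolding sum_basis by (simp add: combination_def ev_zero)
  ultimately have AB: "?A I = 0" "?B I = 0" if "I \<subseteq> {1..N}" for I
    using combination_inj[of ?A ?B "\<lambda>I. 0" "\<lambda>I. 0" I] that by (simp_all add: coeffs_delta(2))
  obtain e I m where bI: "b = (e, I, m)" "I \<subseteq> {1..N}" "m \<in> rs_monomials N n (of_bool e)"
    using b by (auto simp: H_basis_index_def rs_monomials_def)
  have keys: "\<And>m e. m \<in> rs_monomials N n e \<Longrightarrow> Poly_Mapping.keys m \<subseteq> RS_vars N"
    by (simp add: rs_monomials_def)
  show ?thesis
  proof (cases e)
    case True
    then have "m \<in> rs_monomials N n 1" using bI by simp
    then show ?thesis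
      using rs_expansion_inj[where t = "\<lambda>m. c (True, I, m)", OF _ finite_rs_monomials keys AB(2)[OF bI(2)]]
        cT'[OF bI(2)] bI(1) True by simp
  next
    case False
    then have "m \<in> rs_monomials N n 0" using bI by simp
    then show ?thesis
      using rs_expansion_inj[where t = "\<lambda>m. c (False, I, m)", OF _ finite_rs_monomials keys AB(1)[OF bI(2)]]
        cT[OF bI(2)] bI(1) False by simp
  qed
qed

lemma H_coords:
  assumes "F \<in> H n"
  shows "b \<in> B_index n \<Longrightarrow> H_coords x y N n F b \<in> T_alg N"
    and "F = (\<Sum>b\<in>B_index n. basis b * E (H_coords x y N n F b))"
proof -
  let ?P = "\<lambda>c. c \<in> B_index n \<rightarrow>\<^sub>E T_alg N \<and> F = (\<Sum>b\<in>B_index n. T_act x y N (c b) (basis b))"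
  obtain c where c: "\<forall>b. c b \<in> T_alg N" "F = (\<Sum>b\<in>B_index n. basis b * E (c b))"
    using basis_span[OF assms] by blast
  \<comment> \<open>Restriction makes the coordinate function extensional; otherwise its values
    outside the index set would spoil uniqueness.\<close>
  have "?P (restrict c (B_index n))"
    using c by (auto simp: T_act_def)
  moreover have "c' = c''" if "?P c'" "?P c''" for c' c''
  proof (rule PiE_ext)
    show "c' \<in> B_index n \<rightarrow>\<^sub>E T_alg N" "c'' \<in> B_index n \<rightarrow>\<^sub>E T_alg N" using that by auto
    fix b assume b: "b \<in> B_index n"
    have "(\<Sum>b\<in>B_index n. basis b * E (c' b + - c'' b)) =
        (\<Sum>b\<in>B_index n. T_act x y N (c' b) (basis b)) - (\<Sum>b\<in>B_index n. T_act x y N (c'' b) (basis b))"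
      by (simp add: T_act_def ev_diff right_diff_distrib sum_subtractf)
    also have "\<dots> = F - F" 
      unfolding conjunct2[OF that(1), symmetric] conjunct2[OF that(2), symmetric] ..
    also have "\<dots> = 0" by simp
    finally have "c' b + - c'' b = 0"
      using b conjunct1[OF that(1)] conjunct1[OF that(2)]
      by (intro basis_independent[of n "\<lambda>b. c' b + - c'' b"] T_alg_closed(3,4)) (rule PiE_mem, assumption+)+
    then show "c' b = c'' b" by simp
  qed
  ultimately have "?P (H_coords x y N n F)"
    unfolding H_coords_def by (intro theI'[of ?P]) blast
  then show "b \<in> B_index n \<Longrightarrow> H_coords x y N n F b \<in> T_alg N"
    "F = (\<Sum>b\<in>B_index n. basis b * E (H_coords x y N n F b))"
    by (auto simp: T_act_def)
qed

section \<open>The determinant\<close>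

lemma basis_in_H: "b \<in> B_index n \<Longrightarrow> basis b \<in> H n"
proof -
  assume "b \<in> B_index n"
  then obtain e I m where b: "b = (e, I, m)" "I \<subseteq> {1..N}" "of_bool e + xdeg N m = n"
    by (auto simp: H_basis_index_def)
  have "y_wedge y I * eval_mono x y N m \<in> graded (int (xdeg N m))"
    by (rule graded_mult[OF graded_y_wedge[OF b(2)] graded_eval_mono]) simp
  moreover have "xy_wedge x y I * eval_mono x y N m \<in> graded (int (1 + xdeg N m))"
    by (rule graded_mult[OF graded_xy_wedge[OF b(2)] graded_eval_mono]) simp
  ultimately show ?thesis
    using b by (cases e) (auto simp: H_basis_def H_eq_graded)
qed

lemma T_alg_det: "M \<in> carrier_mat n n \<Longrightarrow> (\<And>i j. i < n \<Longrightarrow> j < n \<Longrightarrow> M $$ (i, j) \<in> T_alg N) \<Longrightarrow> det M \<in> T_alg N"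
proof -
  assume M: "M \<in> carrier_mat n n" "\<And>i j. i < n \<Longrightarrow> j < n \<Longrightarrow> M $$ (i, j) \<in> T_alg N"
  have sgn: "signof p \<in> T_alg N" for p
    by (simp add: sign_def T_alg_closed)
  show ?thesis
    unfolding det_def'[OF M(1)]
    by (intro T_alg_sum T_alg_closed(5) T_alg_prod sgn M(2)) (auto simp: permutes_in_image)
qed

text \<open>Cramer's rule over a commutative ring. For the matrix \<open>M\<close> of
  \<open>f\<close>, the identity for \<open>M\<close> times its adjugate solves
  \<open>f G = F * E (det M)\<close>; the identity in the opposite order shows that
  \<open>det M\<close> annihilates the kernel.\<close>

lemma H_det:
  assumes f: "\<And>F. F \<in> H n \<Longrightarrow> f F \<in> H n" "\<And>F G. f (F + G) = f F + f G"
    "\<And>t F. t \<in> T_alg N \<Longrightarrow> f (F * E t) = f F * E t"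
  shows "H_det x y N n f \<in> T_alg N"
    and "F \<in> H n \<Longrightarrow> \<exists>G\<in>H n. f G = F * E (H_det x y N n f)"
    and "F \<in> H n \<Longrightarrow> f F = 0 \<Longrightarrow> F * E (H_det x y N n f) = 0"
proof -
  define bs where "bs = (SOME bs. distinct bs \<and> set bs = B_index n)"
  have "\<exists>bs. distinct bs \<and> set bs = B_index n"
    using finite_distinct_list[OF finite_B_index[of n]] by blast
  then have bs: "distinct bs" "set bs = B_index n"
    unfolding bs_def by (rule someI2_ex, simp)+
  define d where "d = length bs"
  define M where "M = mat d d (\<lambda>(i, j). H_coords x y N n (f (basis (bs ! j))) (bs ! i))"
  have det: "H_det x y N n f = det M"
    by (simp add: H_det_def bs_def[symmetric] Let_def M_def d_def)
  have bs_in: "bs ! i \<in> B_index n" if "i < d" for i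
    using that bs nth_mem unfolding d_def by blast
  have M_carrier: "M \<in> carrier_mat d d" by (simp add: M_def)
  have M_T: "M $$ (i, j) \<in> T_alg N" if "i < d" "j < d" for i j
    using that H_coords(1)[OF f(1)[OF basis_in_H[OF bs_in]] bs_in] by (simp add: M_def)
  show D_T: "H_det x y N n f \<in> T_alg N"
    unfolding det using M_carrier M_T by (rule T_alg_det)
  define L where "L = adj_mat M"
  note adj = adj_mat[OF M_carrier, folded L_def]
  \<comment> \<open>The entries of the adjugate are signed minors, so they stay in
    \<open>T_alg N\<close> and are admissible as coordinates.\<close>
  have L_T: "L $$ (i, j) \<in> T_alg N" if "i < d" "j < d" for i j
  proof -
    have "(- 1) ^ k \<in> T_alg N" for k by (intro T_alg_power T_alg_closed)
    moreover have "det (mat_delete M j i) \<in> T_alg N"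
    proof (rule T_alg_det[of _ "d - 1"])
      show "mat_delete M j i \<in> carrier_mat (d - 1) (d - 1)"
        using M_carrier by (simp add: mat_delete_def)
      fix i' j' assume "i' < d - 1" "j' < d - 1"
      then show "mat_delete M j i $$ (i', j') \<in> T_alg N"
        using that M_carrier by (auto simp: mat_delete_def intro!: M_T)
    qed
    ultimately show ?thesis
      using that M_carrier by (simp add: L_def adj_mat_def cofactor_def T_alg_closed)
  qed
  have M_adj: "(\<Sum>j<d. M $$ (i, j) * L $$ (j, l)) = (if i = l then det M else 0)" if "i < d" "l < d" for i l
  proof -
    have "(M * L) $$ (i, l) = (\<Sum>j<d. M $$ (i, j) * L $$ (j, l))"
      using that M_carrier adj(1) by (simp add: scalar_prod_def atLeast0LessThan)
    then show ?thesis using that adj(2) by (cases "i = l") auto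
  qed
  have adj_M: "(\<Sum>j<d. L $$ (i, j) * M $$ (j, l)) = (if i = l then det M else 0)" if "i < d" "l < d" for i l
  proof -
    have "(L * M) $$ (i, l) = (\<Sum>j<d. L $$ (i, j) * M $$ (j, l))"
      using that M_carrier adj(1) by (simp add: scalar_prod_def atLeast0LessThan)
    then show ?thesis using that adj(3) by (cases "i = l") auto
  qed
  define lc where "lc v = (\<Sum>j<d. basis (bs ! j) * E (v j))" for v
  have reindex: "(\<Sum>b\<in>B_index n. g b) = (\<Sum>j<d. g (bs ! j))" for g :: "_ \<Rightarrow> 'v RB"
  proof -
    have "bij_betw ((!) bs) {..<d} (B_index n)"
      using bij_betw_nth[OF bs(1)] bs(2) by (simp add: d_def)
    then show ?thesis by (rule sum.reindex_bij_betw[symmetric])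
  qed
  have f_zero: "f 0 = 0" using f(2)[of 0 0] by simp
  have f_sum: "f (sum g S) = (\<Sum>i\<in>S. f (g i))" for g :: "nat \<Rightarrow> 'v RB" and S
    by (induction S rule: infinite_finite_induct) (simp_all add: f_zero f(2))
  have f_basis: "f (basis (bs ! j)) = (\<Sum>i<d. basis (bs ! i) * E (M $$ (i, j)))" if "j < d" for j
    using H_coords(2)[OF f(1)[OF basis_in_H[OF bs_in[OF that]]]] that
    unfolding reindex by (simp add: M_def)
  have f_lc: "f (lc v) = lc (\<lambda>i. \<Sum>j<d. M $$ (i, j) * v j)" if v: "\<And>j. j < d \<Longrightarrow> v j \<in> T_alg N" for v
  proof -
    have "f (lc v) = (\<Sum>j<d. (\<Sum>i<d. basis (bs ! i) * E (M $$ (i, j))) * E (v j))"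
      unfolding lc_def f_sum by (intro sum.cong refl) (simp add: f(3) v f_basis)
    also have "\<dots> = (\<Sum>j<d. \<Sum>i<d. basis (bs ! i) * E (M $$ (i, j) * v j))"
      by (simp add: sum_distrib_right ev_mult mult.assoc)
    also have "\<dots> = lc (\<lambda>i. \<Sum>j<d. M $$ (i, j) * v j)"
      unfolding lc_def by (subst sum.swap) (simp add: ev_sum sum_distrib_left)
    finally show ?thesis .
  qed
  have lc_scale: "lc v * E a = lc (\<lambda>i. a * v i)" for v a
    by (simp add: lc_def sum_distrib_right mult.assoc mult.commute[of a] ev_mult)
  have lc_H: "lc v \<in> H n" if v: "\<And>j. j < d \<Longrightarrow> v j \<in> T_alg N" for v
  proof -
    have sum_H: "sum g S \<in> H n" if "\<And>j. j \<in> S \<Longrightarrow> g j \<in> H n" for g :: "nat \<Rightarrow> 'v RB" and S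
      using that by (induction S rule: infinite_finite_induct) (auto intro: H_block_zero H_block_add)
    have "basis (bs ! j) * E (v j) \<in> H n" if "j < d" for j
      using H_block_mult_ev[OF basis_in_H[OF bs_in[OF that]] T_alg_hom[OF v[OF that]]] by simp
    then show ?thesis unfolding lc_def by (intro sum_H) simp
  qed
  have lc_zero: "v j = 0" if v: "\<And>j. j < d \<Longrightarrow> v j \<in> T_alg N" and "lc v = 0" "j < d" for v j
  proof -
    \<comment> \<open>Coordinates indexed by positions in the list are carried back to the basis
      indices, where independence is known.\<close>
    define c where "c b = v (inv_into {..<d} ((!) bs) b)" for b
    have inj: "inj_on ((!) bs) {..<d}" using bij_betw_nth[OF bs(1)] by (auto simp: d_def bij_betw_def)
    have c: "c (bs ! j) = v j" if "j < d" for j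
      using that inj by (simp add: c_def)
    have "(\<Sum>b\<in>B_index n. basis b * E (c b)) = 0"
      unfolding reindex using \<open>lc v = 0\<close> by (simp add: lc_def c)
    moreover have "c b \<in> T_alg N" if "b \<in> B_index n" for b
    proof -
      have "b \<in> set bs" using that bs(2) by simp
      then obtain i where "i < d" "b = bs ! i" unfolding in_set_conv_nth d_def by blast
      then show ?thesis using c v by simp
    qed
    ultimately have "c (bs ! j) = 0" by (intro basis_independent[of n c] bs_in \<open>j < d\<close>)
    then show ?thesis using c \<open>j < d\<close> by simp
  qed
  have lc_surj: "\<exists>v. (\<forall>j<d. v j \<in> T_alg N) \<and> F = lc v" if "F \<in> H n" for F
    using H_coords[OF that] bs_in unfolding reindex lc_def
    by (intro exI[of _ "\<lambda>j. H_coords x y N n F (bs ! j)"]) simp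
  show "\<exists>G\<in>H n. f G = F * E (H_det x y N n f)" if F: "F \<in> H n"
  proof -
    obtain v where v: "\<And>j. j < d \<Longrightarrow> v j \<in> T_alg N" "F = lc v" using lc_surj[OF F] by blast
    \<comment> \<open>The coordinates of the preimage: the adjugate applied to those of
      \<open>F\<close>.\<close>
    define w where "w j = (\<Sum>l<d. L $$ (j, l) * v l)" for j
    have w: "w j \<in> T_alg N" if "j < d" for j
      unfolding w_def using that by (intro T_alg_sum T_alg_closed L_T v) auto
    have "(\<Sum>j<d. M $$ (i, j) * w j) = det M * v i" if i: "i < d" for i
    proof -
      have "(\<Sum>j<d. M $$ (i, j) * w j) = (\<Sum>l<d. (\<Sum>j<d. M $$ (i, j) * L $$ (j, l)) * v l)"
        unfolding w_def sum_distrib_left sum_distrib_right by (subst sum.swap) (simp add: mult.assoc)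
      also have "\<dots> = (\<Sum>l<d. if l = i then det M * v i else 0)"
        by (intro sum.cong refl) (auto simp: M_adj[OF i])
      finally show ?thesis using i by simp
    qed
    then have "lc (\<lambda>i. \<Sum>j<d. M $$ (i, j) * w j) = lc (\<lambda>i. det M * v i)"
      unfolding lc_def by simp
    moreover have "f (lc w) = lc (\<lambda>i. \<Sum>j<d. M $$ (i, j) * w j)" by (rule f_lc[OF w])
    ultimately have "f (lc w) = lc (\<lambda>i. det M * v i)" by simp
    moreover have "lc w \<in> H n" by (rule lc_H[OF w])
    ultimately show ?thesis unfolding det v(2) lc_scale by blast
  qed
  show "F * E (H_det x y N n f) = 0" if F: "F \<in> H n" "f F = 0"
  proof -
    obtain v where v: "\<And>j. j < d \<Longrightarrow> v j \<in> T_alg N" "F = lc v" using lc_surj[OF F(1)] by blast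
    have "f (lc v) = lc (\<lambda>i. \<Sum>j<d. M $$ (i, j) * v j)" by (rule f_lc[OF v(1)])
    then have "lc (\<lambda>i. \<Sum>j<d. M $$ (i, j) * v j) = 0" using F(2) v(2) by simp
    then have "(\<Sum>j<d. M $$ (i, j) * v j) = 0" if "i < d" for i
      using that by (intro lc_zero[of "\<lambda>i. \<Sum>j<d. M $$ (i, j) * v j"]) (auto intro!: T_alg_sum T_alg_closed(5) M_T v(1))
    \<comment> \<open>Multiplying \<open>M v = 0\<close> by the adjugate from the left leaves
      \<open>det M\<close> times \<open>v\<close>.\<close>
    then have *: "(\<Sum>i<d. L $$ (l, i) * (\<Sum>j<d. M $$ (i, j) * v j)) = 0" for l
      by simp
    have "det M * v l = 0" if l: "l < d" for l
    proof -
      have "(\<Sum>i<d. L $$ (l, i) * (\<Sum>j<d. M $$ (i, j) * v j)) = (\<Sum>j<d. (\<Sum>i<d. L $$ (l, i) * M $$ (i, j)) * v j)"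
        unfolding sum_distrib_left sum_distrib_right by (subst sum.swap) (simp add: mult.assoc)
      also have "\<dots> = (\<Sum>j<d. if j = l then det M * v l else 0)"
        by (intro sum.cong refl) (auto simp: adj_M[OF l])
      finally show ?thesis using l * by simp
    qed
    then show ?thesis
      unfolding det v(2) lc_scale unfolding lc_def by (simp add: ev_zero)
  qed
qed

end

section \<open>The decomposition of the localised block\<close>

theorem theorem5p6:
  fixes x :: 'v and y :: "nat \<Rightarrow> 'v" and N k :: nat
  assumes "bij_betw y {1..N} (UNIV - {x})"
  shows
    "qderiv_loc x y N k \<in> carrier (H_loc x y N k (k + 1)) \<rightarrow> carrier (H_loc x y N k k) \<and>
     Rx_loc x y N k \<in> carrier (H_loc x y N k k) \<rightarrow> carrier (H_loc x y N k (k + 1)) \<and>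
     internal_direct_sum (T_loc x y N k) (H_loc x y N k (k + 1))
       (monogenic_loc x y N k) (Rx_loc x y N k ` carrier (H_loc x y N k k)) \<and>
     bij_betw (K_loc x y N k) (carrier (H_loc x y N k k)) (carrier (H_loc x y N k k)) \<and>
     (\<forall>U \<in> monogenic_loc x y N k. \<forall>W \<in> Rx_loc x y N k ` carrier (H_loc x y N k k).
       Pi_loc x y N k (U \<oplus>\<^bsub>H_loc x y N k (k + 1)\<^esub> W) = U)"
proof -
  interpret radial_vars x y N by unfold_locales fact
  let ?T = "T_act x y N" and ?D = "D_det x y N k" and ?S = "D_powers x y N k"
  let ?R = "right_mult_x x" and ?K = "K_op x y N"
  have K_eq: "?K = (\<lambda>F. deriv (?R F))"
    by (simp add: fun_eq_iff K_op_def right_qderiv_eq)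
  have R_lin: "?R (F + G) = ?R F + ?R G" "?R (F * E t) = ?R F * E t" for F G t
    by (simp_all add: right_mult_x_def distrib_right mult.assoc centralD[OF central_ev, of "xv x"])
  have R_H: "?R F \<in> H (n + 1)" if "F \<in> H n" for F n
    using H_mult_x[OF that] by (simp add: right_mult_x_def)
  have K_H: "?K F \<in> H k" if "F \<in> H k" for F
    unfolding K_eq by (intro deriv_H R_H that)
  have K_lin: "?K (F + G) = ?K F + ?K G" "t \<in> T_alg N \<Longrightarrow> ?K (F * E t) = ?K F * E t" for F G t
    by (simp_all add: K_eq R_lin deriv_add deriv_mult_T)
  \<comment> \<open>The adjugate argument for \<open>K\<close> on the block of degree
    \<open>k\<close> gives the two torsion properties required by
    \<open>compression\<close>.\<close>
  have D: "?D \<in> T_alg N" "F \<in> H k \<Longrightarrow> \<exists>G\<in>H k. ?K G = F * E ?D"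
    "F \<in> H k \<Longrightarrow> ?K F = 0 \<Longrightarrow> F * E ?D = 0" for F
    unfolding D_det_def by (rule H_det; simp add: K_H K_lin)+
  have S_T: "?S \<subseteq> T_alg N"
    using D(1) by (auto simp: D_powers_def intro: T_alg_power)
  interpret localization ?T "T_alg N" ?S
  proof
    fix a b :: spoly
    assume "a \<in> ?S" "b \<in> ?S"
    then obtain i j where "a = ?D ^ i" "b = ?D ^ j" by (auto simp: D_powers_def)
    then have "a * b = ?D ^ (i + j)" by (simp add: power_add)
    then show "a * b \<in> ?S" by (auto simp: D_powers_def)
  next
    have "1 = ?D ^ 0" by simp
    then show "1 \<in> ?S" unfolding D_powers_def by blast
  next
    fix a b :: spoly and F :: "'v RB"
    \<comment> \<open>\<open>T_act\<close> multiplies from the right, so successive actions reverse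
      the factors; commutativity of the polynomials restores their order.\<close>
    have "E (a * b) = E b * E a" by (simp only: ev_mult[symmetric] mult.commute)
    then show "?T a (?T b F) = ?T (a * b) F" by (simp add: T_act_def mult.assoc)
  qed (use S_T in \<open>simp_all add: T_act_def ev_add ev_one distrib_left distrib_right T_alg_closed\<close>)
  have H_sub: "submod (H n)" for n
    using H_block_mult_ev[of _ x y N n _ 0]
    by (auto simp: submod_def H_block_zero H_block_add H_block_uminus T_act_def dest: T_alg_hom)
  interpret compression ?T "T_alg N" ?S "H (k + 1)" "H k" ?R deriv ?D
  proof
    show "submod (H (k + 1))" "submod (H k)" by (rule H_sub)+
    show "lin (H k) (H (k + 1)) ?R"
      using R_H by (auto simp: lin_def R_lin T_act_def)
    show "lin (H (k + 1)) (H k) deriv"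
      using deriv_H by (auto simp: lin_def deriv_add deriv_mult_T T_act_def)
    show "?D \<in> ?S" unfolding D_powers_def by (rule range_eqI[of _ _ 1]) simp
    show "\<exists>n\<in>H k. deriv (?R n) = ?T ?D m" if "m \<in> H k" for m
      using D(2)[OF that] by (simp add: K_eq T_act_def)
    show "?T ?D m = 0" if "m \<in> H k" "deriv (?R m) = 0" for m
      using D(3)[OF that(1)] that(2) by (simp add: K_eq T_act_def)
  qed
  \<comment> \<open>Identifies the localised operators of the statement with those of the abstract
    setting, the defined derivative being replaced by \<open>deriv\<close>.\<close>
  have loc: "H_loc x y N k n = LM (H n)" "T_loc x y N k = loc_ring ?S (T_alg N)"
    "qderiv_loc x y N k = ld" "Rx_loc x y N k = lR" "K_loc x y N k = lK" for n
    by (simp_all add: H_loc_def T_loc_def qderiv_loc_def Rx_loc_def K_loc_def op_loc_def fun_eq_iff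
        right_qderiv_eq K_eq)
  show ?thesis
    unfolding monogenic_loc_def Pi_loc_def loc
    using ld_in lR_in direct_sum lK_bij projection by auto
qed

end
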